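(* If for every $e_0=(t_0,q_0),\,e_1=(t_1,q_1)\in E$ with $t_0<t_1$ the functional $\mathcal S_{e_0,e_1}$ is coercive, then for every $e_0,e_1\in E$ with $t_0<t_1$ the functional $\mathcal S_{e_0,e_1}$ attains its infimum on $C^1_{e_0,e_1}$.
   Context: Setting. $r\ge 2$; $Q$ is a connected $d$-dimensional ($C^{r+1}$, Hausdorff, paracompact, boundaryless) manifold; $T\subset\mathbb{R}$ is a connected interval, open because the associated spacetime $T\times Q\times\mathbb{R}$ is without boundary; $E=T\times Q$ with points $e=(t,q)$. On $Q$ there are given a time-dependent Riemannian metric $a_t$, a time-dependent 1-form $b_t$ and a function $V(t,q)$, all $C^r$ in $(t,q)\in E$. The Lagrangian is $L(t,q,v)=\frac12 a_t(v,v)+b_t(v)-V(t,q)$. Action functional. For $t_0<t_1$, $\mathcal S_{e_0,e_1}[q]=\int_{t_0}^{t_1}L(t,q(t),\dot q(t))\,dt$ on the set $C^1_{e_0,e_1}$ of $C^1$ curves $q:[t_0,t_1]\to Q$ with $q(t_0)=q_0$, $q(t_1)=q_1$. It is coercive if for every sequence $q_n\in C^1_{e_0,e_1}$ such that $\mathcal S_{e_0,e_1}[q_n]$ is bounded from above, the images $q_n([t_0,t_1])$ are all contained in one compact subset of $Q$. *)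

theory Defs
  imports "HOL-Analysis.Analysis"
begin

section \<open>Functions of class \<open>C\<^sup>k\<close> on open subsets of normed spaces\<close>

text \<open>Only meant for open \<open>S\<close>, where the derivative \<open>f'\<close> is unique.\<close>

primrec Ck_on :: "nat \<Rightarrow> ('a::real_normed_vector \<Rightarrow> 'b::real_normed_vector) \<Rightarrow> 'a set \<Rightarrow> bool" where
  "Ck_on 0 f S \<longleftrightarrow> continuous_on S f"
| "Ck_on (Suc k) f S \<longleftrightarrow>
     (\<exists>f'. (\<forall>x\<in>S. (f has_derivative f' x) (at x)) \<and> (\<forall>v. Ck_on k (\<lambda>x. f' x v) S))"


section \<open>Manifolds\<close>

text \<open>
  The manifold \<open>Q\<close> is the whole type \<open>'q\<close>, with its type class topology; it is modelled on
  \<open>'e\<close>, so that its dimension is \<open>DIM('e)\<close>. A chart is a coordinate domain together with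
  a coordinate map, whose values outside the domain are irrelevant.
\<close>

type_synonym ('q, 'e) chart = "'q set \<times> ('q \<Rightarrow> 'e)"

definition is_chart :: "('q::topological_space, 'e::euclidean_space) chart \<Rightarrow> bool" where
  "is_chart c \<longleftrightarrow> open (fst c) \<and> open (snd c ` fst c) \<and>
     homeomorphism (fst c) (snd c ` fst c) (snd c) (inv_into (fst c) (snd c))"

definition transition :: "('q, 'e) chart \<Rightarrow> ('q, 'e) chart \<Rightarrow> 'e \<Rightarrow> 'e" where
  "transition c c' = snd c' \<circ> inv_into (fst c) (snd c)"

text \<open>The atlas need not be maximal; it determines the differentiable structure.\<close>

definition Ck_atlas :: "nat \<Rightarrow> ('q::topological_space, 'e::euclidean_space) chart set \<Rightarrow> bool" where
  "Ck_atlas k A \<longleftrightarrow> (\<forall>c\<in>A. is_chart c) \<and> (\<Union>c\<in>A. fst c) = UNIV \<and>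
     (\<forall>c\<in>A. \<forall>c'\<in>A. Ck_on k (transition c c') (snd c ` (fst c \<inter> fst c')))"

definition paracompact_space :: "'q topology \<Rightarrow> bool" where
  "paracompact_space X \<longleftrightarrow>
     (\<forall>\<U>. (\<forall>U\<in>\<U>. openin X U) \<and> \<Union>\<U> = topspace X \<longrightarrow>
        (\<exists>\<V>. (\<forall>V\<in>\<V>. openin X V) \<and> \<Union>\<V> = topspace X \<and>
             (\<forall>V\<in>\<V>. \<exists>U\<in>\<U>. V \<subseteq> U) \<and> locally_finite_in X \<V>))"


section \<open>Tangent vectors\<close>

text \<open>
  A tangent vector at \<open>p\<close> assigns to every chart around \<open>p\<close> a coordinate vector, subject to
  the usual transformation law; it is normalised to 0 at the irrelevant arguments.
\<close>

type_synonym ('q, 'e) tvec = "('q, 'e) chart \<Rightarrow> 'e"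

definition charts_at :: "('q, 'e) chart set \<Rightarrow> 'q \<Rightarrow> ('q, 'e) chart set" where
  "charts_at A p = {c \<in> A. p \<in> fst c}"

definition tangent_space :: "('q, 'e::euclidean_space) chart set \<Rightarrow> 'q \<Rightarrow> ('q, 'e) tvec set" where
  "tangent_space A p = {\<xi>.
     (\<forall>c\<in>charts_at A p. \<forall>c'\<in>charts_at A p.
        \<xi> c' = frechet_derivative (transition c c') (at (snd c p)) (\<xi> c)) \<and>
     (\<forall>c. c \<notin> charts_at A p \<longrightarrow> \<xi> c = 0)}"

definition lincomb :: "real \<Rightarrow> ('q, 'e::real_vector) tvec \<Rightarrow> real \<Rightarrow> ('q, 'e) tvec \<Rightarrow> ('q, 'e) tvec" where
  "lincomb s \<xi> u \<eta> = (\<lambda>c. s *\<^sub>R \<xi> c + u *\<^sub>R \<eta> c)"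

text \<open>The tangent vector at \<open>p\<close> whose coordinate vector in the chart \<open>c\<close> around \<open>p\<close> is \<open>v\<close>.\<close>

definition coord_vec ::
    "('q, 'e::euclidean_space) chart set \<Rightarrow> ('q, 'e) chart \<Rightarrow> 'q \<Rightarrow> 'e \<Rightarrow> ('q, 'e) tvec" where
  "coord_vec A c p v = (\<lambda>c'. if c' \<in> charts_at A p
     then frechet_derivative (transition c c') (at (snd c p)) v else 0)"


section \<open>Time-dependent functions, 1-forms and Riemannian metrics\<close>

text \<open>
  Being of class \<open>C\<^sup>r\<close> in \<open>(t, q)\<close> means that the components in every chart are \<open>C\<^sup>r\<close>
  functions of time and of the coordinates jointly.
\<close>

definition Cr_function ::
    "nat \<Rightarrow> ('q, 'e::euclidean_space) chart set \<Rightarrow> real set \<Rightarrow> (real \<Rightarrow> 'q \<Rightarrow> real) \<Rightarrow> bool" where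
  "Cr_function r A T V \<longleftrightarrow>
     (\<forall>c\<in>A. Ck_on r (\<lambda>(t, x). V t (inv_into (fst c) (snd c) x)) (T \<times> snd c ` fst c))"

definition Cr_one_form ::
    "nat \<Rightarrow> ('q, 'e::euclidean_space) chart set \<Rightarrow> real set
      \<Rightarrow> (real \<Rightarrow> 'q \<Rightarrow> ('q, 'e) tvec \<Rightarrow> real) \<Rightarrow> bool" where
  "Cr_one_form r A T b \<longleftrightarrow>
     (\<forall>t\<in>T. \<forall>p. \<forall>\<xi>\<in>tangent_space A p. \<forall>\<eta>\<in>tangent_space A p. \<forall>s u.
        b t p (lincomb s \<xi> u \<eta>) = s * b t p \<xi> + u * b t p \<eta>) \<and>
     (\<forall>c\<in>A. \<forall>v. Ck_on r
        (\<lambda>(t, x). let p = inv_into (fst c) (snd c) x in b t p (coord_vec A c p v))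
        (T \<times> snd c ` fst c))"

definition Cr_riemannian_metric ::
    "nat \<Rightarrow> ('q, 'e::euclidean_space) chart set \<Rightarrow> real set
      \<Rightarrow> (real \<Rightarrow> 'q \<Rightarrow> ('q, 'e) tvec \<Rightarrow> ('q, 'e) tvec \<Rightarrow> real) \<Rightarrow> bool" where
  "Cr_riemannian_metric r A T a \<longleftrightarrow>
     (\<forall>t\<in>T. \<forall>p. \<forall>\<xi>\<in>tangent_space A p. \<forall>\<eta>\<in>tangent_space A p. a t p \<xi> \<eta> = a t p \<eta> \<xi>) \<and>
     (\<forall>t\<in>T. \<forall>p. \<forall>\<xi>\<in>tangent_space A p. \<forall>\<eta>\<in>tangent_space A p. \<forall>\<zeta>\<in>tangent_space A p. \<forall>s u.
        a t p (lincomb s \<xi> u \<eta>) \<zeta> = s * a t p \<xi> \<zeta> + u * a t p \<eta> \<zeta>) \<and>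
     (\<forall>t\<in>T. \<forall>p. \<forall>\<xi>\<in>tangent_space A p. \<xi> \<noteq> (\<lambda>c. 0) \<longrightarrow> a t p \<xi> \<xi> > 0) \<and>
     (\<forall>c\<in>A. \<forall>v w. Ck_on r
        (\<lambda>(t, x). let p = inv_into (fst c) (snd c) x
                  in a t p (coord_vec A c p v) (coord_vec A c p w))
        (T \<times> snd c ` fst c))"


section \<open>The action functional\<close>

text \<open>
  \<open>C\<^sup>1\<close> curves on the closed interval \<open>[t0, t1]\<close>, with one-sided derivatives at the end points.
  Curves are total functions; their values outside \<open>[t0, t1]\<close> play no role.
\<close>

definition C1_curve ::
    "('q::topological_space, 'e::euclidean_space) chart set \<Rightarrow> real \<Rightarrow> real \<Rightarrow> (real \<Rightarrow> 'q) \<Rightarrow> bool" where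
  "C1_curve A t0 t1 q \<longleftrightarrow> continuous_on {t0..t1} q \<and>
     (\<forall>c\<in>A. \<exists>D. continuous_on {t\<in>{t0..t1}. q t \<in> fst c} D \<and>
        (\<forall>t\<in>{t\<in>{t0..t1}. q t \<in> fst c}.
           ((snd c \<circ> q) has_vector_derivative D t) (at t within {t0..t1})))"

definition C1_curves ::
    "('q::topological_space, 'e::euclidean_space) chart set \<Rightarrow> real \<times> 'q \<Rightarrow> real \<times> 'q
      \<Rightarrow> (real \<Rightarrow> 'q) set" where
  "C1_curves A e0 e1 =
     {q. C1_curve A (fst e0) (fst e1) q \<and> q (fst e0) = snd e0 \<and> q (fst e1) = snd e1}"

definition velocity ::
    "('q, 'e::euclidean_space) chart set \<Rightarrow> real \<Rightarrow> real \<Rightarrow> (real \<Rightarrow> 'q) \<Rightarrow> real \<Rightarrow> ('q, 'e) tvec" where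
  "velocity A t0 t1 q t = (\<lambda>c. if c \<in> charts_at A (q t)
     then vector_derivative (snd c \<circ> q) (at t within {t0..t1}) else 0)"

definition lagrangian ::
    "(real \<Rightarrow> 'q \<Rightarrow> ('q, 'e) tvec \<Rightarrow> ('q, 'e) tvec \<Rightarrow> real) \<Rightarrow> (real \<Rightarrow> 'q \<Rightarrow> ('q, 'e) tvec \<Rightarrow> real)
      \<Rightarrow> (real \<Rightarrow> 'q \<Rightarrow> real) \<Rightarrow> real \<Rightarrow> 'q \<Rightarrow> ('q, 'e) tvec \<Rightarrow> real" where
  "lagrangian a b V t p \<xi> = 1/2 * a t p \<xi> \<xi> + b t p \<xi> - V t p"

definition action ::
    "('q, 'e::euclidean_space) chart set
      \<Rightarrow> (real \<Rightarrow> 'q \<Rightarrow> ('q, 'e) tvec \<Rightarrow> ('q, 'e) tvec \<Rightarrow> real) \<Rightarrow> (real \<Rightarrow> 'q \<Rightarrow> ('q, 'e) tvec \<Rightarrow> real)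
      \<Rightarrow> (real \<Rightarrow> 'q \<Rightarrow> real) \<Rightarrow> real \<times> 'q \<Rightarrow> real \<times> 'q \<Rightarrow> (real \<Rightarrow> 'q) \<Rightarrow> real" where
  "action A a b V e0 e1 q =
     integral {fst e0..fst e1}
       (\<lambda>t. lagrangian a b V t (q t) (velocity A (fst e0) (fst e1) q t))"

definition coercive_on :: "(real \<Rightarrow> 'q::topological_space) set \<Rightarrow> real \<Rightarrow> real
      \<Rightarrow> ((real \<Rightarrow> 'q) \<Rightarrow> real) \<Rightarrow> bool" where
  "coercive_on C t0 t1 S \<longleftrightarrow>
     (\<forall>q :: nat \<Rightarrow> real \<Rightarrow> 'q. (\<forall>n. q n \<in> C) \<and> bdd_above (range (\<lambda>n. S (q n))) \<longrightarrow>
        (\<exists>K. compact K \<and> (\<forall>n. q n ` {t0..t1} \<subseteq> K)))"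

text \<open>The infimum is taken in the extended reals, where it always exists.\<close>

definition attains_infimum_on :: "'c set \<Rightarrow> ('c \<Rightarrow> real) \<Rightarrow> bool" where
  "attains_infimum_on C S \<longleftrightarrow> (\<exists>q\<in>C. ereal (S q) = (INF p\<in>C. ereal (S p)))"

end

theory Submission
  imports Defs "HOL-Complex_Analysis.Great_Picard"
begin

text \<open>
  The direct method, carried out with \<open>C\<^sup>1\<close> curves only. By coercivity a minimising sequence stays in a
  compact set, where the Lagrangian is bounded below by a multiple of the squared speed; so short
  pieces of all its curves lie in a common chart and have bounded energy. In a chart the first
  variation of a near-minimiser is small, hence (du Bois-Reymond) its momentum \<open>L\<^sub>v\<close> differs from a
  constant plus \<open>\<integral> L\<^sub>x\<close> by little in the mean square. The latter functions are asymptotically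
  equi-Lipschitz, and so converge uniformly along a subsequence; inverting the Legendre transform
  yields a continuous limit velocity, to which the velocities converge in the mean square. Thus the
  limit curve is \<open>C\<^sup>1\<close> and its action is the limit of the actions, without any appeal to Sobolev
  spaces, regularity theory or the solution of the Euler-Lagrange equation. The set of competitors is
  not empty because \<open>Q\<close> is connected.
\<close>

section \<open>Mean-square estimates and compactness\<close>

text \<open>The obstacle is that bounded energy alone gives only weak convergence of the velocities,
  which neither produces a C^1 limit nor makes the actions converge. Minimality has to supply the
  compactness, and its quantitative content must be uniform along the sequence although the
  velocities have no uniform pointwise bound. The C^2 coefficients make this possible: the
  second-order remainder of L under a variation h is at most C ((1 + |v|)^2 |h|^2 + |h'|^2). As h
  vanishes at the left end, |h|^2 is at most the length of the interval times the integral of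
  |h'|^2, so the integrated remainder is at most a constant times the integral of |h'|^2, and the
  constant involves v only through the energy. Balancing this remainder against the first variation
  and the defect \<epsilon> of minimality leaves a mean-square error of order \<epsilon> for the
  momentum. The variations are C^1 and vanish together with their derivatives at the ends, so they
  can be inserted into curves on the manifold without leaving the class of competitors.\<close>

lemma square_sum_le: "(a + b)\<^sup>2 \<le> 2 * a\<^sup>2 + 2 * b\<^sup>2" for a b :: real
  using sum_squares_bound[of a b] by (simp add: power2_sum)

text \<open>Cauchy-Schwarz against the constant 1, obtained from the nonnegativity of the variance:
  the square of \<open>f - m\<close>, with \<open>m\<close> the mean value of \<open>f\<close>, has
  a nonnegative integral.\<close>

lemma integral_square_le:
  fixes f :: "real \<Rightarrow> real"
  assumes "\<alpha> \<le> \<beta>" and f: "continuous_on {\<alpha>..\<beta>} f"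
  shows "(integral {\<alpha>..\<beta>} f)\<^sup>2 \<le> (\<beta> - \<alpha>) * integral {\<alpha>..\<beta>} (\<lambda>t. (f t)\<^sup>2)"
proof (cases "\<alpha> = \<beta>")
  case False
  then have ab: "\<beta> - \<alpha> > 0" using assms by simp
  define I where "I = integral {\<alpha>..\<beta>} f"
  define m where "m = I / (\<beta> - \<alpha>)"
  have int: "f integrable_on {\<alpha>..\<beta>}" "(\<lambda>t. (f t)\<^sup>2) integrable_on {\<alpha>..\<beta>}"
    by (intro integrable_continuous_real continuous_intros f)+
  have "0 \<le> integral {\<alpha>..\<beta>} (\<lambda>t. (f t - m)\<^sup>2)"
    by (intro integral_nonneg integrable_continuous_real continuous_intros f) auto
  also have "(\<lambda>t. (f t - m)\<^sup>2) = (\<lambda>t. (f t)\<^sup>2 - 2 * m * f t + m\<^sup>2)"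
    by (auto simp: power2_eq_square algebra_simps)
  also have "((\<lambda>t. (f t)\<^sup>2 - 2 * m * f t + m\<^sup>2) has_integral
      integral {\<alpha>..\<beta>} (\<lambda>t. (f t)\<^sup>2) - 2 * m * I + m\<^sup>2 * (\<beta> - \<alpha>)) {\<alpha>..\<beta>}"
    using int assms(1) has_integral_const_real[of "m\<^sup>2" \<alpha> \<beta>]
    by (intro has_integral_add has_integral_diff has_integral_mult_right)
       (auto simp: I_def has_integral_integral mult.commute)
  then have "integral {\<alpha>..\<beta>} (\<lambda>t. (f t)\<^sup>2 - 2 * m * f t + m\<^sup>2)
      = integral {\<alpha>..\<beta>} (\<lambda>t. (f t)\<^sup>2) - 2 * m * I + m\<^sup>2 * (\<beta> - \<alpha>)"
    by (rule integral_unique)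
  also have "\<dots> = integral {\<alpha>..\<beta>} (\<lambda>t. (f t)\<^sup>2) - I\<^sup>2 / (\<beta> - \<alpha>)"
  proof -
    have "m * I = I\<^sup>2 / (\<beta> - \<alpha>)" "m\<^sup>2 * (\<beta> - \<alpha>) = I\<^sup>2 / (\<beta> - \<alpha>)"
      using ab by (simp_all add: m_def power2_eq_square)
    then show ?thesis by simp
  qed
  finally show ?thesis using ab by (simp add: I_def field_simps)
qed simp

text \<open>Converts energy into displacement. With \<open>g\<close> a velocity it bounds how far a
  curve moves in a given time; with \<open>g\<close> the derivative of a variation it bounds the
  variation itself.\<close>

lemma norm_integral_square_le:
  fixes g :: "real \<Rightarrow> 'e::euclidean_space"
  assumes "\<alpha> \<le> \<beta>" and g: "continuous_on {\<alpha>..\<beta>} g"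
  shows "(norm (integral {\<alpha>..\<beta>} g))\<^sup>2 \<le> (\<beta> - \<alpha>) * integral {\<alpha>..\<beta>} (\<lambda>t. (norm (g t))\<^sup>2)"
proof -
  have "norm (integral {\<alpha>..\<beta>} g) \<le> integral {\<alpha>..\<beta>} (\<lambda>t. norm (g t))"
    by (intro integral_norm_bound_integral integrable_continuous_real continuous_intros g) auto
  then have "(norm (integral {\<alpha>..\<beta>} g))\<^sup>2 \<le> (integral {\<alpha>..\<beta>} (\<lambda>t. norm (g t)))\<^sup>2"
    by (intro power_mono) auto
  also have "\<dots> \<le> (\<beta> - \<alpha>) * integral {\<alpha>..\<beta>} (\<lambda>t. (norm (g t))\<^sup>2)"
    by (intro integral_square_le assms continuous_intros)
  finally show ?thesis .
qed

lemma integral_mono_subinterval: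
  fixes f :: "real \<Rightarrow> real"
  assumes "continuous_on {\<alpha>..\<beta>} f" "\<And>t. t \<in> {\<alpha>..\<beta>} \<Longrightarrow> 0 \<le> f t" "\<alpha> \<le> s" "t \<le> \<beta>"
  shows "integral {s..t} f \<le> integral {\<alpha>..\<beta>} f"
  using assms
  by (intro integral_subset_le integrable_continuous_real continuous_on_subset[OF assms(1)]) auto

text \<open>The cutoff is \<open>1 - \<theta> t ^ (2 * m)\<close> with \<open>\<theta>\<close> the
  affine map of the interval onto [-1, 1]; the integral of the even power is (\<beta> - \<alpha>) /
  (2m + 1), which tends to 0 as m grows. Continuity suffices because the cutoff multiplies the
  derivative of a variation, not the variation itself.\<close>

lemma cutoff_exists:
  fixes \<alpha> \<beta> \<delta> :: real
  assumes "\<alpha> < \<beta>" "\<delta> > 0"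
  obtains \<phi> :: "real \<Rightarrow> real" where "continuous_on {\<alpha>..\<beta>} \<phi>" "\<phi> \<alpha> = 0" "\<phi> \<beta> = 0"
    "\<And>t. t \<in> {\<alpha>..\<beta>} \<Longrightarrow> 0 \<le> \<phi> t \<and> \<phi> t \<le> 1" "integral {\<alpha>..\<beta>} (\<lambda>t. 1 - \<phi> t) \<le> \<delta>"
proof -
  obtain m :: nat where m: "real m > (\<beta> - \<alpha>) / \<delta>" using reals_Archimedean2 by blast
  define \<theta> where "\<theta> t = (2 * t - \<alpha> - \<beta>) / (\<beta> - \<alpha>)" for t
  define \<phi> where "\<phi> t = 1 - \<theta> t ^ (2 * m)" for t
  have \<theta>: "\<bar>\<theta> t\<bar> \<le> 1" if "t \<in> {\<alpha>..\<beta>}" for t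
    using that assms by (auto simp: \<theta>_def abs_le_iff field_simps)
  have ends: "\<theta> \<alpha> = -1" "\<theta> \<beta> = 1" using assms by (auto simp: \<theta>_def field_simps)
  have c: "continuous_on {\<alpha>..\<beta>} \<theta>" unfolding \<theta>_def using assms by (intro continuous_intros) auto
  have "((\<lambda>t. \<theta> t ^ (2*m)) has_integral
      (\<beta> - \<alpha>) / 2 * (\<theta> \<beta> ^ (2*m+1) / (2*m+1)) - (\<beta> - \<alpha>) / 2 * (\<theta> \<alpha> ^ (2*m+1) / (2*m+1))) {\<alpha>..\<beta>}"
  proof (rule fundamental_theorem_of_calculus)
    fix t assume "t \<in> {\<alpha>..\<beta>}"
    have d\<theta>: "(\<theta> has_real_derivative 2 / (\<beta> - \<alpha>)) (at t within {\<alpha>..\<beta>})"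
      unfolding \<theta>_def divide_inverse by (auto intro!: derivative_eq_intros)
    have "((\<lambda>t. (\<beta> - \<alpha>) / 2 * (\<theta> t ^ (2*m+1) / (2*m+1))) has_real_derivative \<theta> t ^ (2*m))
        (at t within {\<alpha>..\<beta>})"
      using DERIV_cmult[OF DERIV_cdivide[OF DERIV_power[OF d\<theta>, of "2*m+1"], of "real (2*m+1)"],
          of "(\<beta> - \<alpha>) / 2"] assms(1)
      by (simp add: divide_simps)
    then show "((\<lambda>t. (\<beta> - \<alpha>) / 2 * (\<theta> t ^ (2*m+1) / (2*m+1))) has_vector_derivative \<theta> t ^ (2*m))
        (at t within {\<alpha>..\<beta>})"
      by (simp add: has_real_derivative_iff_has_vector_derivative)
  qed (use assms in simp)
  then have "integral {\<alpha>..\<beta>} (\<lambda>t. \<theta> t ^ (2*m)) = (\<beta> - \<alpha>) / (2*m+1)"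
    by (simp add: integral_unique ends divide_simps) (simp add: algebra_simps)
  also have "\<dots> \<le> \<delta>"
  proof -
    have "\<beta> - \<alpha> < \<delta> * real m" using m assms by (simp add: field_simps)
    also have "\<dots> \<le> \<delta> * (2 * real m + 1)" using assms by (intro mult_left_mono) auto
    finally show ?thesis by (simp add: field_simps)
  qed
  finally have "integral {\<alpha>..\<beta>} (\<lambda>t. 1 - \<phi> t) \<le> \<delta>" by (simp add: \<phi>_def)
  moreover have "0 \<le> \<phi> t \<and> \<phi> t \<le> 1" if "t \<in> {\<alpha>..\<beta>}" for t
    using power_mono[OF \<theta>[OF that] abs_ge_zero, of "2*m"]
    by (simp add: \<phi>_def power_mult)
  moreover have "continuous_on {\<alpha>..\<beta>} \<phi>" "\<phi> \<alpha> = 0" "\<phi> \<beta> = 0"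
    unfolding \<phi>_def by (auto simp: ends intro!: continuous_intros c)
  ultimately show ?thesis using that[of \<phi>] by blast
qed

text \<open>
  Testing with \<open>g = s \<phi> (P - c)\<close>, where the cutoff \<open>\<phi>\<close> is close to 1 and \<open>c\<close> is the \<open>\<phi>\<close>-mean of \<open>P\<close>,
  turns the variational inequality into \<open>s D \<le> \<epsilon> + K s\<^sup>2 D\<close> for the weighted square deviation \<open>D\<close>.
\<close>

lemma quantitative_du_Bois_Reymond:
  fixes P :: "real \<Rightarrow> 'e::euclidean_space"
  assumes "\<alpha> < \<beta>" and P: "continuous_on {\<alpha>..\<beta>} P" and "\<epsilon> > 0"
    and D0: "integral {\<alpha>..\<beta>} (\<lambda>t. (norm (P t))\<^sup>2) \<le> D0"
    and s: "s > 0" "s * K \<le> 1/2" "s\<^sup>2 * D0 \<le> \<rho>"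
    and var: "\<And>g. \<lbrakk>continuous_on {\<alpha>..\<beta>} g; g \<alpha> = 0; g \<beta> = 0; integral {\<alpha>..\<beta>} g = 0;
      integral {\<alpha>..\<beta>} (\<lambda>t. (norm (g t))\<^sup>2) \<le> \<rho>\<rbrakk> \<Longrightarrow>
      integral {\<alpha>..\<beta>} (\<lambda>t. P t \<bullet> g t) \<le> \<epsilon> + K * integral {\<alpha>..\<beta>} (\<lambda>t. (norm (g t))\<^sup>2)"
    and "K \<ge> 0"
  shows "\<exists>c. integral {\<alpha>..\<beta>} (\<lambda>t. (norm (P t - c))\<^sup>2) \<le> (2 / s + 1) * \<epsilon>"
proof -
  obtain B where B: "B > 0" "\<And>t. t \<in> {\<alpha>..\<beta>} \<Longrightarrow> norm (P t) \<le> B"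
    using compact_imp_bounded[OF compact_continuous_image[OF P compact_Icc]]
    unfolding bounded_pos by auto
  \<comment> \<open>The first bound keeps the mass \<open>w\<close> of the weight positive; the
    second is the price allowed for removing the weight at the end, where the integrand is at most
    \<open>4 * B\<^sup>2\<close>. The bound \<open>B\<close> depends on \<open>P\<close>, but it
    enters only the choice of \<open>\<phi>\<close> and not the final estimate.\<close>
  obtain \<phi> where \<phi>: "continuous_on {\<alpha>..\<beta>} \<phi>" "\<phi> \<alpha> = 0" "\<phi> \<beta> = 0"
    "\<And>t. t \<in> {\<alpha>..\<beta>} \<Longrightarrow> 0 \<le> \<phi> t \<and> \<phi> t \<le> 1"
    "integral {\<alpha>..\<beta>} (\<lambda>t. 1 - \<phi> t) \<le> min ((\<beta> - \<alpha>) / 2) (\<epsilon> / (4 * B\<^sup>2))"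
    using cutoff_exists[of \<alpha> \<beta> "min ((\<beta> - \<alpha>) / 2) (\<epsilon> / (4 * B\<^sup>2))"] assms B by auto
  define w where "w = integral {\<alpha>..\<beta>} \<phi>"
  define c where "c = (1 / w) *\<^sub>R integral {\<alpha>..\<beta>} (\<lambda>t. \<phi> t *\<^sub>R P t)"
  note [continuous_intros] = P \<phi>(1)
  have w: "w > 0"
  proof -
    have "integral {\<alpha>..\<beta>} (\<lambda>t. 1 - \<phi> t) = (\<beta> - \<alpha>) - w"
      unfolding w_def using assms(1)
      by (subst integral_diff) (auto intro!: integrable_continuous_real continuous_intros)
    then show ?thesis using \<phi>(5) assms(1) by (simp add: min_def split: if_splits)
  qed
  have int\<phi>P: "integral {\<alpha>..\<beta>} (\<lambda>t. \<phi> t *\<^sub>R P t) = w *\<^sub>R c" using w by (simp add: c_def)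
  have nc: "norm c \<le> B"
  proof -
    have "norm (integral {\<alpha>..\<beta>} (\<lambda>t. \<phi> t *\<^sub>R P t)) \<le> integral {\<alpha>..\<beta>} (\<lambda>t. \<phi> t * B)"
      using \<phi>(4) B by (intro integral_norm_bound_integral integrable_continuous_real continuous_intros)
        (auto intro!: mult_mono)
    also have "\<dots> = w * B" by (simp add: w_def)
    finally show ?thesis using w B by (simp add: c_def field_simps)
  qed
  define D where "D = integral {\<alpha>..\<beta>} (\<lambda>t. \<phi> t * (norm (P t - c))\<^sup>2)"
  have D_nonneg: "D \<ge> 0" unfolding D_def
    using \<phi>(4) by (intro integral_nonneg integrable_continuous_real continuous_intros) auto
  \<comment> \<open>With \<open>c\<close> the weighted mean, \<open>\<phi> (P - c)\<close> has
    integral zero, as the test functions must. This also allows \<open>P\<close> to be replaced by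
    \<open>P - c\<close> in the pairing with it.\<close>
  have int0: "integral {\<alpha>..\<beta>} (\<lambda>t. \<phi> t *\<^sub>R (P t - c)) = 0"
  proof -
    have "integral {\<alpha>..\<beta>} (\<lambda>t. \<phi> t *\<^sub>R P t - \<phi> t *\<^sub>R c) = w *\<^sub>R c - w *\<^sub>R c"
      unfolding int\<phi>P[symmetric] w_def
      apply (subst integral_diff)
        apply (auto intro!: integrable_continuous_real continuous_intros)
      using integral_linear[OF integrable_continuous_real[OF \<phi>(1)], of "\<lambda>x. x *\<^sub>R c"]
      by (simp add: int\<phi>P w_def o_def bounded_linear_scaleR_left)
    then show ?thesis by (simp add: scaleR_diff_right)
  qed
  have inner0: "integral {\<alpha>..\<beta>} (\<lambda>t. d \<bullet> (\<phi> t *\<^sub>R (P t - c))) = 0" for d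
  proof -
    have "(\<lambda>t. \<phi> t *\<^sub>R (P t - c)) integrable_on {\<alpha>..\<beta>}"
      by (intro integrable_continuous_real continuous_intros)
    from integral_linear[OF this bounded_linear_inner_right[of d]] int0
    show ?thesis by (simp add: o_def)
  qed
  have D1: "integral {\<alpha>..\<beta>} (\<lambda>t. P t \<bullet> (\<phi> t *\<^sub>R (P t - c))) = D"
  proof -
    have "D = integral {\<alpha>..\<beta>} (\<lambda>t. P t \<bullet> (\<phi> t *\<^sub>R (P t - c)) - c \<bullet> (\<phi> t *\<^sub>R (P t - c)))"
      unfolding D_def by (rule integral_cong) (simp add: power2_norm_eq_inner algebra_simps inner_commute)
    also have "\<dots> = integral {\<alpha>..\<beta>} (\<lambda>t. P t \<bullet> (\<phi> t *\<^sub>R (P t - c))) -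
        integral {\<alpha>..\<beta>} (\<lambda>t. c \<bullet> (\<phi> t *\<^sub>R (P t - c)))"
      by (rule integral_diff; intro integrable_continuous_real continuous_intros)
    finally show ?thesis by (simp only: inner0)
  qed
  \<comment> \<open>Subtracting the weighted mean does not raise the weighted square integral, and
    \<phi> \<le> 1 does the rest. Hence the step size \<open>s\<close>, which is tied to
    \<open>D0\<close>, fits every choice of \<open>\<phi>\<close>.\<close>
  have DD0: "D \<le> D0"
  proof -
    have "D = integral {\<alpha>..\<beta>} (\<lambda>t. \<phi> t * (norm (P t))\<^sup>2 - \<phi> t * (norm c)\<^sup>2 - 2 * (c \<bullet> (\<phi> t *\<^sub>R (P t - c))))"
      unfolding D_def by (rule integral_cong) (simp add: power2_norm_eq_inner algebra_simps inner_commute)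
    also have "\<dots> = integral {\<alpha>..\<beta>} (\<lambda>t. \<phi> t * (norm (P t))\<^sup>2 - \<phi> t * (norm c)\<^sup>2) -
        integral {\<alpha>..\<beta>} (\<lambda>t. 2 * (c \<bullet> (\<phi> t *\<^sub>R (P t - c))))"
      by (rule integral_diff; intro integrable_continuous_real continuous_intros)
    also have "\<dots> = integral {\<alpha>..\<beta>} (\<lambda>t. \<phi> t * (norm (P t))\<^sup>2 - \<phi> t * (norm c)\<^sup>2)"
      by (simp only: inner0 integral_mult_right mult_zero_right diff_zero)
    also have "\<dots> \<le> integral {\<alpha>..\<beta>} (\<lambda>t. (norm (P t))\<^sup>2)"
    proof (rule integral_le)
      fix t assume "t \<in> {\<alpha>..\<beta>}"
      then have "0 \<le> \<phi> t" "\<phi> t \<le> 1" using \<phi>(4) by auto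
      then have "\<phi> t * (norm (P t))\<^sup>2 \<le> 1 * (norm (P t))\<^sup>2" "0 \<le> \<phi> t * (norm c)\<^sup>2"
        by (intro mult_right_mono mult_nonneg_nonneg; simp)+
      then show "\<phi> t * (norm (P t))\<^sup>2 - \<phi> t * (norm c)\<^sup>2 \<le> (norm (P t))\<^sup>2" by linarith
    qed (intro integrable_continuous_real continuous_intros)+
    finally show ?thesis using D0 by simp
  qed
  define g where "g t = s *\<^sub>R (\<phi> t *\<^sub>R (P t - c))" for t
  have g: "continuous_on {\<alpha>..\<beta>} g" unfolding g_def by (intro continuous_intros)
  have "integral {\<alpha>..\<beta>} (\<lambda>t. (norm (g t))\<^sup>2) \<le> integral {\<alpha>..\<beta>} (\<lambda>t. s\<^sup>2 * (\<phi> t * (norm (P t - c))\<^sup>2))"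
  proof (rule integral_le)
    fix t assume "t \<in> {\<alpha>..\<beta>}"
    then have "0 \<le> \<phi> t" "\<phi> t \<le> 1" using \<phi>(4) by auto
    then have "\<phi> t * \<phi> t \<le> \<phi> t * 1" by (intro mult_left_mono) auto
    then have "(\<phi> t * \<phi> t) * (s\<^sup>2 * (norm (P t - c))\<^sup>2) \<le> \<phi> t * (s\<^sup>2 * (norm (P t - c))\<^sup>2)"
      by (intro mult_right_mono) auto
    moreover have "norm (g t) = s * \<phi> t * norm (P t - c)"
      using s(1) \<open>0 \<le> \<phi> t\<close> by (simp add: g_def)
    ultimately show "(norm (g t))\<^sup>2 \<le> s\<^sup>2 * (\<phi> t * (norm (P t - c))\<^sup>2)"
      by (simp add: power2_eq_square algebra_simps)
  qed (intro integrable_continuous_real continuous_intros g)+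
  also have "\<dots> = s\<^sup>2 * D" by (simp add: D_def)
  finally have g2: "integral {\<alpha>..\<beta>} (\<lambda>t. (norm (g t))\<^sup>2) \<le> s\<^sup>2 * D" .
  have "s\<^sup>2 * D \<le> s\<^sup>2 * D0" using DD0 by (intro mult_left_mono) auto
  have "integral {\<alpha>..\<beta>} (\<lambda>t. P t \<bullet> g t) \<le> \<epsilon> + K * integral {\<alpha>..\<beta>} (\<lambda>t. (norm (g t))\<^sup>2)"
  proof (rule var[OF g])
    show "integral {\<alpha>..\<beta>} g = 0" unfolding g_def by (simp only: integral_cmul int0 scaleR_zero_right)
  qed (use \<phi> g2 s(3) \<open>s\<^sup>2 * D \<le> s\<^sup>2 * D0\<close> in \<open>auto simp: g_def\<close>)
  moreover have "integral {\<alpha>..\<beta>} (\<lambda>t. P t \<bullet> g t) = s * D"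
    by (simp only: g_def inner_scaleR_right integral_mult_right D1[unfolded inner_scaleR_right])
  moreover have "K * integral {\<alpha>..\<beta>} (\<lambda>t. (norm (g t))\<^sup>2) \<le> K * (s\<^sup>2 * D)"
    using g2 \<open>K \<ge> 0\<close> by (intro mult_left_mono)
  \<comment> \<open>As \<open>s * K \<le> 1/2\<close>, the quadratic remainder is at most half of
    the linear term and is absorbed by it.\<close>
  moreover have "K * (s\<^sup>2 * D) \<le> s * D / 2"
  proof -
    have "(s * K) * (s * D) \<le> 1/2 * (s * D)" using s D_nonneg by (intro mult_right_mono) auto
    then show ?thesis by (simp add: power2_eq_square algebra_simps)
  qed
  ultimately have "s * D \<le> 2 * \<epsilon>" by linarith
  then have D: "D \<le> 2 / s * \<epsilon>" using s by (simp add: field_simps)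
  \<comment> \<open>The weight is removed: \<open>norm (P t - c)\<close> is at most
    \<open>2 * B\<close>, and the total deficit of the cutoff was chosen so that this costs at most
    \<open>\<epsilon>\<close>.\<close>
  have "integral {\<alpha>..\<beta>} (\<lambda>t. (norm (P t - c))\<^sup>2)
      \<le> integral {\<alpha>..\<beta>} (\<lambda>t. \<phi> t * (norm (P t - c))\<^sup>2 + (4 * B\<^sup>2) * (1 - \<phi> t))"
  proof (rule integral_le)
    fix t assume t: "t \<in> {\<alpha>..\<beta>}"
    have "norm (P t - c) \<le> 2 * B" using norm_triangle_ineq4[of "P t" c] B(2)[OF t] nc by linarith
    then have "(norm (P t - c))\<^sup>2 \<le> (2 * B)\<^sup>2" by (intro power_mono) auto
    then have "(1 - \<phi> t) * (norm (P t - c))\<^sup>2 \<le> (1 - \<phi> t) * (4 * B\<^sup>2)"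
      using \<phi>(4)[OF t] by (intro mult_left_mono) (auto simp: power_mult_distrib)
    then show "(norm (P t - c))\<^sup>2 \<le> \<phi> t * (norm (P t - c))\<^sup>2 + (4 * B\<^sup>2) * (1 - \<phi> t)"
      by (simp add: algebra_simps)
  qed (intro integrable_continuous_real continuous_intros)+
  also have "\<dots> = D + (4 * B\<^sup>2) * integral {\<alpha>..\<beta>} (\<lambda>t. 1 - \<phi> t)"
    unfolding D_def
    by (subst integral_add) (auto intro!: integrable_continuous_real continuous_intros
        simp del: integral_diff)
  also have "(4 * B\<^sup>2) * integral {\<alpha>..\<beta>} (\<lambda>t. 1 - \<phi> t) \<le> (4 * B\<^sup>2) * (\<epsilon> / (4 * B\<^sup>2))"
    using \<phi>(5) by (intro mult_left_mono) auto
  also have "\<dots> = \<epsilon>" using B by simp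
  finally have "integral {\<alpha>..\<beta>} (\<lambda>t. (norm (P t - c))\<^sup>2) \<le> D + \<epsilon>" by simp
  also have "\<dots> \<le> (2 / s + 1) * \<epsilon>" using D by (simp add: algebra_simps)
  finally show ?thesis by blast
qed

text \<open>
  Equicontinuity up to an error \<open>\<eta> n \<longlonglongrightarrow> 0\<close> suffices, because the finitely many functions with a large
  error are continuous anyway.
\<close>

lemma Arzela_Ascoli_asymptotic:
  fixes F :: "nat \<Rightarrow> real \<Rightarrow> 'b::{real_normed_vector,heine_borel}"
  assumes c: "\<And>n. continuous_on {\<alpha>..\<beta>} (F n)"
    and M: "\<And>n t. t \<in> {\<alpha>..\<beta>} \<Longrightarrow> norm (F n t) \<le> M"
    and lip: "\<And>n s t. \<lbrakk>\<alpha> \<le> s; s \<le> t; t \<le> \<beta>\<rbrakk> \<Longrightarrow> norm (F n t - F n s) \<le> A * (t - s) + \<eta> n"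
    and \<eta>: "\<eta> \<longlonglongrightarrow> 0"
  obtains g k where "continuous_on {\<alpha>..\<beta>} g" "strict_mono (k :: nat \<Rightarrow> nat)"
    "\<And>e. 0 < e \<Longrightarrow> \<exists>N. \<forall>n t. n \<ge> N \<and> t \<in> {\<alpha>..\<beta>} \<longrightarrow> norm (F (k n) t - g t) < e"
proof (rule Arzela_Ascoli[of "{\<alpha>..\<beta>}" F M])
  fix x e :: real assume x: "x \<in> {\<alpha>..\<beta>}" and e: "0 < e"
  obtain N where N: "\<And>n. n \<ge> N \<Longrightarrow> norm (\<eta> n) < e/2"
    using LIMSEQ_D[OF \<eta>, of "e/2"] e by auto
  have "\<exists>d>0. \<forall>n<m. \<forall>y. y \<in> {\<alpha>..\<beta>} \<and> norm (x - y) < d \<longrightarrow> norm (F n x - F n y) < e" for m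
  proof (induction m)
    case 0 show ?case by (rule exI[of _ 1]) auto
  next
    case (Suc m)
    then obtain d where d: "d > 0" "\<And>n y. \<lbrakk>n < m; y \<in> {\<alpha>..\<beta>}; norm (x - y) < d\<rbrakk> \<Longrightarrow> norm (F n x - F n y) < e"
      by blast
    obtain d' where d': "d' > 0" "\<And>y. \<lbrakk>y \<in> {\<alpha>..\<beta>}; dist y x < d'\<rbrakk> \<Longrightarrow> dist (F m y) (F m x) < e"
      using c[of m] x e unfolding continuous_on_iff by blast
    have "norm (F n x - F n y) < e"
      if "n < Suc m" "y \<in> {\<alpha>..\<beta>}" "norm (x - y) < min d d'" for n y
    proof (cases "n = m")
      case True
      then show ?thesis using d'(2)[of y] that by (simp add: dist_norm norm_minus_commute abs_minus_commute)
    next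
      case False
      then show ?thesis using d(2)[of n y] that by simp
    qed
    then show ?case using d(1) d'(1) by (intro exI[of _ "min d d'"]) auto
  qed
  from this[of N] obtain d where d: "d > 0"
    "\<And>n y. \<lbrakk>n < N; y \<in> {\<alpha>..\<beta>}; norm (x - y) < d\<rbrakk> \<Longrightarrow> norm (F n x - F n y) < e"
    by auto
  \<comment> \<open>Half of \<open>e\<close> is spent on the Lipschitz part and half on the error
    \<open>\<eta> n\<close>; \<open>\<bar>A\<bar> + 1\<close> keeps the denominator
    positive.\<close>
  define d' where "d' = min d (e / (2 * (\<bar>A\<bar> + 1)))"
  have "norm (F n x - F n y) < e" if "y \<in> {\<alpha>..\<beta>}" "norm (x - y) < d'" for n y
  proof (cases "n < N")
    case False
    then have "\<bar>\<eta> n\<bar> < e / 2" using N by simp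
    have "norm (F n x - F n y) \<le> A * \<bar>x - y\<bar> + \<eta> n"
    proof (cases "x \<le> y")
      case True
      then show ?thesis using lip[of x y n] x that(1) by (simp add: norm_minus_commute)
    next
      case False
      then show ?thesis using lip[of y x n] x that(1) by simp
    qed
    also have "A * \<bar>x - y\<bar> \<le> (\<bar>A\<bar> + 1) * \<bar>x - y\<bar>" by (intro mult_right_mono) auto
    also have "\<bar>x - y\<bar> < e / (2 * (\<bar>A\<bar> + 1))" using that(2) by (simp add: d'_def)
    then have "(\<bar>A\<bar> + 1) * \<bar>x - y\<bar> < e / 2" by (simp add: field_simps)
    finally show ?thesis using \<open>\<bar>\<eta> n\<bar> < e / 2\<close> by linarith
  qed (use d that in \<open>auto simp: d'_def\<close>)
  moreover have "d' > 0" using d e by (auto simp: d'_def)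
  ultimately show "\<exists>d. 0 < d \<and> (\<forall>n y. y \<in> {\<alpha>..\<beta>} \<and> norm (x - y) < d \<longrightarrow> norm (F n x - F n y) < e)"
    by blast
qed (use M in \<open>simp_all add: that\<close>)


section \<open>Near-minimisers in Euclidean space\<close>

text \<open>
  \<open>Lx\<close> and \<open>Lv\<close> play the role of the partial gradients of \<open>L\<close> in position and velocity; the powers of
  \<open>1 + norm v\<close> are those of a Lagrangian that is quadratic in the velocity.
\<close>

definition tame :: "real set \<Rightarrow> 'e::euclidean_space set \<Rightarrow> (real \<Rightarrow> 'e \<Rightarrow> 'e \<Rightarrow> real)
    \<Rightarrow> (real \<Rightarrow> 'e \<Rightarrow> 'e \<Rightarrow> 'e) \<Rightarrow> (real \<Rightarrow> 'e \<Rightarrow> 'e \<Rightarrow> 'e) \<Rightarrow> bool" where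
  "tame J B L Lx Lv \<longleftrightarrow>
     continuous_on (J \<times> B \<times> UNIV) (\<lambda>(t, x, v). L t x v) \<and>
     continuous_on (J \<times> B \<times> UNIV) (\<lambda>(t, x, v). Lx t x v) \<and>
     continuous_on (J \<times> B \<times> UNIV) (\<lambda>(t, x, v). Lv t x v) \<and>
     (\<exists>C\<ge>0. \<forall>t\<in>J. \<forall>x\<in>B. \<forall>v.
        norm (Lx t x v) \<le> C * (1 + norm v)\<^sup>2 \<and>
        norm (Lv t x v) \<le> C * (1 + norm v) \<and>
        (\<forall>y\<in>B. norm (Lv t y v - Lv t x v) \<le> C * (1 + norm v) * norm (y - x) \<and>
          (\<forall>w. \<bar>L t y w - L t x v - Lx t x v \<bullet> (y - x) - Lv t x v \<bullet> (w - v)\<bar>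
                \<le> C * ((1 + norm v)\<^sup>2 * (norm (y - x))\<^sup>2 + (norm (w - v))\<^sup>2))))"

lemma tameD:
  assumes "tame J B L Lx Lv"
  obtains C where "C \<ge> 0"
    "\<And>t x v. \<lbrakk>t \<in> J; x \<in> B\<rbrakk> \<Longrightarrow> norm (Lx t x v) \<le> C * (1 + norm v)\<^sup>2"
    "\<And>t x v. \<lbrakk>t \<in> J; x \<in> B\<rbrakk> \<Longrightarrow> norm (Lv t x v) \<le> C * (1 + norm v)"
    "\<And>t x y v. \<lbrakk>t \<in> J; x \<in> B; y \<in> B\<rbrakk> \<Longrightarrow> norm (Lv t y v - Lv t x v) \<le> C * (1 + norm v) * norm (y - x)"
    "\<And>t x y v w. \<lbrakk>t \<in> J; x \<in> B; y \<in> B\<rbrakk> \<Longrightarrow>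
       \<bar>L t y w - L t x v - Lx t x v \<bullet> (y - x) - Lv t x v \<bullet> (w - v)\<bar>
                \<le> C * ((1 + norm v)\<^sup>2 * (norm (y - x))\<^sup>2 + (norm (w - v))\<^sup>2)"
  using assms unfolding tame_def by blast

lemma tame_continuous:
  assumes "tame J B L Lx Lv" "I \<subseteq> J" "continuous_on I x" "continuous_on I v" "x ` I \<subseteq> B"
  shows "continuous_on I (\<lambda>t. L t (x t) (v t))" "continuous_on I (\<lambda>t. Lx t (x t) (v t))"
    "continuous_on I (\<lambda>t. Lv t (x t) (v t))"
proof -
  have *: "continuous_on I (\<lambda>t. F t (x t) (v t))"
    if "continuous_on (J \<times> B \<times> UNIV) (\<lambda>(t, x, v). F t x v)"
    for F :: "real \<Rightarrow> 'a \<Rightarrow> 'a \<Rightarrow> 'b::topological_space"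
  proof -
    have "continuous_on I (\<lambda>t. (\<lambda>(t, x, v). F t x v) (t, x t, v t))"
      by (rule continuous_on_compose2[OF that]) (use assms in \<open>auto intro!: continuous_intros\<close>)
    then show ?thesis by simp
  qed
  show "continuous_on I (\<lambda>t. L t (x t) (v t))" "continuous_on I (\<lambda>t. Lx t (x t) (v t))"
    "continuous_on I (\<lambda>t. Lv t (x t) (v t))"
    using assms(1) unfolding tame_def by (auto intro!: *)
qed

text \<open>Isolates what the compactness argument takes from the Lagrangian. The constant
  \<open>\<kappa>\<close> plays the role of a lower bound for the Hessian of \<open>L\<close> in the
  velocity; \<open>mono\<close> and \<open>surj\<close> together make every \<open>Lv t x\<close> a
  bijection, the Legendre transform.\<close>

locale variational =
  fixes J :: "real set" and B :: "'e::euclidean_space set" and L Lx Lv and \<kappa> :: real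
  assumes tame: "tame J B L Lx Lv"
    and cpt: "compact B"
    and \<kappa>: "\<kappa> > 0"
    and mono: "\<And>t x v w. \<lbrakk>t \<in> J; x \<in> B\<rbrakk> \<Longrightarrow>
      \<kappa> * (norm (v - w))\<^sup>2 \<le> (Lv t x v - Lv t x w) \<bullet> (v - w)"
    and surj: "\<And>t x p. \<lbrakk>t \<in> J; x \<in> B\<rbrakk> \<Longrightarrow> \<exists>v. Lv t x v = p"
begin

text \<open>Cauchy-Schwarz in \<open>mono\<close>, divided by the norm of \<open>v - w\<close>: the
  inverse Legendre transform is Lipschitz with constant 1 / \<kappa>, so momentum errors control
  velocity errors.\<close>

lemma mono_norm:
  assumes "t \<in> J" "x \<in> B"
  shows "\<kappa> * norm (v - w) \<le> norm (Lv t x v - Lv t x w)"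
proof (cases "v = w")
  case False
  have "\<kappa> * (norm (v - w))\<^sup>2 \<le> norm (Lv t x v - Lv t x w) * norm (v - w)"
    using mono[OF assms, of v w] norm_cauchy_schwarz order_trans by blast
  then have "(\<kappa> * norm (v - w)) * norm (v - w) \<le> norm (Lv t x v - Lv t x w) * norm (v - w)"
    by (simp add: power2_eq_square)
  then show ?thesis using False by (simp add: mult_le_cancel_right)
qed simp

text \<open>
  \<open>Z\<close> is a constant plus the integral of \<open>Lx\<close> along the curve: the Euler-Lagrange equation says that it
  equals the momentum \<open>Lv\<close>, and near-minimality makes them close in the mean square.
\<close>

lemma momentum_approx:
  assumes "\<alpha> < \<beta>" and J: "{\<alpha>..\<beta>} \<subseteq> J" and "\<rho> > 0" "M \<ge> 0"
  obtains K where "K \<ge> 0"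
    "\<And>x v \<epsilon>. \<lbrakk>\<epsilon> > 0;
      \<And>t. t \<in> {\<alpha>..\<beta>} \<Longrightarrow> (x has_vector_derivative v t) (at t within {\<alpha>..\<beta>});
      continuous_on {\<alpha>..\<beta>} v;
      \<And>t y. t \<in> {\<alpha>..\<beta>} \<Longrightarrow> norm (y - x t) \<le> \<rho> \<Longrightarrow> y \<in> B;
      integral {\<alpha>..\<beta>} (\<lambda>t. (1 + norm (v t))\<^sup>2) \<le> M;
      \<And>h h'. \<lbrakk>\<And>t. t \<in> {\<alpha>..\<beta>} \<Longrightarrow> (h has_vector_derivative h' t) (at t within {\<alpha>..\<beta>});
         continuous_on {\<alpha>..\<beta>} h'; h \<alpha> = 0; h \<beta> = 0; h' \<alpha> = 0; h' \<beta> = 0;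
         \<And>t. t \<in> {\<alpha>..\<beta>} \<Longrightarrow> norm (h t) \<le> \<rho>\<rbrakk> \<Longrightarrow>
         integral {\<alpha>..\<beta>} (\<lambda>t. L t (x t) (v t))
           \<le> integral {\<alpha>..\<beta>} (\<lambda>t. L t (x t + h t) (v t + h' t)) + \<epsilon>\<rbrakk>
     \<Longrightarrow> \<exists>Z. continuous_on {\<alpha>..\<beta>} Z \<and>
          integral {\<alpha>..\<beta>} (\<lambda>t. (norm (Lv t (x t) (v t) - Z t))\<^sup>2) \<le> K * \<epsilon> \<and>
          (\<forall>t\<in>{\<alpha>..\<beta>}. norm (Z t) \<le> K * (1 + sqrt \<epsilon>)) \<and>
          (\<forall>s t. \<alpha> \<le> s \<and> s \<le> t \<and> t \<le> \<beta> \<longrightarrow>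
             norm (Z t - Z s) \<le> K * integral {s..t} (\<lambda>t. (1 + norm (v t))\<^sup>2))"
proof -
  obtain C where C: "C \<ge> 0"
    "\<And>t x v. \<lbrakk>t \<in> J; x \<in> B\<rbrakk> \<Longrightarrow> norm (Lx t x v) \<le> C * (1 + norm v)\<^sup>2"
    "\<And>t x v. \<lbrakk>t \<in> J; x \<in> B\<rbrakk> \<Longrightarrow> norm (Lv t x v) \<le> C * (1 + norm v)"
    "\<And>t x y v w. \<lbrakk>t \<in> J; x \<in> B; y \<in> B\<rbrakk> \<Longrightarrow>
       \<bar>L t y w - L t x v - Lx t x v \<bullet> (y - x) - Lv t x v \<bullet> (w - v)\<bar>
                \<le> C * ((1 + norm v)\<^sup>2 * (norm (y - x))\<^sup>2 + (norm (w - v))\<^sup>2)"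
    by (rule tameD[OF tame]) blast
  define l where "l = \<beta> - \<alpha>"
  have l: "l > 0" using assms by (simp add: l_def)
  \<comment> \<open>\<open>D0\<close> bounds the square integral of \<open>Lv\<close> minus the
    primitive of \<open>Lx\<close>, by the growth bounds on the two gradients; \<open>K1\<close> is
    the coefficient of the quadratic remainder; a derivative with square integral at most
    \<open>r\<close> belongs to a variation of norm at most \<open>\<rho>\<close>. The curve enters
    only through \<open>M\<close>, which makes the final \<open>K\<close> uniform.\<close>
  define D0 where "D0 = 2 * C\<^sup>2 * M + 2 * (C * M)\<^sup>2 * l"
  define K1 where "K1 = C * (M * l + 1)"
  define r where "r = \<rho>\<^sup>2 / l"
  have nn: "D0 \<ge> 0" "K1 \<ge> 0" "r > 0" using C(1) \<open>M \<ge> 0\<close> \<open>\<rho> > 0\<close> l by (auto simp: D0_def K1_def r_def)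
  \<comment> \<open>The requirements of the du Bois-Reymond estimate on the step size;
    \<open>s \<le> 1\<close> lets \<open>s\<^sup>2\<close> be replaced by \<open>s\<close> in the
    last of them.\<close>
  define s where "s = min 1 (min (1 / (2 * (K1 + 1))) (r / (D0 + 1)))"
  have s: "s > 0" "s * K1 \<le> 1/2" "s\<^sup>2 * D0 \<le> r"
  proof -
    show "s > 0" using nn by (auto simp: s_def)
    have "s * K1 \<le> 1 / (2 * (K1 + 1)) * K1" using nn by (intro mult_right_mono) (auto simp: s_def)
    also have "\<dots> \<le> 1/2" using nn by (simp add: field_simps)
    finally show "s * K1 \<le> 1/2" .
    have "s * s \<le> s * 1" using \<open>s > 0\<close> by (intro mult_left_mono) (auto simp: s_def)
    then have "s\<^sup>2 * D0 \<le> s * D0" using nn by (intro mult_right_mono) (auto simp: power2_eq_square)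
    also have "\<dots> \<le> r / (D0 + 1) * D0" using nn by (intro mult_right_mono) (auto simp: s_def)
    also have "\<dots> \<le> r" using nn by (simp add: field_simps)
    finally show "s\<^sup>2 * D0 \<le> r" .
  qed
  define K2 where "K2 = 2 / s + 1"
  have K2: "K2 \<ge> 0" using s by (simp add: K2_def)
  \<comment> \<open>One constant for all three estimates: \<open>K2\<close> for the mean-square
    error, \<open>C\<close> for the increments of \<open>Z\<close>, and the remaining terms for its
    supremum.\<close>
  define K where "K = K2 + C + C * M + sqrt (2 * K2 / l) + sqrt (2 * D0 / l)"
  have "K \<ge> 0" unfolding K_def using C(1) \<open>M \<ge> 0\<close> K2 nn l by (intro add_nonneg_nonneg) auto
  show ?thesis
  proof (rule that[of K])
    fix x v :: "real \<Rightarrow> 'e" and \<epsilon> :: real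
    assume \<epsilon>: "\<epsilon> > 0"
      and x: "\<And>t. t \<in> {\<alpha>..\<beta>} \<Longrightarrow> (x has_vector_derivative v t) (at t within {\<alpha>..\<beta>})"
      and v: "continuous_on {\<alpha>..\<beta>} v"
      and xB: "\<And>t y. t \<in> {\<alpha>..\<beta>} \<Longrightarrow> norm (y - x t) \<le> \<rho> \<Longrightarrow> y \<in> B"
      and M: "integral {\<alpha>..\<beta>} (\<lambda>t. (1 + norm (v t))\<^sup>2) \<le> M"
      and min: "\<And>h h'. \<lbrakk>\<And>t. t \<in> {\<alpha>..\<beta>} \<Longrightarrow> (h has_vector_derivative h' t) (at t within {\<alpha>..\<beta>});
         continuous_on {\<alpha>..\<beta>} h'; h \<alpha> = 0; h \<beta> = 0; h' \<alpha> = 0; h' \<beta> = 0;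
         \<And>t. t \<in> {\<alpha>..\<beta>} \<Longrightarrow> norm (h t) \<le> \<rho>\<rbrakk> \<Longrightarrow>
         integral {\<alpha>..\<beta>} (\<lambda>t. L t (x t) (v t))
           \<le> integral {\<alpha>..\<beta>} (\<lambda>t. L t (x t + h t) (v t + h' t)) + \<epsilon>"
    have x_in: "x t \<in> B" if "t \<in> {\<alpha>..\<beta>}" for t using xB[OF that, of "x t"] \<open>\<rho> > 0\<close> by simp
    have xc: "continuous_on {\<alpha>..\<beta>} x"
      using x by (meson continuous_on_eq_continuous_within has_vector_derivative_continuous)
    note cont = tame_continuous[OF tame J xc v]
    have xsub: "x ` {\<alpha>..\<beta>} \<subseteq> B" using x_in by auto
    define lx where "lx t = Lx t (x t) (v t)" for t
    define p where "p t = Lv t (x t) (v t)" for t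
    define R where "R t = integral {\<alpha>..t} lx" for t
    have lxc: "continuous_on {\<alpha>..\<beta>} lx" and pc: "continuous_on {\<alpha>..\<beta>} p"
      unfolding lx_def p_def using cont(2,3)[OF xsub] by auto
    have R': "(R has_vector_derivative lx t) (at t within {\<alpha>..\<beta>})" if "t \<in> {\<alpha>..\<beta>}" for t
      unfolding R_def by (rule integral_has_vector_derivative[OF lxc that])
    have Rc: "continuous_on {\<alpha>..\<beta>} R"
      using R' by (meson continuous_on_eq_continuous_within has_vector_derivative_continuous)
    note [continuous_intros] = v xc lxc pc Rc
    have Rdiff: "norm (R t - R s) \<le> C * integral {s..t} (\<lambda>t. (1 + norm (v t))\<^sup>2)"
      if "\<alpha> \<le> s" "s \<le> t" "t \<le> \<beta>" for s t
    proof -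
      have "continuous_on {\<alpha>..t} lx" using lxc by (rule continuous_on_subset) (use that in auto)
      then have "R t - R s = integral {s..t} lx"
        using Henstock_Kurzweil_Integration.integral_combine[OF that(1,2), of lx] unfolding R_def
        by (simp add: integrable_continuous_real algebra_simps)
      also have "norm \<dots> \<le> integral {s..t} (\<lambda>t. C * (1 + norm (v t))\<^sup>2)"
      proof (rule integral_norm_bound_integral)
        show "lx integrable_on {s..t}"
          by (rule integrable_continuous_real, rule continuous_on_subset[OF lxc]) (use that in auto)
        show "(\<lambda>t. C * (1 + norm (v t))\<^sup>2) integrable_on {s..t}"
          by (rule integrable_continuous_real, rule continuous_on_subset[of "{\<alpha>..\<beta>}"])
             (use that in \<open>auto intro!: continuous_intros\<close>)
        show "norm (lx \<tau>) \<le> C * (1 + norm (v \<tau>))\<^sup>2" if "\<tau> \<in> {s..t}" for \<tau>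
          unfolding lx_def using that \<open>\<alpha> \<le> s\<close> \<open>t \<le> \<beta>\<close> J by (intro C(2) x_in) auto
      qed
      finally show ?thesis by simp
    qed
    have RM: "norm (R t) \<le> C * M" if t: "t \<in> {\<alpha>..\<beta>}" for t
    proof -
      have "norm (R t - R \<alpha>) \<le> C * integral {\<alpha>..t} (\<lambda>t. (1 + norm (v t))\<^sup>2)"
        using t by (intro Rdiff) auto
      also have "\<dots> \<le> C * integral {\<alpha>..\<beta>} (\<lambda>t. (1 + norm (v t))\<^sup>2)"
        using C(1) t by (intro mult_left_mono integral_mono_subinterval continuous_intros) auto
      also have "\<dots> \<le> C * M" using M C(1) by (rule mult_left_mono)
      finally show ?thesis by (simp add: R_def)
    qed
    \<comment> \<open>The coefficient of \<open>h'\<close> in the first variation, once the term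
      with \<open>Lx\<close> has been integrated by parts.\<close>
    define P where "P t = p t - R t" for t
    have Pc: "continuous_on {\<alpha>..\<beta>} P" unfolding P_def by (intro continuous_intros)
    note [continuous_intros] = Pc
    have P2: "integral {\<alpha>..\<beta>} (\<lambda>t. (norm (P t))\<^sup>2) \<le> D0"
    proof -
      have "integral {\<alpha>..\<beta>} (\<lambda>t. (norm (P t))\<^sup>2)
          \<le> integral {\<alpha>..\<beta>} (\<lambda>t. 2 * C\<^sup>2 * (1 + norm (v t))\<^sup>2 + 2 * (C * M)\<^sup>2)"
      proof (rule integral_le)
        fix t assume t: "t \<in> {\<alpha>..\<beta>}"
        have "norm (P t) \<le> norm (p t) + norm (R t)" unfolding P_def by (rule norm_triangle_ineq4)
        also have "\<dots> \<le> C * (1 + norm (v t)) + C * M"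
          using C(3)[of t "x t" "v t"] x_in[OF t] RM[OF t] t J by (auto simp: p_def intro!: add_mono)
        finally have "(norm (P t))\<^sup>2 \<le> (C * (1 + norm (v t)) + C * M)\<^sup>2" by (intro power_mono) auto
        also have "\<dots> \<le> 2 * (C * (1 + norm (v t)))\<^sup>2 + 2 * (C * M)\<^sup>2"
          by (rule square_sum_le)
        finally show "(norm (P t))\<^sup>2 \<le> 2 * C\<^sup>2 * (1 + norm (v t))\<^sup>2 + 2 * (C * M)\<^sup>2"
          by (simp add: power_mult_distrib)
      qed (intro integrable_continuous_real continuous_intros)+
      also have "\<dots> = 2 * C\<^sup>2 * integral {\<alpha>..\<beta>} (\<lambda>t. (1 + norm (v t))\<^sup>2) + 2 * (C * M)\<^sup>2 * l"
        using assms(1) unfolding l_def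
        by (subst integral_add) (auto intro!: integrable_continuous_real continuous_intros)
      also have "\<dots> \<le> D0" unfolding D0_def using M by (intro add_right_mono mult_left_mono) auto
      finally show ?thesis .
    qed
    have "\<exists>c. integral {\<alpha>..\<beta>} (\<lambda>t. (norm (P t - c))\<^sup>2) \<le> (2 / s + 1) * \<epsilon>"
    proof (rule quantitative_du_Bois_Reymond[OF assms(1) Pc \<epsilon> P2 s])
      fix g :: "real \<Rightarrow> 'e" assume g: "continuous_on {\<alpha>..\<beta>} g" "g \<alpha> = 0" "g \<beta> = 0" "integral {\<alpha>..\<beta>} g = 0"
        "integral {\<alpha>..\<beta>} (\<lambda>t. (norm (g t))\<^sup>2) \<le> r"
      note [continuous_intros] = g(1)
      define G where "G = integral {\<alpha>..\<beta>} (\<lambda>t. (norm (g t))\<^sup>2)"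
      \<comment> \<open>The sign makes \<open>- g\<close> the derivative of \<open>h\<close>, so
        that near-minimality bounds the integral of \<open>P \<bullet> g\<close> from above. The
        zero integral of \<open>g\<close> gives \<open>h \<beta> = 0\<close>.\<close>
      define h where "h t = - integral {\<alpha>..t} g" for t
      have h': "(h has_vector_derivative - g t) (at t within {\<alpha>..\<beta>})" if "t \<in> {\<alpha>..\<beta>}" for t
        unfolding h_def using integral_has_vector_derivative[OF g(1) that]
        by (rule has_vector_derivative_minus)
      have hc: "continuous_on {\<alpha>..\<beta>} h"
        using h' by (meson continuous_on_eq_continuous_within has_vector_derivative_continuous)
      note [continuous_intros] = hc
      have hl: "(norm (h t))\<^sup>2 \<le> l * G" if t: "t \<in> {\<alpha>..\<beta>}" for t
      proof -
        have "(norm (h t))\<^sup>2 \<le> (t - \<alpha>) * integral {\<alpha>..t} (\<lambda>t. (norm (g t))\<^sup>2)"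
          unfolding h_def norm_minus_cancel
          by (rule norm_integral_square_le, use t in simp)
             (rule continuous_on_subset[OF g(1)], use t in auto)
        also have "\<dots> \<le> l * G"
          unfolding G_def l_def using t assms(1)
          by (intro mult_mono integral_mono_subinterval continuous_intros integral_nonneg
                integrable_continuous_real continuous_on_subset[OF g(1)]) auto
        finally show ?thesis .
      qed
      have h\<rho>: "norm (h t) \<le> \<rho>" if "t \<in> {\<alpha>..\<beta>}" for t
      proof -
        have "l * G \<le> l * r" using g(5) l unfolding G_def by (intro mult_left_mono) auto
        then have "(norm (h t))\<^sup>2 \<le> \<rho>\<^sup>2" using hl[OF that] l by (simp add: r_def)
        then show ?thesis using \<open>\<rho> > 0\<close> by (simp add: power2_le_iff_abs_le)
      qed
      have xh: "x t + h t \<in> B" if "t \<in> {\<alpha>..\<beta>}" for t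
        using xB[OF that, of "x t + h t"] h\<rho>[OF that] by simp
      have 1: "integral {\<alpha>..\<beta>} (\<lambda>t. L t (x t) (v t))
           \<le> integral {\<alpha>..\<beta>} (\<lambda>t. L t (x t + h t) (v t + - g t)) + \<epsilon>"
        by (rule min[OF h' _ _ _ _ _ h\<rho>]) (use g in \<open>auto simp: h_def intro!: continuous_intros\<close>)
      have Lc: "continuous_on {\<alpha>..\<beta>} (\<lambda>t. L t (x t) (v t))" using cont(1)[OF xsub] .
      have Lc2: "continuous_on {\<alpha>..\<beta>} (\<lambda>t. L t (x t + h t) (v t + - g t))"
        by (rule tame_continuous(1)[OF tame J]) (use xh in \<open>auto intro!: continuous_intros\<close>)
      have parts: "((\<lambda>t. R t \<bullet> (- g t) + lx t \<bullet> h t) has_integral (R \<beta> \<bullet> h \<beta> - R \<alpha> \<bullet> h \<alpha>)) {\<alpha>..\<beta>}"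
      proof (rule fundamental_theorem_of_calculus)
        fix t assume t: "t \<in> {\<alpha>..\<beta>}"
        show "((\<lambda>t. R t \<bullet> h t) has_vector_derivative R t \<bullet> (- g t) + lx t \<bullet> h t) (at t within {\<alpha>..\<beta>})"
          by (rule bounded_bilinear.has_vector_derivative[OF bounded_bilinear_inner R'[OF t] h'[OF t]])
      qed (use assms in simp)
      have parts0: "((\<lambda>t. R t \<bullet> (- g t) + lx t \<bullet> h t) has_integral 0) {\<alpha>..\<beta>}"
        using parts g(4) by (simp add: h_def)
      have Pg: "((\<lambda>t. P t \<bullet> g t) has_integral integral {\<alpha>..\<beta>} (\<lambda>t. P t \<bullet> g t)) {\<alpha>..\<beta>}"
        by (intro integrable_integral integrable_continuous_real continuous_intros)
      have v2: "((\<lambda>t. (1 + norm (v t))\<^sup>2) has_integral integral {\<alpha>..\<beta>} (\<lambda>t. (1 + norm (v t))\<^sup>2)) {\<alpha>..\<beta>}"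
        by (intro integrable_integral integrable_continuous_real continuous_intros)
      have G2: "((\<lambda>t. (norm (g t))\<^sup>2) has_integral G) {\<alpha>..\<beta>}"
        unfolding G_def by (intro integrable_integral integrable_continuous_real continuous_intros)
      \<comment> \<open>The first variation contributes minus the integral of
        \<open>P \<bullet> g\<close>. In the remainder, the uniform bound \<open>hl\<close> takes
        \<open>h\<close> out of the integral against \<open>(1 + norm (v t))\<^sup>2\<close>, so
        that the energy bound \<open>M\<close> is all that is asked of the velocity.\<close>
      have "integral {\<alpha>..\<beta>} (\<lambda>t. L t (x t + h t) (v t + - g t))
          \<le> integral {\<alpha>..\<beta>} (\<lambda>t. L t (x t) (v t)) + (0 - integral {\<alpha>..\<beta>} (\<lambda>t. P t \<bullet> g t))
             + (C * (l * G) * integral {\<alpha>..\<beta>} (\<lambda>t. (1 + norm (v t))\<^sup>2) + C * G)"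
      proof (rule has_integral_le)
        show "((\<lambda>t. L t (x t + h t) (v t + - g t)) has_integral
            integral {\<alpha>..\<beta>} (\<lambda>t. L t (x t + h t) (v t + - g t))) {\<alpha>..\<beta>}"
          by (intro integrable_integral integrable_continuous_real Lc2)
        show "((\<lambda>t. L t (x t) (v t) + ((R t \<bullet> (- g t) + lx t \<bullet> h t) - P t \<bullet> g t)
            + (C * (l * G) * (1 + norm (v t))\<^sup>2 + C * (norm (g t))\<^sup>2)) has_integral
           (integral {\<alpha>..\<beta>} (\<lambda>t. L t (x t) (v t)) + (0 - integral {\<alpha>..\<beta>} (\<lambda>t. P t \<bullet> g t))
             + (C * (l * G) * integral {\<alpha>..\<beta>} (\<lambda>t. (1 + norm (v t))\<^sup>2) + C * G))) {\<alpha>..\<beta>}"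
          by (intro has_integral_add has_integral_diff has_integral_mult_right parts0 Pg v2 G2
                integrable_integral integrable_continuous_real Lc)
        fix t assume t: "t \<in> {\<alpha>..\<beta>}"
        have "\<bar>L t (x t + h t) (v t + - g t) - L t (x t) (v t) - lx t \<bullet> h t - p t \<bullet> (- g t)\<bar>
            \<le> C * ((1 + norm (v t))\<^sup>2 * (norm (h t))\<^sup>2 + (norm (g t))\<^sup>2)"
          using C(4)[of t "x t" "x t + h t" "v t + - g t" "v t"] xh[OF t] x_in[OF t] t J
          by (auto simp: lx_def p_def)
        also have "\<dots> \<le> C * ((1 + norm (v t))\<^sup>2 * (l * G) + (norm (g t))\<^sup>2)"
          using hl[OF t] C(1) by (intro mult_left_mono add_right_mono) auto
        also have "\<dots> = C * (l * G) * (1 + norm (v t))\<^sup>2 + C * (norm (g t))\<^sup>2"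
          by (simp add: algebra_simps)
        finally show "L t (x t + h t) (v t + - g t) \<le> L t (x t) (v t) + ((R t \<bullet> (- g t) + lx t \<bullet> h t) - P t \<bullet> g t)
            + (C * (l * G) * (1 + norm (v t))\<^sup>2 + C * (norm (g t))\<^sup>2)"
          by (simp add: P_def inner_diff_left)
      qed
      moreover have "C * (l * G) * integral {\<alpha>..\<beta>} (\<lambda>t. (1 + norm (v t))\<^sup>2) \<le> C * (l * G) * M"
      proof -
        have "G \<ge> 0" unfolding G_def by (intro integral_nonneg integrable_continuous_real continuous_intros) auto
        then show ?thesis using M C(1) l by (intro mult_left_mono) auto
      qed
      moreover have "C * (l * G) * M + C * G = K1 * G" by (simp add: K1_def algebra_simps)
      ultimately have "integral {\<alpha>..\<beta>} (\<lambda>t. P t \<bullet> g t) \<le> \<epsilon> + K1 * G" using 1 by linarith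
      then show "integral {\<alpha>..\<beta>} (\<lambda>t. P t \<bullet> g t) \<le> \<epsilon> + K1 * integral {\<alpha>..\<beta>} (\<lambda>t. (norm (g t))\<^sup>2)"
        by (simp add: G_def)
    qed (use nn in auto)
    then obtain c where c: "integral {\<alpha>..\<beta>} (\<lambda>t. (norm (P t - c))\<^sup>2) \<le> K2 * \<epsilon>"
      unfolding K2_def by blast
    \<comment> \<open>Over an interval of length \<open>l\<close> a constant has square integral
      \<open>l\<close> times its square; writing \<open>c\<close> as \<open>P t - (P t - c)\<close>
      bounds this by the square integrals of the two parts.\<close>
    have nc: "norm c \<le> sqrt (2 * K2 / l) * sqrt \<epsilon> + sqrt (2 * D0 / l)"
    proof -
      have "((\<lambda>t. (norm c)\<^sup>2) has_integral l * (norm c)\<^sup>2) {\<alpha>..\<beta>}"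
        using has_integral_const_real[of "(norm c)\<^sup>2" \<alpha> \<beta>] assms(1) by (simp add: l_def)
      then have "l * (norm c)\<^sup>2 = integral {\<alpha>..\<beta>} (\<lambda>t. (norm c)\<^sup>2)" by (simp only: integral_unique)
      also have "\<dots> \<le> integral {\<alpha>..\<beta>} (\<lambda>t. 2 * (norm (P t - c))\<^sup>2 + 2 * (norm (P t))\<^sup>2)"
      proof (rule integral_le)
        fix t
        have "norm c \<le> norm (P t - c) + norm (P t)"
          using norm_triangle_ineq4[of "P t" "P t - c"] by simp
        then have "(norm c)\<^sup>2 \<le> (norm (P t - c) + norm (P t))\<^sup>2" by (intro power_mono) auto
        then show "(norm c)\<^sup>2 \<le> 2 * (norm (P t - c))\<^sup>2 + 2 * (norm (P t))\<^sup>2"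
          using sum_squares_bound[of "norm (P t - c)" "norm (P t)"] by (simp add: power2_sum)
      qed (intro integrable_continuous_real continuous_intros)+
      also have "\<dots> = 2 * integral {\<alpha>..\<beta>} (\<lambda>t. (norm (P t - c))\<^sup>2) + 2 * integral {\<alpha>..\<beta>} (\<lambda>t. (norm (P t))\<^sup>2)"
        by (subst integral_add) (auto intro!: integrable_continuous_real continuous_intros)
      also have "\<dots> \<le> 2 * (K2 * \<epsilon>) + 2 * D0" using c P2 by linarith
      finally have "(norm c)\<^sup>2 \<le> 2 * K2 / l * \<epsilon> + 2 * D0 / l" using l by (simp add: field_simps)
      then have "norm c \<le> sqrt (2 * K2 / l * \<epsilon> + 2 * D0 / l)" by (rule real_le_rsqrt)
      also have "\<dots> \<le> sqrt (2 * K2 / l * \<epsilon>) + sqrt (2 * D0 / l)"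
        using K2 \<epsilon> l nn by (intro sqrt_add_le_add_sqrt) auto
      finally show ?thesis by (simp only: real_sqrt_mult)
    qed
    define Z where "Z t = c + R t" for t
    have "continuous_on {\<alpha>..\<beta>} Z" unfolding Z_def by (intro continuous_intros)
    moreover have "integral {\<alpha>..\<beta>} (\<lambda>t. (norm (Lv t (x t) (v t) - Z t))\<^sup>2) \<le> K * \<epsilon>"
    proof -
      have "K2 * \<epsilon> \<le> K * \<epsilon>" unfolding K_def using \<epsilon> C(1) \<open>M \<ge> 0\<close> K2 nn l
        by (intro mult_right_mono) auto
      moreover have "(\<lambda>t. (norm (Lv t (x t) (v t) - Z t))\<^sup>2) = (\<lambda>t. (norm (P t - c))\<^sup>2)"
        by (auto simp: P_def p_def Z_def algebra_simps)
      ultimately show ?thesis using c by simp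
    qed
    moreover have "norm (Z t) \<le> K * (1 + sqrt \<epsilon>)" if t: "t \<in> {\<alpha>..\<beta>}" for t
    proof -
      have "norm (Z t) \<le> norm c + norm (R t)" unfolding Z_def by (rule norm_triangle_ineq)
      also have "\<dots> \<le> sqrt (2 * K2 / l) * sqrt \<epsilon> + sqrt (2 * D0 / l) + C * M"
        using nc RM[OF t] by linarith
      also have "\<dots> \<le> K * sqrt \<epsilon> + K"
      proof -
        have "sqrt (2 * K2 / l) * sqrt \<epsilon> \<le> K * sqrt \<epsilon>"
          unfolding K_def using \<epsilon> C(1) \<open>M \<ge> 0\<close> K2 nn l by (intro mult_right_mono) auto
        moreover have "sqrt (2 * D0 / l) + C * M \<le> K"
          unfolding K_def using C(1) \<open>M \<ge> 0\<close> K2 nn l by auto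
        ultimately show ?thesis by linarith
      qed
      finally show ?thesis by (simp add: algebra_simps)
    qed
    moreover have "norm (Z t - Z s) \<le> K * integral {s..t} (\<lambda>t. (1 + norm (v t))\<^sup>2)"
      if "\<alpha> \<le> s \<and> s \<le> t \<and> t \<le> \<beta>" for s t
    proof -
      have "norm (Z t - Z s) \<le> C * integral {s..t} (\<lambda>t. (1 + norm (v t))\<^sup>2)"
        using Rdiff[of s t] that by (simp add: Z_def)
      also have "\<dots> \<le> K * integral {s..t} (\<lambda>t. (1 + norm (v t))\<^sup>2)"
      proof (rule mult_right_mono)
        show "C \<le> K" unfolding K_def using C(1) \<open>M \<ge> 0\<close> K2 nn l by auto
        show "0 \<le> integral {s..t} (\<lambda>t. (1 + norm (v t))\<^sup>2)"
          by (rule integral_nonneg, rule integrable_continuous_real, rule continuous_on_subset[of "{\<alpha>..\<beta>}"])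
             (use that in \<open>auto intro!: continuous_intros\<close>)
      qed
      finally show ?thesis .
    qed
    ultimately show "\<exists>Z. continuous_on {\<alpha>..\<beta>} Z \<and>
          integral {\<alpha>..\<beta>} (\<lambda>t. (norm (Lv t (x t) (v t) - Z t))\<^sup>2) \<le> K * \<epsilon> \<and>
          (\<forall>t\<in>{\<alpha>..\<beta>}. norm (Z t) \<le> K * (1 + sqrt \<epsilon>)) \<and>
          (\<forall>s t. \<alpha> \<le> s \<and> s \<le> t \<and> t \<le> \<beta> \<longrightarrow>
             norm (Z t - Z s) \<le> K * integral {s..t} (\<lambda>t. (1 + norm (v t))\<^sup>2))"
      by blast
  qed (rule \<open>K \<ge> 0\<close>)
qed

text \<open>
  The pairs of position and approximate momentum \<open>Z\<close> are asymptotically equicontinuous. The limit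
  velocity \<open>u\<close> is read off the limit momentum by inverting \<open>Lv\<close>, hence it is continuous; strong
  monotonicity of \<open>Lv\<close> makes the velocities converge to \<open>u\<close> in the mean square.
\<close>

theorem near_minimisers_converge:
  fixes x v :: "nat \<Rightarrow> real \<Rightarrow> 'e"
  assumes "\<alpha> < \<beta>" and J: "{\<alpha>..\<beta>} \<subseteq> J" and "\<rho> > 0"
    and x: "\<And>n t. t \<in> {\<alpha>..\<beta>} \<Longrightarrow> (x n has_vector_derivative v n t) (at t within {\<alpha>..\<beta>})"
    and v: "\<And>n. continuous_on {\<alpha>..\<beta>} (v n)"
    and xB: "\<And>n t y. t \<in> {\<alpha>..\<beta>} \<Longrightarrow> norm (y - x n t) \<le> \<rho> \<Longrightarrow> y \<in> B"
    and M: "\<And>n. integral {\<alpha>..\<beta>} (\<lambda>t. (1 + norm (v n t))\<^sup>2) \<le> M"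
    and \<epsilon>: "\<And>n. \<epsilon> n > 0" "\<epsilon> \<longlonglongrightarrow> 0"
    and min: "\<And>n h h'. \<lbrakk>\<And>t. t \<in> {\<alpha>..\<beta>} \<Longrightarrow> (h has_vector_derivative h' t) (at t within {\<alpha>..\<beta>});
         continuous_on {\<alpha>..\<beta>} h'; h \<alpha> = 0; h \<beta> = 0; h' \<alpha> = 0; h' \<beta> = 0;
         \<And>t. t \<in> {\<alpha>..\<beta>} \<Longrightarrow> norm (h t) \<le> \<rho>\<rbrakk> \<Longrightarrow>
         integral {\<alpha>..\<beta>} (\<lambda>t. L t (x n t) (v n t))
           \<le> integral {\<alpha>..\<beta>} (\<lambda>t. L t (x n t + h t) (v n t + h' t)) + \<epsilon> n"
  obtains k y u where "strict_mono (k :: nat \<Rightarrow> nat)" "continuous_on {\<alpha>..\<beta>} u"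
    "\<And>t. t \<in> {\<alpha>..\<beta>} \<Longrightarrow> (y has_vector_derivative u t) (at t within {\<alpha>..\<beta>})"
    "\<And>t. t \<in> {\<alpha>..\<beta>} \<Longrightarrow> (\<lambda>n. x (k n) t) \<longlonglongrightarrow> y t"
    "\<And>s t. \<lbrakk>\<alpha> \<le> s; s \<le> t; t \<le> \<beta>\<rbrakk> \<Longrightarrow>
       (\<lambda>n. integral {s..t} (\<lambda>\<tau>. L \<tau> (x (k n) \<tau>) (v (k n) \<tau>)))
         \<longlonglongrightarrow> integral {s..t} (\<lambda>\<tau>. L \<tau> (y \<tau>) (u \<tau>))"
proof -
  obtain C where C: "C \<ge> 0"
    "\<And>t x v. \<lbrakk>t \<in> J; x \<in> B\<rbrakk> \<Longrightarrow> norm (Lx t x v) \<le> C * (1 + norm v)\<^sup>2"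
    "\<And>t x v. \<lbrakk>t \<in> J; x \<in> B\<rbrakk> \<Longrightarrow> norm (Lv t x v) \<le> C * (1 + norm v)"
    "\<And>t x y v. \<lbrakk>t \<in> J; x \<in> B; y \<in> B\<rbrakk> \<Longrightarrow> norm (Lv t y v - Lv t x v) \<le> C * (1 + norm v) * norm (y - x)"
    "\<And>t x y v w. \<lbrakk>t \<in> J; x \<in> B; y \<in> B\<rbrakk> \<Longrightarrow>
       \<bar>L t y w - L t x v - Lx t x v \<bullet> (y - x) - Lv t x v \<bullet> (w - v)\<bar>
                \<le> C * ((1 + norm v)\<^sup>2 * (norm (y - x))\<^sup>2 + (norm (w - v))\<^sup>2)"
    by (rule tameD[OF tame]) blast
  define l where "l = \<beta> - \<alpha>"
  have l: "l > 0" using assms by (simp add: l_def)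
  have x_in: "x n t \<in> B" if "t \<in> {\<alpha>..\<beta>}" for n t
    using xB[OF that, of "x n t" n] \<open>\<rho> > 0\<close> by simp
  have xc: "continuous_on {\<alpha>..\<beta>} (x n)" for n
    using x by (meson continuous_on_eq_continuous_within has_vector_derivative_continuous)
  define p where "p n t = Lv t (x n t) (v n t)" for n t
  have pc: "continuous_on {\<alpha>..\<beta>} (p n)" for n
    unfolding p_def by (rule tame_continuous[OF tame J xc v]) (use x_in in auto)
  have "0 \<le> integral {\<alpha>..\<beta>} (\<lambda>t. (1 + norm (v 0 t))\<^sup>2)"
    by (intro integral_nonneg integrable_continuous_real continuous_intros v) auto
  then have "M \<ge> 0" using M[of 0] by linarith
  obtain K where K: "K \<ge> 0" and K2: "\<And>n. \<exists>Z. continuous_on {\<alpha>..\<beta>} Z \<and>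
          integral {\<alpha>..\<beta>} (\<lambda>t. (norm (p n t - Z t))\<^sup>2) \<le> K * \<epsilon> n \<and>
          (\<forall>t\<in>{\<alpha>..\<beta>}. norm (Z t) \<le> K * (1 + sqrt (\<epsilon> n))) \<and>
          (\<forall>s t. \<alpha> \<le> s \<and> s \<le> t \<and> t \<le> \<beta> \<longrightarrow>
             norm (Z t - Z s) \<le> K * integral {s..t} (\<lambda>t. (1 + norm (v n t))\<^sup>2))"
  proof (rule momentum_approx[OF assms(1) J \<open>\<rho> > 0\<close> \<open>M \<ge> 0\<close>])
    fix K
    assume "K \<ge> 0" and *: "\<And>x v \<epsilon>. \<lbrakk>\<epsilon> > 0;
      \<And>t. t \<in> {\<alpha>..\<beta>} \<Longrightarrow> (x has_vector_derivative v t) (at t within {\<alpha>..\<beta>});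
      continuous_on {\<alpha>..\<beta>} v;
      \<And>t y. t \<in> {\<alpha>..\<beta>} \<Longrightarrow> norm (y - x t) \<le> \<rho> \<Longrightarrow> y \<in> B;
      integral {\<alpha>..\<beta>} (\<lambda>t. (1 + norm (v t))\<^sup>2) \<le> M;
      \<And>h h'. \<lbrakk>\<And>t. t \<in> {\<alpha>..\<beta>} \<Longrightarrow> (h has_vector_derivative h' t) (at t within {\<alpha>..\<beta>});
         continuous_on {\<alpha>..\<beta>} h'; h \<alpha> = 0; h \<beta> = 0; h' \<alpha> = 0; h' \<beta> = 0;
         \<And>t. t \<in> {\<alpha>..\<beta>} \<Longrightarrow> norm (h t) \<le> \<rho>\<rbrakk> \<Longrightarrow>
         integral {\<alpha>..\<beta>} (\<lambda>t. L t (x t) (v t))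
           \<le> integral {\<alpha>..\<beta>} (\<lambda>t. L t (x t + h t) (v t + h' t)) + \<epsilon>\<rbrakk>
     \<Longrightarrow> \<exists>Z. continuous_on {\<alpha>..\<beta>} Z \<and>
          integral {\<alpha>..\<beta>} (\<lambda>t. (norm (Lv t (x t) (v t) - Z t))\<^sup>2) \<le> K * \<epsilon> \<and>
          (\<forall>t\<in>{\<alpha>..\<beta>}. norm (Z t) \<le> K * (1 + sqrt \<epsilon>)) \<and>
          (\<forall>s t. \<alpha> \<le> s \<and> s \<le> t \<and> t \<le> \<beta> \<longrightarrow>
             norm (Z t - Z s) \<le> K * integral {s..t} (\<lambda>t. (1 + norm (v t))\<^sup>2))"
    show thesis
      by (rule that[OF \<open>K \<ge> 0\<close>]) (unfold p_def, rule *[OF \<epsilon>(1) x v xB M min], assumption+)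
  qed
  from choice[OF allI[OF K2]] obtain Z where "\<forall>n. continuous_on {\<alpha>..\<beta>} (Z n) \<and>
          integral {\<alpha>..\<beta>} (\<lambda>t. (norm (p n t - Z n t))\<^sup>2) \<le> K * \<epsilon> n \<and>
          (\<forall>t\<in>{\<alpha>..\<beta>}. norm (Z n t) \<le> K * (1 + sqrt (\<epsilon> n))) \<and>
          (\<forall>s t. \<alpha> \<le> s \<and> s \<le> t \<and> t \<le> \<beta> \<longrightarrow>
             norm (Z n t - Z n s) \<le> K * integral {s..t} (\<lambda>t. (1 + norm (v n t))\<^sup>2))" ..
  then have Z: "continuous_on {\<alpha>..\<beta>} (Z n)"
    "integral {\<alpha>..\<beta>} (\<lambda>t. (norm (p n t - Z n t))\<^sup>2) \<le> K * \<epsilon> n"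
    "t \<in> {\<alpha>..\<beta>} \<Longrightarrow> norm (Z n t) \<le> K * (1 + sqrt (\<epsilon> n))"
    "\<lbrakk>\<alpha> \<le> s; s \<le> t; t \<le> \<beta>\<rbrakk> \<Longrightarrow>
        norm (Z n t - Z n s) \<le> K * integral {s..t} (\<lambda>t. (1 + norm (v n t))\<^sup>2)"
    for n s t
    by simp_all
  note [continuous_intros] = v xc pc Z(1)
  have "bounded (range (\<lambda>n. sqrt (\<epsilon> n)))"
    by (rule convergent_imp_bounded, rule tendsto_real_sqrt, rule \<epsilon>)
  then obtain S where S0: "\<And>n. norm (sqrt (\<epsilon> n)) \<le> S" unfolding bounded_iff by auto
  have S: "sqrt (\<epsilon> n) \<le> S" for n using S0[of n] by simp
  define Zb where "Zb = K * (1 + S)"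
  have Zb: "norm (Z n t) \<le> Zb" if "t \<in> {\<alpha>..\<beta>}" for n t
  proof -
    have "K * (1 + sqrt (\<epsilon> n)) \<le> Zb" unfolding Zb_def using K S[of n] by (intro mult_left_mono) auto
    then show ?thesis using Z(3)[OF that, of n] by linarith
  qed
  define A1 where "A1 = 2 * (1 + (Zb + C) / \<kappa>)\<^sup>2"
  define A2 where "A2 = 2 / \<kappa>\<^sup>2"
  have A2: "A2 \<ge> 0" by (simp add: A2_def)
  \<comment> \<open>The inverse Legendre transform is Lipschitz and \<open>Z\<close> is bounded, so
    the velocity is bounded up to a multiple of the distance between momentum and \<open>Z\<close>,
    whose square has a small integral.\<close>
  have v2: "(1 + norm (v n t))\<^sup>2 \<le> A1 + A2 * (norm (p n t - Z n t))\<^sup>2" if t: "t \<in> {\<alpha>..\<beta>}" for n t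
  proof -
    have tJ: "t \<in> J" using t J by auto
    have "\<kappa> * norm (v n t) \<le> norm (p n t - Lv t (x n t) 0)"
      using mono_norm[OF tJ x_in[OF t], of "v n t" 0 n] by (simp add: p_def)
    also have "\<dots> \<le> norm (p n t - Z n t) + norm (Z n t) + norm (Lv t (x n t) 0)"
      using norm_triangle_ineq4[of "p n t" "Lv t (x n t) 0"] norm_triangle_ineq[of "p n t - Z n t" "Z n t"]
      by simp
    also have "\<dots> \<le> norm (p n t - Z n t) + Zb + C"
      using Zb[OF t, of n] C(3)[OF tJ x_in[OF t], of n 0] by simp
    finally have "norm (v n t) \<le> norm (p n t - Z n t) / \<kappa> + (Zb + C) / \<kappa>"
      using \<kappa> by (simp add: add_divide_distrib[symmetric] pos_le_divide_eq mult.commute)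
    then have "(1 + norm (v n t))\<^sup>2 \<le> ((1 + (Zb + C) / \<kappa>) + norm (p n t - Z n t) / \<kappa>)\<^sup>2"
      by (intro power_mono) auto
    also have "\<dots> \<le> 2 * (1 + (Zb + C) / \<kappa>)\<^sup>2 + 2 * (norm (p n t - Z n t) / \<kappa>)\<^sup>2"
      by (rule square_sum_le)
    finally show ?thesis by (simp add: A1_def A2_def power_divide)
  qed
  \<comment> \<open>The energy over a subinterval is at most proportional to its length, up to an
    error tending to 0. The plain energy bound would make the positions equicontinuous but not
    \<open>Z\<close>, since energy might concentrate on short intervals.\<close>
  have int_v2: "integral {s..t} (\<lambda>t. (1 + norm (v n t))\<^sup>2) \<le> A1 * (t - s) + A2 * (K * \<epsilon> n)"
    if "\<alpha> \<le> s" "s \<le> t" "t \<le> \<beta>" for n s t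
  proof -
    have sub: "{s..t} \<subseteq> {\<alpha>..\<beta>}" using that by auto
    have "integral {s..t} (\<lambda>t. (1 + norm (v n t))\<^sup>2)
        \<le> integral {s..t} (\<lambda>t. A1 + A2 * (norm (p n t - Z n t))\<^sup>2)"
      by (intro integral_le integrable_continuous_real continuous_on_subset[OF _ sub] continuous_intros v2)
         (use sub in auto)
    also have "\<dots> = A1 * (t - s) + A2 * integral {s..t} (\<lambda>t. (norm (p n t - Z n t))\<^sup>2)"
      using that by (subst integral_add)
        (auto intro!: integrable_continuous_real continuous_on_subset[OF _ sub] continuous_intros)
    also have "integral {s..t} (\<lambda>t. (norm (p n t - Z n t))\<^sup>2) \<le> integral {\<alpha>..\<beta>} (\<lambda>t. (norm (p n t - Z n t))\<^sup>2)"
      using that by (intro integral_mono_subinterval continuous_intros) auto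
    also have "\<dots> \<le> K * \<epsilon> n" by (rule Z(2))
    finally show ?thesis using A2 by (simp add: mult_left_mono)
  qed
  have xdiff: "x n t - x n s = integral {s..t} (v n)" if "\<alpha> \<le> s" "s \<le> t" "t \<le> \<beta>" for n s t
  proof -
    have sub: "{s..t} \<subseteq> {\<alpha>..\<beta>}" using that by auto
    have "(v n has_integral (x n t - x n s)) {s..t}"
      by (rule fundamental_theorem_of_calculus[OF that(2)])
         (rule has_vector_derivative_within_subset[OF x sub], use sub in auto)
    then show ?thesis by (simp add: integral_unique)
  qed
  define F where "F n t = (x n t, Z n t)" for n t
  have F_cont: "continuous_on {\<alpha>..\<beta>} (F n)" for n unfolding F_def by (intro continuous_intros)
  obtain Bb where Bb: "\<And>y. y \<in> B \<Longrightarrow> norm y \<le> Bb"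
    using compact_imp_bounded[OF cpt] unfolding bounded_iff by auto
  obtain g k where g: "continuous_on {\<alpha>..\<beta>} g" and k: "strict_mono (k :: nat \<Rightarrow> nat)"
    and conv: "\<And>e. 0 < e \<Longrightarrow> \<exists>N. \<forall>n t. n \<ge> N \<and> t \<in> {\<alpha>..\<beta>} \<longrightarrow> norm (F (k n) t - g t) < e"
  proof (rule Arzela_Ascoli_asymptotic[OF F_cont])
    show "norm (F n t) \<le> Bb + Zb" if "t \<in> {\<alpha>..\<beta>}" for n t
      unfolding F_def by (rule order_trans[OF norm_Pair_le add_mono[OF Bb[OF x_in[OF that]] Zb[OF that]]])
    show "norm (F n t - F n s) \<le> ((1 + K) * A1) * (t - s) + (1 + K) * (A2 * (K * \<epsilon> n))"
      if st: "\<alpha> \<le> s" "s \<le> t" "t \<le> \<beta>" for n s t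
    proof -
      define I where "I = integral {s..t} (\<lambda>t. (1 + norm (v n t))\<^sup>2)"
      have sub: "{s..t} \<subseteq> {\<alpha>..\<beta>}" using that by auto
      have "norm (x n t - x n s) \<le> I"
        unfolding xdiff[OF st] I_def
      proof (rule integral_norm_bound_integral)
        show "norm (v n \<tau>) \<le> (1 + norm (v n \<tau>))\<^sup>2" for \<tau>
          using zero_le_power2[of "norm (v n \<tau>)"] norm_ge_zero[of "v n \<tau>"]
          by (simp add: power2_sum del: norm_ge_zero zero_le_power2)
      qed (intro integrable_continuous_real continuous_on_subset[OF _ sub] continuous_intros)+
      moreover have "norm (Z n t - Z n s) \<le> K * I" unfolding I_def by (rule Z(4)[OF st])
      moreover have "norm (F n t - F n s) \<le> norm (x n t - x n s) + norm (Z n t - Z n s)"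
        by (simp add: F_def norm_Pair_le)
      ultimately have "norm (F n t - F n s) \<le> (1 + K) * I" by (simp add: algebra_simps)
      also have "\<dots> \<le> (1 + K) * (A1 * (t - s) + A2 * (K * \<epsilon> n))"
        unfolding I_def using K by (intro mult_left_mono int_v2 st) auto
      finally show ?thesis by (simp add: algebra_simps)
    qed
    have "(\<lambda>n. (1 + K) * (A2 * (K * \<epsilon> n))) \<longlonglongrightarrow> (1 + K) * (A2 * (K * 0))"
      by (intro tendsto_intros \<epsilon>)
    then show "(\<lambda>n. (1 + K) * (A2 * (K * \<epsilon> n))) \<longlonglongrightarrow> 0" by simp
  qed (rule that, assumption, assumption, blast)
  define y where "y t = fst (g t)" for t
  define Zl where "Zl t = snd (g t)" for t
  have yc: "continuous_on {\<alpha>..\<beta>} y" and Zlc: "continuous_on {\<alpha>..\<beta>} Zl"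
    unfolding y_def Zl_def by (intro continuous_intros g)+
  define d where "d n = (SUP t\<in>{\<alpha>..\<beta>}. norm (F (k n) t - g t))" for n
  have d: "norm (F (k n) t - g t) \<le> d n" if "t \<in> {\<alpha>..\<beta>}" for n t
  proof -
    have "continuous_on {\<alpha>..\<beta>} (\<lambda>t. norm (F (k n) t - g t))" by (intro continuous_intros F_cont g)
    then have "bounded ((\<lambda>t. norm (F (k n) t - g t)) ` {\<alpha>..\<beta>})"
      using compact_continuous_image compact_imp_bounded by blast
    then show ?thesis unfolding d_def by (intro cSUP_upper that bounded_imp_bdd_above)
  qed
  have d0: "d n \<ge> 0" for n using order_trans[OF norm_ge_zero d, of \<alpha> n] assms(1) by auto
  have d_lim: "d \<longlonglongrightarrow> 0"
  proof (rule LIMSEQ_I)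
    fix e :: real assume "e > 0"
    then obtain N where N: "\<forall>n t. n \<ge> N \<and> t \<in> {\<alpha>..\<beta>} \<longrightarrow> norm (F (k n) t - g t) < e / 2"
      using conv[of "e/2"] by auto
    have "d n \<le> e / 2" if "n \<ge> N" for n
      unfolding d_def by (rule cSUP_least) (use N that assms(1) less_imp_le in auto)
    then show "\<exists>N. \<forall>n\<ge>N. norm (d n - 0) < e"
      using d0 \<open>e > 0\<close> by (intro exI[of _ N]) (fastforce)
  qed
  have dx: "norm (x (k n) t - y t) \<le> d n" and dZ: "norm (Z (k n) t - Zl t) \<le> d n"
    if "t \<in> {\<alpha>..\<beta>}" for n t
  proof -
    have eq: "F (k n) t - g t = (x (k n) t - y t, Z (k n) t - Zl t)"
      by (simp add: F_def y_def Zl_def prod_eq_iff)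
    show "norm (x (k n) t - y t) \<le> d n"
      using d[OF that, of n] unfolding eq by (rule order_trans[OF norm_fst_le])
    show "norm (Z (k n) t - Zl t) \<le> d n"
      using d[OF that, of n] unfolding eq by (rule order_trans[OF norm_snd_le])
  qed
  have x_lim: "(\<lambda>n. x (k n) t) \<longlonglongrightarrow> y t" if "t \<in> {\<alpha>..\<beta>}" for t
    by (rule Lim_transform, rule tendsto_const, rule Lim_null_comparison[OF _ d_lim])
       (use dx[OF that] in \<open>auto simp: norm_minus_commute\<close>)
  have yB: "y t \<in> B" if "t \<in> {\<alpha>..\<beta>}" for t
    by (rule closed_sequentially[OF compact_imp_closed[OF cpt] _ x_lim[OF that]]) (rule x_in[OF that])
  \<comment> \<open>The Legendre transform is inverted at the limit position and limit momentum; by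
    \<open>mono_norm\<close> the solution is unique, so nothing depends on the choice.\<close>
  define u where "u t = (SOME w. Lv t (y t) w = Zl t)" for t
  have u: "Lv t (y t) (u t) = Zl t" if "t \<in> {\<alpha>..\<beta>}" for t
    unfolding u_def by (rule someI_ex, rule surj) (use that J yB in auto)
  \<comment> \<open>Comparison with the fixed velocity \<open>u t\<close>: by
    \<open>mono_norm\<close> the norm of \<open>u s - u t\<close> is at most 1 / \<kappa> times the
    distance of the two momenta at the position \<open>y s\<close>, which is continuous in
    \<open>s\<close> and vanishes at \<open>t\<close>.\<close>
  have uc: "continuous_on {\<alpha>..\<beta>} u"
    unfolding continuous_on_def
  proof
    fix t assume t: "t \<in> {\<alpha>..\<beta>}"
    have "continuous_on {\<alpha>..\<beta>} (\<lambda>s. norm (Zl s - Lv s (y s) (u t)) / \<kappa>)"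
      using \<kappa> by (intro continuous_intros Zlc tame_continuous[OF tame J yc]) (use yB in auto)
    then have "((\<lambda>s. norm (Zl s - Lv s (y s) (u t)) / \<kappa>) \<longlongrightarrow> norm (Zl t - Lv t (y t) (u t)) / \<kappa>)
        (at t within {\<alpha>..\<beta>})"
      using t unfolding continuous_on_def by blast
    then have lim: "((\<lambda>s. norm (Zl s - Lv s (y s) (u t)) / \<kappa>) \<longlongrightarrow> 0) (at t within {\<alpha>..\<beta>})"
      using u[OF t] by simp
    have "norm (u s - u t) \<le> norm (Zl s - Lv s (y s) (u t)) / \<kappa>" if s: "s \<in> {\<alpha>..\<beta>}" for s
      using mono_norm[of s "y s" "u s" "u t"] yB[OF s] u[OF s] s J \<kappa>
      by (auto simp: field_simps)
    then have "((\<lambda>s. u s - u t) \<longlongrightarrow> 0) (at t within {\<alpha>..\<beta>})"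
      by (intro Lim_null_comparison[OF _ lim]) (auto simp: eventually_at_filter)
    then show "(u \<longlongrightarrow> u t) (at t within {\<alpha>..\<beta>})" by (rule LIM_zero_cancel)
  qed
  note [continuous_intros] = yc uc
  obtain U where U: "U \<ge> 0" "\<And>t. t \<in> {\<alpha>..\<beta>} \<Longrightarrow> norm (u t) \<le> U"
  proof -
    obtain U where "U > 0" "\<forall>x\<in>u ` {\<alpha>..\<beta>}. norm x \<le> U"
      using compact_imp_bounded[OF compact_continuous_image[OF uc compact_Icc]]
      unfolding bounded_pos by auto
    then show ?thesis using that[of U] by auto
  qed
  define W where "W = 1 + C * (1 + U)"
  define Q where "Q n = integral {\<alpha>..\<beta>} (\<lambda>t. (norm (v (k n) t - u t))\<^sup>2)" for n
  have Q0: "Q n \<ge> 0" for n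
    unfolding Q_def by (intro integral_nonneg integrable_continuous_real continuous_intros) auto
  \<comment> \<open>The momenta of \<open>v (k n) t\<close> and \<open>u t\<close> are compared at
    the same position \<open>x (k n) t\<close>. Their difference splits into the mean-square error
    of the momentum, the uniform error of \<open>Z\<close>, and the change of \<open>Lv\<close>
    between the positions \<open>x (k n) t\<close> and \<open>y t\<close> at the bounded velocity
    \<open>u t\<close>.\<close>
  have vu: "(norm (v (k n) t - u t))\<^sup>2 \<le> A2 * (norm (p (k n) t - Z (k n) t))\<^sup>2 + A2 * (W * d n)\<^sup>2"
    if t: "t \<in> {\<alpha>..\<beta>}" for n t
  proof -
    have tJ: "t \<in> J" using t J by auto
    have "\<kappa> * norm (v (k n) t - u t) \<le> norm (p (k n) t - Lv t (x (k n) t) (u t))"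
      unfolding p_def by (rule mono_norm[OF tJ x_in[OF t]])
    also have "\<dots> = norm ((p (k n) t - Z (k n) t) + (Z (k n) t - Zl t) - (Lv t (x (k n) t) (u t) - Lv t (y t) (u t)))"
      using u[OF t] by simp
    also have "\<dots> \<le> norm (p (k n) t - Z (k n) t) + norm (Z (k n) t - Zl t)
        + norm (Lv t (x (k n) t) (u t) - Lv t (y t) (u t))"
      by (rule order_trans[OF norm_triangle_ineq4 add_right_mono[OF norm_triangle_ineq]])
    also have "\<dots> \<le> norm (p (k n) t - Z (k n) t) + d n + C * (1 + U) * d n"
    proof -
      have "norm (Lv t (x (k n) t) (u t) - Lv t (y t) (u t)) \<le> C * (1 + norm (u t)) * norm (x (k n) t - y t)"
        by (rule C(4)[OF tJ yB[OF t] x_in[OF t]])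
      also have "\<dots> \<le> C * (1 + U) * d n"
        using C(1) U(1) U(2)[OF t] dx[OF t, of n] by (intro mult_mono) auto
      finally show ?thesis using dZ[OF t, of n] by linarith
    qed
    finally have "norm (v (k n) t - u t) * \<kappa> \<le> norm (p (k n) t - Z (k n) t) + W * d n"
      by (simp add: W_def algebra_simps)
    then have "norm (v (k n) t - u t) \<le> norm (p (k n) t - Z (k n) t) / \<kappa> + W * d n / \<kappa>"
      using \<kappa> by (simp add: add_divide_distrib[symmetric] pos_le_divide_eq)
    then have "(norm (v (k n) t - u t))\<^sup>2 \<le> (norm (p (k n) t - Z (k n) t) / \<kappa> + W * d n / \<kappa>)\<^sup>2"
      by (intro power_mono) auto
    also have "\<dots> \<le> 2 * (norm (p (k n) t - Z (k n) t) / \<kappa>)\<^sup>2 + 2 * (W * d n / \<kappa>)\<^sup>2"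
      by (rule square_sum_le)
    finally show ?thesis by (simp add: A2_def power_divide)
  qed
  have Q_le: "Q n \<le> A2 * (K * \<epsilon> (k n)) + A2 * (W * d n)\<^sup>2 * l" for n
  proof -
    have "Q n \<le> integral {\<alpha>..\<beta>} (\<lambda>t. A2 * (norm (p (k n) t - Z (k n) t))\<^sup>2 + A2 * (W * d n)\<^sup>2)"
      unfolding Q_def by (intro integral_le integrable_continuous_real continuous_intros vu)
    also have "\<dots> = A2 * integral {\<alpha>..\<beta>} (\<lambda>t. (norm (p (k n) t - Z (k n) t))\<^sup>2) + A2 * (W * d n)\<^sup>2 * l"
      using assms(1) unfolding l_def
      by (subst integral_add) (auto intro!: integrable_continuous_real continuous_intros)
    also have "\<dots> \<le> A2 * (K * \<epsilon> (k n)) + A2 * (W * d n)\<^sup>2 * l"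
      using Z(2)[of "k n"] A2 by (intro add_right_mono mult_left_mono) auto
    finally show ?thesis .
  qed
  have Q_lim: "Q \<longlonglongrightarrow> 0"
  proof (rule tendsto_sandwich[OF _ _ tendsto_const])
    have "(\<lambda>n. \<epsilon> (k n)) \<longlonglongrightarrow> 0" using LIMSEQ_subseq_LIMSEQ[OF \<epsilon>(2) k] by (simp add: o_def)
    then have "(\<lambda>n. A2 * (K * \<epsilon> (k n)) + A2 * (W * d n)\<^sup>2 * l) \<longlonglongrightarrow> A2 * (K * 0) + A2 * (W * 0)\<^sup>2 * l"
      by (intro tendsto_intros d_lim)
    then show "(\<lambda>n. A2 * (K * \<epsilon> (k n)) + A2 * (W * d n)\<^sup>2 * l) \<longlonglongrightarrow> 0" by simp
  qed (use Q0 Q_le in auto)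
  \<comment> \<open>Mean-square convergence of the velocities passes to their integrals, so the
    limit of the positions is a primitive of the continuous function \<open>u\<close>, hence
    C^1.\<close>
  have y_int: "y t = y \<alpha> + integral {\<alpha>..t} u" if t: "t \<in> {\<alpha>..\<beta>}" for t
  proof -
    have sub: "{\<alpha>..t} \<subseteq> {\<alpha>..\<beta>}" using t by auto
    have "(\<lambda>n. integral {\<alpha>..t} (v (k n)) - integral {\<alpha>..t} u) \<longlonglongrightarrow> 0"
    proof (rule Lim_null_comparison)
      have "norm (integral {\<alpha>..t} (v (k n)) - integral {\<alpha>..t} u) \<le> sqrt (l * Q n)" for n
      proof (rule real_le_rsqrt)
        have "integral {\<alpha>..t} (v (k n)) - integral {\<alpha>..t} u = integral {\<alpha>..t} (\<lambda>s. v (k n) s - u s)"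
          by (rule integral_diff[symmetric]; intro integrable_continuous_real
              continuous_on_subset[OF _ sub] continuous_intros)
        also have "(norm \<dots>)\<^sup>2 \<le> (t - \<alpha>) * integral {\<alpha>..t} (\<lambda>s. (norm (v (k n) s - u s))\<^sup>2)"
          using t by (intro norm_integral_square_le continuous_on_subset[OF _ sub] continuous_intros) auto
        also have "\<dots> \<le> l * Q n"
          unfolding Q_def l_def using t
          by (intro mult_mono integral_mono_subinterval integral_nonneg integrable_continuous_real
              continuous_on_subset[OF _ sub] continuous_intros) auto
        finally show "(norm (integral {\<alpha>..t} (v (k n)) - integral {\<alpha>..t} u))\<^sup>2 \<le> l * Q n" .
      qed
      then show "\<forall>\<^sub>F n in sequentially. norm (integral {\<alpha>..t} (v (k n)) - integral {\<alpha>..t} u) \<le> sqrt (l * Q n)"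
        by simp
      have "(\<lambda>n. sqrt (l * Q n)) \<longlonglongrightarrow> sqrt (l * 0)" by (intro tendsto_intros Q_lim)
      then show "(\<lambda>n. sqrt (l * Q n)) \<longlonglongrightarrow> 0" by simp
    qed
    then have "(\<lambda>n. integral {\<alpha>..t} (v (k n))) \<longlonglongrightarrow> integral {\<alpha>..t} u" by (rule LIM_zero_cancel)
    moreover have "(\<lambda>n. x (k n) t - x (k n) \<alpha>) \<longlonglongrightarrow> y t - y \<alpha>"
      using t by (intro tendsto_diff x_lim) auto
    moreover have "x (k n) t - x (k n) \<alpha> = integral {\<alpha>..t} (v (k n))" for n
      using t by (intro xdiff) auto
    ultimately have "y t - y \<alpha> = integral {\<alpha>..t} u" by (simp add: LIMSEQ_unique)
    then show ?thesis by (simp add: algebra_simps)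
  qed
  have y': "(y has_vector_derivative u t) (at t within {\<alpha>..\<beta>})" if t: "t \<in> {\<alpha>..\<beta>}" for t
  proof (rule has_vector_derivative_transform[OF t])
    show "((\<lambda>t. y \<alpha> + integral {\<alpha>..t} u) has_vector_derivative u t) (at t within {\<alpha>..\<beta>})"
      using has_vector_derivative_add[OF has_vector_derivative_const integral_has_vector_derivative[OF uc t]]
      by simp
  qed (rule y_int)
  \<comment> \<open>\<open>L\<close> is expanded around the limit, where the velocity is at most
    \<open>U\<close> and the coefficients stay bounded. The three terms come from the displacement,
    from the velocity error (by Cauchy-Schwarz) and from its square; they do not depend on the
    subinterval.\<close>
  define H where "H n = C * (1 + U)\<^sup>2 * (d n + (d n)\<^sup>2) * l + C * (1 + U) * sqrt (l * Q n) + C * Q n" for n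
  have H_lim: "H \<longlonglongrightarrow> 0"
  proof -
    have "H \<longlonglongrightarrow> C * (1 + U)\<^sup>2 * (0 + 0\<^sup>2) * l + C * (1 + U) * sqrt (l * 0) + C * 0"
      unfolding H_def by (intro tendsto_intros d_lim Q_lim)
    then show ?thesis by simp
  qed
  have act: "(\<lambda>n. integral {s..t} (\<lambda>\<tau>. L \<tau> (x (k n) \<tau>) (v (k n) \<tau>)))
         \<longlonglongrightarrow> integral {s..t} (\<lambda>\<tau>. L \<tau> (y \<tau>) (u \<tau>))" if st: "\<alpha> \<le> s" "s \<le> t" "t \<le> \<beta>" for s t
  proof -
    have sub: "{s..t} \<subseteq> {\<alpha>..\<beta>}" using st by auto
    have Lyc: "continuous_on {\<alpha>..\<beta>} (\<lambda>\<tau>. L \<tau> (y \<tau>) (u \<tau>))"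
      by (rule tame_continuous[OF tame J yc uc]) (use yB in auto)
    have Lnc: "continuous_on {\<alpha>..\<beta>} (\<lambda>\<tau>. L \<tau> (x (k n) \<tau>) (v (k n) \<tau>))" for n
      by (rule tame_continuous[OF tame J xc v]) (use x_in in auto)
    note [continuous_intros] = Lyc Lnc
    have "norm (integral {s..t} (\<lambda>\<tau>. L \<tau> (x (k n) \<tau>) (v (k n) \<tau>)) - integral {s..t} (\<lambda>\<tau>. L \<tau> (y \<tau>) (u \<tau>)))
        \<le> H n" for n
    proof -
      have "integral {s..t} (\<lambda>\<tau>. L \<tau> (x (k n) \<tau>) (v (k n) \<tau>)) - integral {s..t} (\<lambda>\<tau>. L \<tau> (y \<tau>) (u \<tau>))
          = integral {s..t} (\<lambda>\<tau>. L \<tau> (x (k n) \<tau>) (v (k n) \<tau>) - L \<tau> (y \<tau>) (u \<tau>))"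
        by (rule integral_diff[symmetric]; intro integrable_continuous_real
            continuous_on_subset[OF _ sub] continuous_intros)
      also have "norm \<dots> \<le> integral {s..t} (\<lambda>\<tau>. norm (L \<tau> (x (k n) \<tau>) (v (k n) \<tau>) - L \<tau> (y \<tau>) (u \<tau>)))"
        by (intro integral_norm_bound_integral integrable_continuous_real
            continuous_on_subset[OF _ sub] continuous_intros) auto
      also have "\<dots> \<le> integral {\<alpha>..\<beta>} (\<lambda>\<tau>. norm (L \<tau> (x (k n) \<tau>) (v (k n) \<tau>) - L \<tau> (y \<tau>) (u \<tau>)))"
        using st by (intro integral_mono_subinterval continuous_intros) auto
      also have "\<dots> \<le> integral {\<alpha>..\<beta>} (\<lambda>\<tau>. C * (1 + U)\<^sup>2 * (d n + (d n)\<^sup>2)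
          + C * (1 + U) * norm (v (k n) \<tau> - u \<tau>) + C * (norm (v (k n) \<tau> - u \<tau>))\<^sup>2)"
      proof (rule integral_le)
        fix \<tau> assume t: "\<tau> \<in> {\<alpha>..\<beta>}"
        have tJ: "\<tau> \<in> J" using t J by auto
        define a where "a = Lx \<tau> (y \<tau>) (u \<tau>) \<bullet> (x (k n) \<tau> - y \<tau>)"
        define b where "b = Lv \<tau> (y \<tau>) (u \<tau>) \<bullet> (v (k n) \<tau> - u \<tau>)"
        have 1: "(1 + norm (u \<tau>))\<^sup>2 \<le> (1 + U)\<^sup>2" using U(2)[OF t] by (intro power_mono) auto
        have dd: "(norm (x (k n) \<tau> - y \<tau>))\<^sup>2 \<le> (d n)\<^sup>2" using dx[OF t, of n] by (intro power_mono) auto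
        have "\<bar>a\<bar> \<le> norm (Lx \<tau> (y \<tau>) (u \<tau>)) * norm (x (k n) \<tau> - y \<tau>)"
          unfolding a_def by (rule Cauchy_Schwarz_ineq2)
        also have "\<dots> \<le> (C * (1 + norm (u \<tau>))\<^sup>2) * d n"
          using C(1) dx[OF t] by (intro mult_mono C(2)[OF tJ yB[OF t]]) auto
        also have "\<dots> \<le> (C * (1 + U)\<^sup>2) * d n"
          using C(1) 1 d0 by (intro mult_right_mono mult_left_mono) auto
        finally have a: "\<bar>a\<bar> \<le> C * (1 + U)\<^sup>2 * d n" .
        have "\<bar>b\<bar> \<le> norm (Lv \<tau> (y \<tau>) (u \<tau>)) * norm (v (k n) \<tau> - u \<tau>)"
          unfolding b_def by (rule Cauchy_Schwarz_ineq2)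
        also have "\<dots> \<le> (C * (1 + norm (u \<tau>))) * norm (v (k n) \<tau> - u \<tau>)"
          by (intro mult_right_mono C(3)[OF tJ yB[OF t]]) auto
        also have "\<dots> \<le> C * (1 + U) * norm (v (k n) \<tau> - u \<tau>)"
          using C(1) U(2)[OF t] by (intro mult_right_mono mult_left_mono) auto
        finally have b: "\<bar>b\<bar> \<le> C * (1 + U) * norm (v (k n) \<tau> - u \<tau>)" .
        have "\<bar>L \<tau> (x (k n) \<tau>) (v (k n) \<tau>) - L \<tau> (y \<tau>) (u \<tau>) - a - b\<bar>
            \<le> C * ((1 + norm (u \<tau>))\<^sup>2 * (norm (x (k n) \<tau> - y \<tau>))\<^sup>2 + (norm (v (k n) \<tau> - u \<tau>))\<^sup>2)"
          unfolding a_def b_def by (rule C(5)[OF tJ yB[OF t] x_in[OF t]])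
        also have "\<dots> \<le> C * ((1 + U)\<^sup>2 * (d n)\<^sup>2 + (norm (v (k n) \<tau> - u \<tau>))\<^sup>2)"
          using C(1) 1 dd by (intro mult_left_mono add_right_mono mult_mono) auto
        also have "\<dots> = C * (1 + U)\<^sup>2 * (d n)\<^sup>2 + C * (norm (v (k n) \<tau> - u \<tau>))\<^sup>2"
          by (simp add: algebra_simps)
        finally show "norm (L \<tau> (x (k n) \<tau>) (v (k n) \<tau>) - L \<tau> (y \<tau>) (u \<tau>)) \<le> C * (1 + U)\<^sup>2 * (d n + (d n)\<^sup>2)
          + C * (1 + U) * norm (v (k n) \<tau> - u \<tau>) + C * (norm (v (k n) \<tau> - u \<tau>))\<^sup>2"
          using a b unfolding real_norm_def distrib_left by linarith
      qed (intro integrable_continuous_real continuous_intros)+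
      also have "\<dots> = C * (1 + U)\<^sup>2 * (d n + (d n)\<^sup>2) * l
          + C * (1 + U) * integral {\<alpha>..\<beta>} (\<lambda>\<tau>. norm (v (k n) \<tau> - u \<tau>)) + C * Q n"
      proof (rule integral_unique, intro has_integral_add)
        show "((\<lambda>\<tau>. C * (1 + U)\<^sup>2 * (d n + (d n)\<^sup>2)) has_integral C * (1 + U)\<^sup>2 * (d n + (d n)\<^sup>2) * l) {\<alpha>..\<beta>}"
          using has_integral_const_real[of "C * (1 + U)\<^sup>2 * (d n + (d n)\<^sup>2)" \<alpha> \<beta>] assms(1)
          by (simp add: l_def mult.commute)
        show "((\<lambda>\<tau>. C * (1 + U) * norm (v (k n) \<tau> - u \<tau>)) has_integral
            C * (1 + U) * integral {\<alpha>..\<beta>} (\<lambda>\<tau>. norm (v (k n) \<tau> - u \<tau>))) {\<alpha>..\<beta>}"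
          by (intro has_integral_mult_right integrable_integral integrable_continuous_real continuous_intros)
        show "((\<lambda>\<tau>. C * (norm (v (k n) \<tau> - u \<tau>))\<^sup>2) has_integral C * Q n) {\<alpha>..\<beta>}"
          unfolding Q_def
          by (intro has_integral_mult_right integrable_integral integrable_continuous_real continuous_intros)
      qed
      also have "\<dots> \<le> H n"
      proof -
        have "integral {\<alpha>..\<beta>} (\<lambda>\<tau>. norm (v (k n) \<tau> - u \<tau>)) \<le> sqrt (l * Q n)"
          unfolding Q_def l_def using assms(1)
          by (intro real_le_rsqrt integral_square_le continuous_intros) auto
        then have "C * (1 + U) * integral {\<alpha>..\<beta>} (\<lambda>\<tau>. norm (v (k n) \<tau> - u \<tau>)) \<le> C * (1 + U) * sqrt (l * Q n)"
          using C(1) U(1) by (intro mult_left_mono) auto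
        then show ?thesis by (simp add: H_def)
      qed
      finally show ?thesis .
    qed
    then have "(\<lambda>n. integral {s..t} (\<lambda>\<tau>. L \<tau> (x (k n) \<tau>) (v (k n) \<tau>)) - integral {s..t} (\<lambda>\<tau>. L \<tau> (y \<tau>) (u \<tau>)))
        \<longlonglongrightarrow> 0"
      by (intro Lim_null_comparison[OF _ H_lim]) auto
    then show ?thesis by (rule LIM_zero_cancel)
  qed
  show ?thesis by (rule that[OF k uc y' x_lim act])
qed

end


section \<open>Lagrangians that are quadratic in the velocity\<close>

lemma Ck_on_SucD: "Ck_on (Suc k) f S \<Longrightarrow> Ck_on k f S"
proof (induction k arbitrary: f)
  case 0
  then show ?case
    by simp (blast intro: continuous_at_imp_continuous_on has_derivative_continuous)
next
  case (Suc k)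
  then show ?case by (metis Ck_on.simps(2))
qed

lemma Ck_on_le:
  assumes "Ck_on k f S" "j \<le> k"
  shows "Ck_on j f S"
  using assms(2,1) by (induction rule: dec_induct) (auto dest: Ck_on_SucD simp del: Ck_on.simps)

lemma Ck_on_imp_continuous_on: "Ck_on k f S \<Longrightarrow> continuous_on S f"
  using Ck_on_le[of k f S 0] by simp

text \<open>The gradient in the position collects the total derivative in the directions
  \<open>(0, i)\<close>; by the chain rule along the inclusion of a time slice it is the gradient at
  fixed time. Its components lose one degree of differentiability, jointly in time and
  position.\<close>

lemma Ck_on_partial_gradient:
  fixes f :: "real \<times> 'e::euclidean_space \<Rightarrow> real"
  assumes "Ck_on (Suc k) f \<Omega>"
  shows "\<exists>D. (\<forall>t x. (t, x) \<in> \<Omega> \<longrightarrow> ((\<lambda>x. f (t, x)) has_derivative (\<lambda>h. D (t, x) \<bullet> h)) (at x)) \<and>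
    (\<forall>i\<in>Basis. Ck_on k (\<lambda>z. D z \<bullet> i) \<Omega>)"
proof -
  obtain f' where f': "\<And>z. z \<in> \<Omega> \<Longrightarrow> (f has_derivative f' z) (at z)" "\<And>v. Ck_on k (\<lambda>z. f' z v) \<Omega>"
    using assms by auto
  define D :: "real \<times> 'e \<Rightarrow> 'e" where "D z = (\<Sum>i\<in>Basis. f' z (0, i) *\<^sub>R i)" for z
  have Di: "D z \<bullet> i = f' z (0, i)" if "i \<in> Basis" for z i
    using that by (simp add: D_def inner_sum_left inner_Basis if_distrib sum.delta cong: if_cong)
  show ?thesis
  proof (intro exI[of _ D] conjI allI impI ballI)
    fix t and x :: 'e assume z: "(t, x) \<in> \<Omega>"
    have "((\<lambda>x. (t, x)) has_derivative (\<lambda>h. (0, h))) (at x)"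
      by (auto intro!: derivative_eq_intros)
    from diff_chain_at[OF this f'(1)[OF z]]
    have d: "((\<lambda>x. f (t, x)) has_derivative (\<lambda>h. f' (t, x) (0, h))) (at x)" by (simp add: o_def)
    have lin: "linear (\<lambda>h. f' (t, x) (0, h))"
      using has_derivative_linear[OF d] .
    have "f' (t, x) (0, h) = D (t, x) \<bullet> h" for h
    proof -
      have "f' (t, x) (0, h) = f' (t, x) (0, \<Sum>i\<in>Basis. (h \<bullet> i) *\<^sub>R i)" by (simp add: euclidean_representation)
      also have "\<dots> = (\<Sum>i\<in>Basis. (h \<bullet> i) * f' (t, x) (0, i))"
        using linear_sum[OF lin, of "\<lambda>i. (h \<bullet> i) *\<^sub>R i" Basis] linear_cmul[OF lin] by simp
      also have "\<dots> = D (t, x) \<bullet> h"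
        by (simp add: D_def inner_sum_left) (simp add: inner_commute mult.commute)
      finally show ?thesis .
    qed
    then show "((\<lambda>x. f (t, x)) has_derivative (\<lambda>h. D (t, x) \<bullet> h)) (at x)" using d by simp
  next
    fix i :: 'e assume "i \<in> Basis"
    then show "Ck_on k (\<lambda>z. D z \<bullet> i) \<Omega>" using f'(2)[of "(0, i)"] by (simp add: Di)
  qed
qed

lemma compact_bound:
  fixes f :: "'a::topological_space \<Rightarrow> 'b::real_normed_vector"
  assumes "compact S" "continuous_on S f"
  obtains C where "C \<ge> 0" "\<And>z. z \<in> S \<Longrightarrow> norm (f z) \<le> C"
proof -
  obtain C where "C > 0" "\<forall>x\<in>f ` S. norm x \<le> C"
    using compact_imp_bounded[OF compact_continuous_image[OF assms(2,1)]]
    unfolding bounded_pos by auto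
  then show ?thesis using that[of C] by auto
qed

lemma continuous_on_gradient:
  fixes D :: "'a::topological_space \<Rightarrow> 'e::euclidean_space"
  assumes "\<And>i. i \<in> Basis \<Longrightarrow> continuous_on S (\<lambda>z. D z \<bullet> i)"
  shows "continuous_on S D"
proof -
  have "continuous_on S (\<lambda>z. \<Sum>i\<in>Basis. (D z \<bullet> i) *\<^sub>R i)" by (intro continuous_intros assms)
  then show ?thesis by (simp add: euclidean_representation)
qed

text \<open>Mean value inequality on the convex set \<open>B\<close>: the gradient in the position
  is bounded on the compact product, which makes the constant uniform in time.\<close>

lemma C1_lipschitz:
  fixes f :: "real \<times> 'e::euclidean_space \<Rightarrow> real"
  assumes f: "Ck_on 1 f \<Omega>" and sub: "J \<times> B \<subseteq> \<Omega>" and "compact J" "compact B" "convex B"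
  obtains C where "C \<ge> 0"
    "\<And>t x y. \<lbrakk>t \<in> J; x \<in> B; y \<in> B\<rbrakk> \<Longrightarrow> \<bar>f (t, y) - f (t, x)\<bar> \<le> C * norm (y - x)"
proof -
  obtain D where D0: "(\<forall>t x. (t, x) \<in> \<Omega> \<longrightarrow> ((\<lambda>x. f (t, x)) has_derivative (\<lambda>h. D (t, x) \<bullet> h)) (at x)) \<and>
    (\<forall>i\<in>Basis. Ck_on 0 (\<lambda>z. D z \<bullet> i) \<Omega>)"
    using Ck_on_partial_gradient[OF f[unfolded One_nat_def]] ..
  have D: "(t, x) \<in> \<Omega> \<Longrightarrow> ((\<lambda>x. f (t, x)) has_derivative (\<lambda>h. D (t, x) \<bullet> h)) (at x)"
    "i \<in> Basis \<Longrightarrow> Ck_on 0 (\<lambda>z. D z \<bullet> i) \<Omega>" for t x i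
    using D0 by (simp_all del: Ck_on.simps One_nat_def)
  have "continuous_on (J \<times> B) D"
    by (rule continuous_on_gradient, rule continuous_on_subset[OF _ sub]) (use D(2) in simp)
  then obtain C where C: "C \<ge> 0" "\<And>z. z \<in> J \<times> B \<Longrightarrow> norm (D z) \<le> C"
    using compact_bound[OF compact_Times[OF assms(3,4)]] by blast
  show ?thesis
  proof (rule that[OF C(1)])
    fix t x y assume t: "t \<in> J" and xy: "x \<in> B" "y \<in> B"
    have "norm (f (t, y) - f (t, x)) \<le> C * norm (y - x)"
    proof (rule differentiable_bound[OF \<open>convex B\<close> _ _ xy(2,1)])
      fix z assume z: "z \<in> B"
      show "((\<lambda>x. f (t, x)) has_derivative (\<lambda>h. D (t, z) \<bullet> h)) (at z within B)"
        by (rule has_derivative_at_withinI, rule D(1)) (use sub t z in auto)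
      show "onorm (\<lambda>h. D (t, z) \<bullet> h) \<le> C"
      proof (rule onorm_bound[OF C(1)])
        fix h
        have "norm (D (t, z) \<bullet> h) \<le> norm (D (t, z)) * norm h"
          using Cauchy_Schwarz_ineq2[of "D (t, z)" h] by simp
        also have "\<dots> \<le> C * norm h" using C(2)[of "(t, z)"] t z by (intro mult_right_mono) auto
        finally show "norm (D (t, z) \<bullet> h) \<le> C * norm h" .
      qed
    qed
    then show "\<bar>f (t, y) - f (t, x)\<bar> \<le> C * norm (y - x)" by simp
  qed
qed

text \<open>Second derivatives are never named: class C^2 enters by applying
  \<open>C1_lipschitz\<close> to the components of the gradient, and a Lipschitz gradient gives a
  quadratic Taylor remainder.\<close>

lemma C2_partial_bounds:
  fixes f :: "real \<times> 'e::euclidean_space \<Rightarrow> real"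
  assumes f: "Ck_on 2 f \<Omega>" and sub: "J \<times> B \<subseteq> \<Omega>" and cpt: "compact J" "compact B" "convex B"
  obtains D C where "C \<ge> 0" "continuous_on (J \<times> B) f" "continuous_on (J \<times> B) D"
    "\<And>t x. \<lbrakk>t \<in> J; x \<in> B\<rbrakk> \<Longrightarrow> \<bar>f (t, x)\<bar> \<le> C"
    "\<And>t x. \<lbrakk>t \<in> J; x \<in> B\<rbrakk> \<Longrightarrow> norm (D (t, x)) \<le> C"
    "\<And>t x y. \<lbrakk>t \<in> J; x \<in> B; y \<in> B\<rbrakk> \<Longrightarrow> \<bar>f (t, y) - f (t, x)\<bar> \<le> C * norm (y - x)"
    "\<And>t x y. \<lbrakk>t \<in> J; x \<in> B; y \<in> B\<rbrakk> \<Longrightarrow>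
       \<bar>f (t, y) - f (t, x) - D (t, x) \<bullet> (y - x)\<bar> \<le> C * (norm (y - x))\<^sup>2"
proof -
  have f2: "Ck_on (Suc 1) f \<Omega>" using f by (simp only: numeral_2_eq_2 One_nat_def)
  obtain D where D0: "(\<forall>t x. (t, x) \<in> \<Omega> \<longrightarrow> ((\<lambda>x. f (t, x)) has_derivative (\<lambda>h. D (t, x) \<bullet> h)) (at x)) \<and>
    (\<forall>i\<in>Basis. Ck_on 1 (\<lambda>z. D z \<bullet> i) \<Omega>)"
    using Ck_on_partial_gradient[OF f2] ..
  have D: "(t, x) \<in> \<Omega> \<Longrightarrow> ((\<lambda>x. f (t, x)) has_derivative (\<lambda>h. D (t, x) \<bullet> h)) (at x)"
    "i \<in> Basis \<Longrightarrow> Ck_on 1 (\<lambda>z. D z \<bullet> i) \<Omega>" for t x i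
    using D0 by (simp_all del: Ck_on.simps One_nat_def)
  have Dc: "continuous_on (J \<times> B) D"
    by (rule continuous_on_gradient, rule continuous_on_subset[OF Ck_on_imp_continuous_on[OF D(2)] sub])
  have fc: "continuous_on (J \<times> B) f"
    by (rule continuous_on_subset[OF Ck_on_imp_continuous_on[OF f] sub])
  obtain C1 where C1: "C1 \<ge> 0" "\<And>z. z \<in> J \<times> B \<Longrightarrow> norm (f z) \<le> C1"
    using compact_bound[OF compact_Times[OF cpt(1,2)] fc] by blast
  obtain C2 where C2: "C2 \<ge> 0" "\<And>z. z \<in> J \<times> B \<Longrightarrow> norm (D z) \<le> C2"
    using compact_bound[OF compact_Times[OF cpt(1,2)] Dc] by blast
  obtain C3 where C3: "C3 \<ge> 0"
    "\<And>t x y. \<lbrakk>t \<in> J; x \<in> B; y \<in> B\<rbrakk> \<Longrightarrow> \<bar>f (t, y) - f (t, x)\<bar> \<le> C3 * norm (y - x)"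
    using C1_lipschitz[OF Ck_on_le[OF f] sub cpt] by auto
  have "\<forall>i\<in>Basis. \<exists>C\<ge>0. \<forall>t\<in>J. \<forall>x\<in>B. \<forall>y\<in>B. \<bar>D (t, y) \<bullet> i - D (t, x) \<bullet> i\<bar> \<le> C * norm (y - x)"
  proof
    fix i :: 'e assume "i \<in> Basis"
    show "\<exists>C\<ge>0. \<forall>t\<in>J. \<forall>x\<in>B. \<forall>y\<in>B. \<bar>D (t, y) \<bullet> i - D (t, x) \<bullet> i\<bar> \<le> C * norm (y - x)"
      by (rule C1_lipschitz[OF D(2)[OF \<open>i \<in> Basis\<close>] sub cpt]) auto
  qed
  then obtain Ci where Ci: "\<And>i. i \<in> Basis \<Longrightarrow> Ci i \<ge> 0"
    "\<And>i t x y. \<lbrakk>i \<in> Basis; t \<in> J; x \<in> B; y \<in> B\<rbrakk> \<Longrightarrow> \<bar>D (t, y) \<bullet> i - D (t, x) \<bullet> i\<bar> \<le> Ci i * norm (y - x)"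
    by metis
  define C4 where "C4 = (\<Sum>i\<in>Basis. Ci i)"
  have "C4 \<ge> 0" unfolding C4_def using Ci by (intro sum_nonneg) auto
  have C4: "norm (D (t, y) - D (t, x)) \<le> C4 * norm (y - x)" if "t \<in> J" "x \<in> B" "y \<in> B" for t x y
  proof -
    have "norm (D (t, y) - D (t, x)) \<le> (\<Sum>i\<in>Basis. \<bar>(D (t, y) - D (t, x)) \<bullet> i\<bar>)" by (rule norm_le_l1)
    also have "\<dots> \<le> (\<Sum>i\<in>Basis. Ci i * norm (y - x))"
      by (intro sum_mono) (simp add: inner_diff_left Ci that)
    finally show ?thesis by (simp add: C4_def sum_distrib_right)
  qed
  have taylor: "\<bar>f (t, y) - f (t, x) - D (t, x) \<bullet> (y - x)\<bar> \<le> C4 * (norm (y - x))\<^sup>2"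
    if t: "t \<in> J" and xy: "x \<in> B" "y \<in> B" for t x y
  proof -
    define S where "S = closed_segment x y"
    have SB: "S \<subseteq> B" unfolding S_def using xy \<open>convex B\<close> by (rule closed_segment_subset)
    \<comment> \<open>Mean value inequality for \<open>f\<close> minus its linear part at
      \<open>x\<close>: along the segment the gradient of this difference is at most
      \<open>C4\<close> times the length of the segment.\<close>
    have "norm ((f (t, y) - D (t, x) \<bullet> y) - (f (t, x) - D (t, x) \<bullet> x)) \<le> C4 * norm (y - x) * norm (y - x)"
    proof (rule differentiable_bound[of S "\<lambda>y. f (t, y) - D (t, x) \<bullet> y"])
      fix z assume z: "z \<in> S"
      have zB: "z \<in> B" using z SB by auto
      show "((\<lambda>y. f (t, y) - D (t, x) \<bullet> y) has_derivative (\<lambda>h. D (t, z) \<bullet> h - D (t, x) \<bullet> h)) (at z within S)"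
        by (rule has_derivative_at_withinI) (use sub t zB in \<open>auto intro!: derivative_eq_intros D(1)\<close>)
      show "onorm (\<lambda>h. D (t, z) \<bullet> h - D (t, x) \<bullet> h) \<le> C4 * norm (y - x)"
      proof (rule onorm_bound)
        fix h
        have "norm (D (t, z) \<bullet> h - D (t, x) \<bullet> h) \<le> norm (D (t, z) - D (t, x)) * norm h"
          using Cauchy_Schwarz_ineq2[of "D (t, z) - D (t, x)" h] by (simp add: inner_diff_left)
        also have "\<dots> \<le> (C4 * norm (z - x)) * norm h" by (intro mult_right_mono C4 t xy zB) auto
        also have "\<dots> \<le> C4 * norm (y - x) * norm h"
          using segment_bound(1)[of z x y] z \<open>C4 \<ge> 0\<close>
          by (intro mult_right_mono mult_left_mono) (auto simp: S_def norm_minus_commute)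
        finally show "norm (D (t, z) \<bullet> h - D (t, x) \<bullet> h) \<le> C4 * norm (y - x) * norm h" .
      qed (use \<open>C4 \<ge> 0\<close> in auto)
    qed (auto simp: S_def)
    then show ?thesis by (simp add: power2_eq_square inner_diff_right mult.assoc algebra_simps)
  qed
  define C where "C = C1 + C2 + C3 + C4"
  have le: "C1 \<le> C" "C2 \<le> C" "C3 \<le> C" "C4 \<le> C"
    using C1(1) C2(1) C3(1) \<open>C4 \<ge> 0\<close> by (auto simp: C_def)
  show ?thesis
  proof (rule that[OF _ fc Dc])
    show "C \<ge> 0" using le(1) C1(1) by linarith
    show "\<bar>f (t, x)\<bar> \<le> C" "norm (D (t, x)) \<le> C" if "t \<in> J" "x \<in> B" for t x
      using C1(2)[of "(t, x)"] C2(2)[of "(t, x)"] that le by auto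
    show "\<bar>f (t, y) - f (t, x)\<bar> \<le> C * norm (y - x)" if "t \<in> J" "x \<in> B" "y \<in> B" for t x y
      using C3(2)[OF that] le(3) by (meson mult_right_mono norm_ge_zero order_trans)
    show "\<bar>f (t, y) - f (t, x) - D (t, x) \<bullet> (y - x)\<bar> \<le> C * (norm (y - x))\<^sup>2"
      if "t \<in> J" "x \<in> B" "y \<in> B" for t x y
      using taylor[OF that] le(4) by (meson mult_right_mono zero_le_power2 order_trans)
  qed
qed

text \<open>The last hypothesis on \<open>m\<close> holds for monomials of degree at most 2 with unit coefficients.\<close>

lemma tame_monomial:
  fixes f :: "real \<times> 'e::euclidean_space \<Rightarrow> real" and m :: "'e \<Rightarrow> real"
  assumes f: "Ck_on 2 f \<Omega>" "J \<times> B \<subseteq> \<Omega>" "compact J" "compact B" "convex B"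
    and mc: "continuous_on UNIV m" "continuous_on UNIV m'"
    and m: "\<And>v. \<bar>m v\<bar> \<le> (1 + norm v)\<^sup>2" "\<And>v. norm (m' v) \<le> 2 * (1 + norm v)"
      "\<And>v w. \<bar>m w - m v - m' v \<bullet> (w - v)\<bar> \<le> (norm (w - v))\<^sup>2"
  shows "\<exists>Lx Lv. tame J B (\<lambda>t x v. f (t, x) * m v) Lx Lv"
proof -
  obtain D C where C: "C \<ge> 0" "continuous_on (J \<times> B) f" "continuous_on (J \<times> B) D"
    "\<And>t x. \<lbrakk>t \<in> J; x \<in> B\<rbrakk> \<Longrightarrow> \<bar>f (t, x)\<bar> \<le> C"
    "\<And>t x. \<lbrakk>t \<in> J; x \<in> B\<rbrakk> \<Longrightarrow> norm (D (t, x)) \<le> C"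
    "\<And>t x y. \<lbrakk>t \<in> J; x \<in> B; y \<in> B\<rbrakk> \<Longrightarrow> \<bar>f (t, y) - f (t, x)\<bar> \<le> C * norm (y - x)"
    "\<And>t x y. \<lbrakk>t \<in> J; x \<in> B; y \<in> B\<rbrakk> \<Longrightarrow>
       \<bar>f (t, y) - f (t, x) - D (t, x) \<bullet> (y - x)\<bar> \<le> C * (norm (y - x))\<^sup>2"
    by (rule C2_partial_bounds[OF f]) (rule that, assumption+)
  define Lx where "Lx t x v = m v *\<^sub>R D (t, x)" for t x v
  define Lv where "Lv t x v = f (t, x) *\<^sub>R m' v" for t x v
  have fcz: "continuous_on (J \<times> B \<times> UNIV) (\<lambda>z. f (fst z, fst (snd z)))"
    by (rule continuous_on_compose2[OF C(2)]) (auto intro!: continuous_intros)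
  have Dcz: "continuous_on (J \<times> B \<times> UNIV) (\<lambda>z. D (fst z, fst (snd z)))"
    by (rule continuous_on_compose2[OF C(3)]) (auto intro!: continuous_intros)
  have mcz: "continuous_on (J \<times> B \<times> UNIV) (\<lambda>z. m (snd (snd z)))"
    "continuous_on (J \<times> B \<times> UNIV) (\<lambda>z. m' (snd (snd z)))"
    by (rule continuous_on_compose2[OF mc(1)] continuous_on_compose2[OF mc(2)];
        auto intro!: continuous_intros)+
  have "tame J B (\<lambda>t x v. f (t, x) * m v) Lx Lv"
    unfolding tame_def case_prod_unfold
  proof (intro conjI exI[of _ "4 * C"] ballI allI)
    show "continuous_on (J \<times> B \<times> UNIV) (\<lambda>z. f (fst z, fst (snd z)) * m (snd (snd z)))"
      by (intro continuous_intros fcz mcz)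
    show "continuous_on (J \<times> B \<times> UNIV) (\<lambda>z. Lx (fst z) (fst (snd z)) (snd (snd z)))"
      unfolding Lx_def by (intro continuous_intros Dcz mcz)
    show "continuous_on (J \<times> B \<times> UNIV) (\<lambda>z. Lv (fst z) (fst (snd z)) (snd (snd z)))"
      unfolding Lv_def by (intro continuous_intros fcz mcz)
    show "0 \<le> 4 * C" using C(1) by simp
  next
    fix t x and v :: 'e assume t: "t \<in> J" and x: "x \<in> B"
    have "norm (Lx t x v) \<le> (1 + norm v)\<^sup>2 * C"
      unfolding Lx_def norm_scaleR using m(1)[of v] C(1) C(5)[OF t x] by (intro mult_mono) auto
    also have "\<dots> \<le> 4 * C * (1 + norm v)\<^sup>2" using C(1) by (simp add: mult.commute mult_right_mono)
    finally show "norm (Lx t x v) \<le> 4 * C * (1 + norm v)\<^sup>2" .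
    have "norm (Lv t x v) \<le> C * (2 * (1 + norm v))"
      unfolding Lv_def norm_scaleR using m(2)[of v] C(1) C(4)[OF t x] by (intro mult_mono) auto
    also have "\<dots> \<le> C * (4 * (1 + norm v))" using C(1) by (intro mult_left_mono) auto
    finally show "norm (Lv t x v) \<le> 4 * C * (1 + norm v)" by (simp add: algebra_simps)
    fix y assume y: "y \<in> B"
    have "norm (Lv t y v - Lv t x v) = \<bar>f (t, y) - f (t, x)\<bar> * norm (m' v)"
      by (simp add: Lv_def scaleR_diff_left[symmetric])
    also have "\<dots> \<le> (C * norm (y - x)) * (2 * (1 + norm v))"
      using C(1) by (intro mult_mono C(6) m(2) t x y) auto
    also have "\<dots> \<le> (C * norm (y - x)) * (4 * (1 + norm v))" using C(1) by (intro mult_left_mono) auto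
    finally show "norm (Lv t y v - Lv t x v) \<le> 4 * C * (1 + norm v) * norm (y - x)"
      by (simp add: algebra_simps)
    fix w
    define h where "h = norm (y - x)"
    define \<delta> where "\<delta> = norm (w - v)"
    define N where "N = 1 + norm v"
    define r where "r = f (t, y) - f (t, x) - D (t, x) \<bullet> (y - x)"
    define q where "q = m w - m v - m' v \<bullet> (w - v)"
    have N: "N \<ge> 0" and h: "h \<ge> 0" and \<delta>: "\<delta> \<ge> 0" by (auto simp: N_def h_def \<delta>_def)
    \<comment> \<open>Product rule with remainder: the remainder of \<open>f\<close> times
      \<open>m v\<close>, the remainder of \<open>m\<close> times \<open>f (t, y)\<close>, and a
      mixed term. The mixed term is controlled by the product of the two increments and is split by
      2ab \<le> a^2 + b^2, with the factor \<open>N\<close> kept on the side of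
      \<open>h\<close>.\<close>
    have "f (t, y) * m w - f (t, x) * m v - Lx t x v \<bullet> (y - x) - Lv t x v \<bullet> (w - v)
        = r * m v + f (t, y) * q + (f (t, y) - f (t, x)) * (m' v \<bullet> (w - v))"
      by (simp add: Lx_def Lv_def r_def q_def algebra_simps)
    also have "\<bar>\<dots>\<bar> \<le> \<bar>r * m v\<bar> + \<bar>f (t, y) * q\<bar> + \<bar>(f (t, y) - f (t, x)) * (m' v \<bullet> (w - v))\<bar>"
      by linarith
    also have "\<bar>r * m v\<bar> \<le> (C * h\<^sup>2) * N\<^sup>2"
      unfolding abs_mult r_def h_def N_def using C(1) by (intro mult_mono C(7) m(1) t x y) auto
    also have "\<bar>f (t, y) * q\<bar> \<le> C * \<delta>\<^sup>2"
      unfolding abs_mult q_def \<delta>_def using C(1) by (intro mult_mono C(4) m(3) t y) auto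
    also have "\<bar>(f (t, y) - f (t, x)) * (m' v \<bullet> (w - v))\<bar> \<le> C * ((N * h)\<^sup>2 + \<delta>\<^sup>2)"
    proof -
      have "\<bar>m' v \<bullet> (w - v)\<bar> \<le> norm (m' v) * \<delta>" unfolding \<delta>_def by (rule Cauchy_Schwarz_ineq2)
      also have "\<dots> \<le> 2 * N * \<delta>" unfolding N_def using m(2)[of v] \<delta> by (intro mult_right_mono) auto
      finally have "\<bar>m' v \<bullet> (w - v)\<bar> \<le> 2 * N * \<delta>" .
      then have "\<bar>(f (t, y) - f (t, x)) * (m' v \<bullet> (w - v))\<bar> \<le> (C * h) * (2 * N * \<delta>)"
        unfolding abs_mult h_def using C(1) by (intro mult_mono C(6) t x y) auto
      also have "\<dots> = C * (2 * (N * h) * \<delta>)" by simp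
      also have "\<dots> \<le> C * ((N * h)\<^sup>2 + \<delta>\<^sup>2)"
        using C(1) by (intro mult_left_mono sum_squares_bound)
      finally show ?thesis .
    qed
    finally have "\<bar>f (t, y) * m w - f (t, x) * m v - Lx t x v \<bullet> (y - x) - Lv t x v \<bullet> (w - v)\<bar>
        \<le> 2 * C * (N\<^sup>2 * h\<^sup>2 + \<delta>\<^sup>2)"
      by (simp add: power_mult_distrib algebra_simps)
    also have "\<dots> \<le> 4 * C * (N\<^sup>2 * h\<^sup>2 + \<delta>\<^sup>2)" using C(1) by (intro mult_right_mono) auto
    finally show "\<bar>f (t, y) * m w - f (t, x) * m v - Lx t x v \<bullet> (y - x) - Lv t x v \<bullet> (w - v)\<bar>
        \<le> 4 * C * ((1 + norm v)\<^sup>2 * (norm (y - x))\<^sup>2 + (norm (w - v))\<^sup>2)"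
      by (simp only: N_def h_def \<delta>_def)
  qed
  then show ?thesis by blast
qed

section \<open>Sums of tame functions and quadratic Lagrangians\<close>

lemma tame_add:
  assumes "tame J B L1 Lx1 Lv1" "tame J B L2 Lx2 Lv2"
  shows "tame J B (\<lambda>t x v. L1 t x v + L2 t x v) (\<lambda>t x v. Lx1 t x v + Lx2 t x v) (\<lambda>t x v. Lv1 t x v + Lv2 t x v)"
proof -
  obtain C1 where C1: "C1 \<ge> 0"
    "\<And>t x v. \<lbrakk>t \<in> J; x \<in> B\<rbrakk> \<Longrightarrow> norm (Lx1 t x v) \<le> C1 * (1 + norm v)\<^sup>2"
    "\<And>t x v. \<lbrakk>t \<in> J; x \<in> B\<rbrakk> \<Longrightarrow> norm (Lv1 t x v) \<le> C1 * (1 + norm v)"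
    "\<And>t x y v. \<lbrakk>t \<in> J; x \<in> B; y \<in> B\<rbrakk> \<Longrightarrow> norm (Lv1 t y v - Lv1 t x v) \<le> C1 * (1 + norm v) * norm (y - x)"
    "\<And>t x y v w. \<lbrakk>t \<in> J; x \<in> B; y \<in> B\<rbrakk> \<Longrightarrow>
       \<bar>L1 t y w - L1 t x v - Lx1 t x v \<bullet> (y - x) - Lv1 t x v \<bullet> (w - v)\<bar>
                \<le> C1 * ((1 + norm v)\<^sup>2 * (norm (y - x))\<^sup>2 + (norm (w - v))\<^sup>2)"
    by (rule tameD[OF assms(1)]) blast
  obtain C2 where C2: "C2 \<ge> 0"
    "\<And>t x v. \<lbrakk>t \<in> J; x \<in> B\<rbrakk> \<Longrightarrow> norm (Lx2 t x v) \<le> C2 * (1 + norm v)\<^sup>2"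
    "\<And>t x v. \<lbrakk>t \<in> J; x \<in> B\<rbrakk> \<Longrightarrow> norm (Lv2 t x v) \<le> C2 * (1 + norm v)"
    "\<And>t x y v. \<lbrakk>t \<in> J; x \<in> B; y \<in> B\<rbrakk> \<Longrightarrow> norm (Lv2 t y v - Lv2 t x v) \<le> C2 * (1 + norm v) * norm (y - x)"
    "\<And>t x y v w. \<lbrakk>t \<in> J; x \<in> B; y \<in> B\<rbrakk> \<Longrightarrow>
       \<bar>L2 t y w - L2 t x v - Lx2 t x v \<bullet> (y - x) - Lv2 t x v \<bullet> (w - v)\<bar>
                \<le> C2 * ((1 + norm v)\<^sup>2 * (norm (y - x))\<^sup>2 + (norm (w - v))\<^sup>2)"
    by (rule tameD[OF assms(2)]) blast
  show ?thesis
    unfolding tame_def case_prod_unfold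
  proof (intro conjI exI[of _ "C1 + C2"] ballI allI)
    show "continuous_on (J \<times> B \<times> UNIV) (\<lambda>p. L1 (fst p) (fst (snd p)) (snd (snd p)) + L2 (fst p) (fst (snd p)) (snd (snd p)))"
      "continuous_on (J \<times> B \<times> UNIV) (\<lambda>p. Lx1 (fst p) (fst (snd p)) (snd (snd p)) + Lx2 (fst p) (fst (snd p)) (snd (snd p)))"
      "continuous_on (J \<times> B \<times> UNIV) (\<lambda>p. Lv1 (fst p) (fst (snd p)) (snd (snd p)) + Lv2 (fst p) (fst (snd p)) (snd (snd p)))"
      using assms unfolding tame_def case_prod_unfold by (auto intro!: continuous_intros)
    show "0 \<le> C1 + C2" using C1(1) C2(1) by simp
  next
    fix t x and v :: 'a assume t: "t \<in> J" and x: "x \<in> B"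
    show "norm (Lx1 t x v + Lx2 t x v) \<le> (C1 + C2) * (1 + norm v)\<^sup>2"
      using norm_triangle_mono[OF C1(2) C2(2), OF t x t x, of v v] by (simp only: distrib_right)
    show "norm (Lv1 t x v + Lv2 t x v) \<le> (C1 + C2) * (1 + norm v)"
      using norm_triangle_mono[OF C1(3) C2(3), OF t x t x, of v v] by (simp only: distrib_right)
    fix y assume y: "y \<in> B"
    show "norm (Lv1 t y v + Lv2 t y v - (Lv1 t x v + Lv2 t x v)) \<le> (C1 + C2) * (1 + norm v) * norm (y - x)"
      using norm_triangle_mono[OF C1(4) C2(4), OF t x y t x y, of v v]
      by (simp only: distrib_right add_diff_add)
    fix w
    show "\<bar>L1 t y w + L2 t y w - (L1 t x v + L2 t x v) - (Lx1 t x v + Lx2 t x v) \<bullet> (y - x) -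
          (Lv1 t x v + Lv2 t x v) \<bullet> (w - v)\<bar>
         \<le> (C1 + C2) * ((1 + norm v)\<^sup>2 * (norm (y - x))\<^sup>2 + (norm (w - v))\<^sup>2)"
      using C1(5)[OF t x y, of w v] C2(5)[OF t x y, of w v]
      unfolding inner_add_left distrib_right[of C1 C2] by linarith
  qed
qed

lemma tame_sum:
  assumes "finite I" "\<And>i. i \<in> I \<Longrightarrow> \<exists>Lx Lv. tame J B (L i) Lx Lv"
  shows "\<exists>Lx Lv. tame J B (\<lambda>t x v. \<Sum>i\<in>I. L i t x v) Lx Lv"
  using assms
proof (induction I)
  case empty
  have "tame J B (\<lambda>t x v. 0) (\<lambda>t x v. 0) (\<lambda>t x v. 0)"
    unfolding tame_def by (auto intro!: continuous_intros exI[of _ 0])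
  then show ?case by auto
next
  case (insert i I)
  then obtain Lx1 Lv1 Lx2 Lv2 where "tame J B (L i) Lx1 Lv1" "tame J B (\<lambda>t x v. \<Sum>i\<in>I. L i t x v) Lx2 Lv2"
    by (metis insertCI)
  from tame_add[OF this] show ?case using insert.hyps by auto
qed

lemma tame_cong:
  assumes "tame J B L Lx Lv" "\<And>t x v. \<lbrakk>t \<in> J; x \<in> B\<rbrakk> \<Longrightarrow> L t x v = L' t x v"
  shows "tame J B L' Lx Lv"
proof -
  have "continuous_on (J \<times> B \<times> UNIV) (\<lambda>(t, x, v). L t x v) = continuous_on (J \<times> B \<times> UNIV) (\<lambda>(t, x, v). L' t x v)"
    using assms(2) by (intro continuous_on_cong) auto
  then show ?thesis using assms unfolding tame_def by simp
qed

text \<open>The gradients of the assembled Lagrangian come out of existence statements, without a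
  formula; this recovers \<open>Lv\<close>. Tameness at \<open>y = x\<close> and the expansion along
  \<open>z\<close> agree up to order \<open>s\<^sup>2\<close>, so their linear coefficients
  coincide: for the chosen \<open>s\<close> a discrepancy \<open>e\<close> would satisfy
  \<open>e \<le> s * Y\<close> and \<open>s * Y < e\<close>.\<close>

lemma tame_gradient:
  assumes "tame J B L Lx Lv" "t \<in> J" "x \<in> B"
    and exp: "\<And>s. L t x (v + s *\<^sub>R z) = L t x v + s * p + s\<^sup>2 * k"
  shows "Lv t x v \<bullet> z = p"
proof (rule ccontr)
  assume ne: "Lv t x v \<bullet> z \<noteq> p"
  obtain C where C: "C \<ge> 0"
    "\<And>t x y v w. \<lbrakk>t \<in> J; x \<in> B; y \<in> B\<rbrakk> \<Longrightarrow>
       \<bar>L t y w - L t x v - Lx t x v \<bullet> (y - x) - Lv t x v \<bullet> (w - v)\<bar>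
                \<le> C * ((1 + norm v)\<^sup>2 * (norm (y - x))\<^sup>2 + (norm (w - v))\<^sup>2)"
    by (rule tameD[OF assms(1)]) blast
  define e where "e = \<bar>p - Lv t x v \<bullet> z\<bar>"
  define Y where "Y = C * (norm z)\<^sup>2 + \<bar>k\<bar>"
  have e: "e > 0" and Y: "Y \<ge> 0" using ne C(1) by (auto simp: e_def Y_def)
  define s where "s = e / (2 * (Y + 1))"
  have s: "s > 0" using e Y by (simp add: s_def)
  have "\<bar>s * (p - Lv t x v \<bullet> z) + s\<^sup>2 * k\<bar> \<le> C * (s\<^sup>2 * (norm z)\<^sup>2)"
    using C(2)[OF assms(2,3,3), of "v + s *\<^sub>R z" v] by (simp add: exp algebra_simps power_mult_distrib)
  moreover have "\<bar>s * (p - Lv t x v \<bullet> z)\<bar> = s * e" using s by (simp add: e_def abs_mult)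
  moreover have "\<bar>s\<^sup>2 * k\<bar> = s\<^sup>2 * \<bar>k\<bar>" by (simp add: abs_mult)
  ultimately have "s * e \<le> C * (s\<^sup>2 * (norm z)\<^sup>2) + s\<^sup>2 * \<bar>k\<bar>" by linarith
  also have "\<dots> = s * (s * Y)" by (simp add: Y_def power2_eq_square algebra_simps)
  finally have "e \<le> s * Y" using s by simp
  also have "s * Y < e"
  proof -
    have "0 < e * (Y + 2)" using e Y by (intro mult_pos_pos) auto
    then show ?thesis using Y by (simp add: s_def field_simps)
  qed
  finally show False by simp
qed

text \<open>Tameness comes from expanding the metric and the 1-form in a basis, where each term is a
  C^2 coefficient times a monomial in the velocity. Strong monotonicity and growth come from the
  minimum \<open>\<kappa>\<close> of the metric over unit vectors at points of the compact set, and
  the surjectivity of \<open>Lv\<close> from the nondegeneracy of the metric in finite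
  dimension.\<close>

lemma quadratic_lagrangian:
  fixes g :: "real \<Rightarrow> 'e::euclidean_space \<Rightarrow> 'e \<Rightarrow> 'e \<Rightarrow> real" and \<beta> :: "real \<Rightarrow> 'e \<Rightarrow> 'e \<Rightarrow> real"
    and V :: "real \<Rightarrow> 'e \<Rightarrow> real"
  defines "L \<equiv> \<lambda>t x v. 1/2 * g t x v v + \<beta> t x v - V t x"
  assumes cpt: "compact J" "compact B" "convex B" and sub: "J \<times> B \<subseteq> \<Omega>"
    and bil: "\<And>t x. \<lbrakk>t \<in> J; x \<in> B\<rbrakk> \<Longrightarrow> bilinear (g t x)"
    and symm: "\<And>t x v w. \<lbrakk>t \<in> J; x \<in> B\<rbrakk> \<Longrightarrow> g t x v w = g t x w v"
    and pos: "\<And>t x v. \<lbrakk>t \<in> J; x \<in> B; v \<noteq> 0\<rbrakk> \<Longrightarrow> g t x v v > 0"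
    and lin: "\<And>t x. \<lbrakk>t \<in> J; x \<in> B\<rbrakk> \<Longrightarrow> linear (\<beta> t x)"
    and g: "\<And>v w. Ck_on 2 (\<lambda>(t, x). g t x v w) \<Omega>"
    and \<beta>: "\<And>v. Ck_on 2 (\<lambda>(t, x). \<beta> t x v) \<Omega>"
    and V: "Ck_on 2 (\<lambda>(t, x). V t x) \<Omega>"
  obtains Lx Lv \<kappa> c C where "variational J B L Lx Lv \<kappa>" "c > 0"
    "\<And>t x v. \<lbrakk>t \<in> J; x \<in> B\<rbrakk> \<Longrightarrow> c * (1 + norm v)\<^sup>2 - C \<le> L t x v"
proof -
  have g_rep: "g t x v w = (\<Sum>i\<in>Basis. \<Sum>j\<in>Basis. g t x i j * ((v \<bullet> i) * (w \<bullet> j)))"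
    if "t \<in> J" "x \<in> B" for t x v w
  proof -
    note b = bil[OF that]
    have "g t x v w = g t x (\<Sum>i\<in>Basis. (v \<bullet> i) *\<^sub>R i) (\<Sum>j\<in>Basis. (w \<bullet> j) *\<^sub>R j)"
      by (simp add: euclidean_representation)
    also have "\<dots> = (\<Sum>(i, j)\<in>Basis \<times> Basis. g t x ((v \<bullet> i) *\<^sub>R i) ((w \<bullet> j) *\<^sub>R j))"
      by (rule bilinear_sum[OF b])
    also have "\<dots> = (\<Sum>i\<in>Basis. \<Sum>j\<in>Basis. g t x ((v \<bullet> i) *\<^sub>R i) ((w \<bullet> j) *\<^sub>R j))"
      by (simp add: sum.cartesian_product)
    also have "\<dots> = (\<Sum>i\<in>Basis. \<Sum>j\<in>Basis. g t x i j * ((v \<bullet> i) * (w \<bullet> j)))"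
      by (simp add: bilinear_lmul[OF b] bilinear_rmul[OF b] mult.assoc mult.left_commute mult.commute)
    finally show ?thesis .
  qed
  have \<beta>_rep: "\<beta> t x v = (\<Sum>i\<in>Basis. \<beta> t x i * (v \<bullet> i))" if "t \<in> J" "x \<in> B" for t x v
  proof -
    have "\<beta> t x v = \<beta> t x (\<Sum>i\<in>Basis. (v \<bullet> i) *\<^sub>R i)" by (simp add: euclidean_representation)
    also have "\<dots> = (\<Sum>i\<in>Basis. \<beta> t x i * (v \<bullet> i))"
      using linear_sum[OF lin[OF that], of "\<lambda>i. (v \<bullet> i) *\<^sub>R i" Basis] linear_cmul[OF lin[OF that]]
      by (simp add: mult.commute)
    finally show ?thesis .
  qed
  have bas: "\<bar>v \<bullet> i\<bar> \<le> norm v" if "i \<in> Basis" for v i :: 'e using Basis_le_norm[OF that] .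
  have one: "1 \<le> (1 + norm v)\<^sup>2" "norm v \<le> (1 + norm v)\<^sup>2" "(norm v)\<^sup>2 \<le> (1 + norm v)\<^sup>2" for v :: 'e
    by (auto simp: power2_sum)
  have T2: "\<exists>Lx Lv. tame J B (\<lambda>t x v. g t x i j * (1/2 * ((v \<bullet> i) * (v \<bullet> j)))) Lx Lv"
    if i: "i \<in> Basis" and j: "j \<in> Basis" for i j
  proof -
    have "\<exists>Lx Lv. tame J B (\<lambda>t x v. (\<lambda>(t, x). g t x i j) (t, x) * (1/2 * ((v \<bullet> i) * (v \<bullet> j)))) Lx Lv"
    proof (rule tame_monomial[OF g sub cpt, of _ "\<lambda>v. (1/2) *\<^sub>R ((v \<bullet> j) *\<^sub>R i + (v \<bullet> i) *\<^sub>R j)"])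
      fix v w :: 'e
      have "\<bar>(v \<bullet> i) * (v \<bullet> j)\<bar> \<le> norm v * norm v"
        unfolding abs_mult by (intro mult_mono bas i j) auto
      moreover have "\<bar>1/2 * ((v \<bullet> i) * (v \<bullet> j))\<bar> = 1/2 * \<bar>(v \<bullet> i) * (v \<bullet> j)\<bar>"
        by (simp add: abs_mult)
      moreover have "0 \<le> norm v * norm v" by simp
      ultimately have "\<bar>1/2 * ((v \<bullet> i) * (v \<bullet> j))\<bar> \<le> (norm v)\<^sup>2"
        unfolding power2_eq_square by linarith
      then show "\<bar>1/2 * ((v \<bullet> i) * (v \<bullet> j))\<bar> \<le> (1 + norm v)\<^sup>2" using one(3)[of v] by linarith
      have "norm ((v \<bullet> j) *\<^sub>R i + (v \<bullet> i) *\<^sub>R j) \<le> norm v + norm v"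
        using bas[OF i, of v] bas[OF j, of v] i j by (intro norm_triangle_mono) (auto simp: norm_Basis)
      then show "norm ((1/2) *\<^sub>R ((v \<bullet> j) *\<^sub>R i + (v \<bullet> i) *\<^sub>R j)) \<le> 2 * (1 + norm v)"
        using norm_ge_zero[of v] unfolding norm_scaleR by (simp del: norm_ge_zero)
      have "1/2 * ((w \<bullet> i) * (w \<bullet> j)) - 1/2 * ((v \<bullet> i) * (v \<bullet> j))
          - (1/2) *\<^sub>R ((v \<bullet> j) *\<^sub>R i + (v \<bullet> i) *\<^sub>R j) \<bullet> (w - v) = 1/2 * (((w - v) \<bullet> i) * ((w - v) \<bullet> j))"
        unfolding inner_scaleR_left inner_add_left inner_diff_left inner_diff_right
          inner_commute[of i v] inner_commute[of i w] inner_commute[of j v] inner_commute[of j w]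
        by (simp add: field_simps)
      also have "\<bar>\<dots>\<bar> \<le> norm (w - v) * norm (w - v)"
      proof -
        have "\<bar>((w - v) \<bullet> i) * ((w - v) \<bullet> j)\<bar> \<le> norm (w - v) * norm (w - v)"
          unfolding abs_mult by (intro mult_mono bas i j) auto
        moreover have "\<bar>1/2 * (((w - v) \<bullet> i) * ((w - v) \<bullet> j))\<bar> = 1/2 * \<bar>((w - v) \<bullet> i) * ((w - v) \<bullet> j)\<bar>"
          by (simp add: abs_mult)
        moreover have "0 \<le> norm (w - v) * norm (w - v)" by simp
        ultimately show ?thesis by linarith
      qed
      finally show "\<bar>1/2 * ((w \<bullet> i) * (w \<bullet> j)) - 1/2 * ((v \<bullet> i) * (v \<bullet> j))
          - (1/2) *\<^sub>R ((v \<bullet> j) *\<^sub>R i + (v \<bullet> i) *\<^sub>R j) \<bullet> (w - v)\<bar> \<le> (norm (w - v))\<^sup>2"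
        by (simp add: power2_eq_square)
    qed (intro continuous_intros)+
    then show ?thesis by simp
  qed
  have T1: "\<exists>Lx Lv. tame J B (\<lambda>t x v. \<beta> t x i * (v \<bullet> i)) Lx Lv" if i: "i \<in> Basis" for i
  proof -
    have "\<exists>Lx Lv. tame J B (\<lambda>t x v. (\<lambda>(t, x). \<beta> t x i) (t, x) * (v \<bullet> i)) Lx Lv"
    proof (rule tame_monomial[OF \<beta> sub cpt, of _ "\<lambda>v. i"])
      fix v w :: 'e
      show "\<bar>v \<bullet> i\<bar> \<le> (1 + norm v)\<^sup>2" using bas[OF i, of v] one(2)[of v] by linarith
      show "norm i \<le> 2 * (1 + norm v)" using i by (simp add: norm_Basis)
      show "\<bar>w \<bullet> i - v \<bullet> i - i \<bullet> (w - v)\<bar> \<le> (norm (w - v))\<^sup>2"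
        by (simp add: inner_diff_right inner_commute)
    qed (intro continuous_intros)+
    then show ?thesis by simp
  qed
  have T0: "\<exists>Lx Lv. tame J B (\<lambda>t x v. V t x * (- 1)) Lx Lv"
  proof -
    have "\<exists>Lx Lv. tame J B (\<lambda>t x (v::'e). (\<lambda>(t, x). V t x) (t, x) * (- 1)) Lx Lv"
      by (rule tame_monomial[OF V sub cpt, of _ "\<lambda>v. 0"]) (use one in \<open>auto intro!: continuous_intros\<close>)
    then show ?thesis by simp
  qed
  have T2': "\<exists>Lx Lv. tame J B (\<lambda>t x v. \<Sum>i\<in>Basis. \<Sum>j\<in>Basis. g t x i j * (1/2 * ((v \<bullet> i) * (v \<bullet> j)))) Lx Lv"
    by (intro tame_sum finite_Basis T2)
  have T1': "\<exists>Lx Lv. tame J B (\<lambda>t x v. \<Sum>i\<in>Basis. \<beta> t x i * (v \<bullet> i)) Lx Lv"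
    by (intro tame_sum finite_Basis T1)
  obtain Lx Lv where tm0: "tame J B (\<lambda>t x v. (\<Sum>i\<in>Basis. \<Sum>j\<in>Basis. g t x i j * (1/2 * ((v \<bullet> i) * (v \<bullet> j))))
      + (\<Sum>i\<in>Basis. \<beta> t x i * (v \<bullet> i)) + V t x * (- 1)) Lx Lv"
    using T2' T1' T0 tame_add by blast
  have tm: "tame J B L Lx Lv"
  proof (rule tame_cong[OF tm0])
    fix t x v assume t: "t \<in> J" "x \<in> B"
    show "(\<Sum>i\<in>Basis. \<Sum>j\<in>Basis. g t x i j * (1/2 * ((v \<bullet> i) * (v \<bullet> j))))
      + (\<Sum>i\<in>Basis. \<beta> t x i * (v \<bullet> i)) + V t x * (- 1) = L t x v"
      by (simp add: L_def g_rep[OF t, of v v] \<beta>_rep[OF t, of v] sum_distrib_left algebra_simps)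
  qed
  \<comment> \<open>The coefficient of \<open>s\<close> in the expansion is read off through
    \<open>tame_gradient\<close>; the two mixed terms of the symmetric form cancel the factor
    1/2.\<close>
  have grad: "Lv t x v \<bullet> z = g t x v z + \<beta> t x z" if t: "t \<in> J" "x \<in> B" for t x v z
  proof (rule tame_gradient[OF tm t])
    fix s
    note b = bil[OF t]
    show "L t x (v + s *\<^sub>R z) = L t x v + s * (g t x v z + \<beta> t x z) + s\<^sup>2 * (1/2 * g t x z z)"
      using symm[OF t, of z v] linear_add[OF lin[OF t]] linear_cmul[OF lin[OF t]]
      by (simp add: L_def bilinear_ladd[OF b] bilinear_radd[OF b] bilinear_lmul[OF b] bilinear_rmul[OF b]
          power2_eq_square algebra_simps)
  qed
  obtain \<kappa> where \<kappa>: "\<kappa> > 0" "\<And>t x v. \<lbrakk>t \<in> J; x \<in> B\<rbrakk> \<Longrightarrow> \<kappa> * (norm v)\<^sup>2 \<le> g t x v v"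
  proof (cases "J \<times> B = {}")
    case True
    then show ?thesis using that[of 1] by auto
  next
    case False
    define S where "S = J \<times> B \<times> sphere (0::'e) 1"
    have "compact S" unfolding S_def by (intro compact_Times cpt compact_sphere)
    moreover obtain b0 :: 'e where "b0 \<in> Basis" using nonempty_Basis by blast
    then have "b0 \<in> sphere 0 1" by (simp add: norm_Basis)
    then have "S \<noteq> {}" using False by (auto simp: S_def)
    \<comment> \<open>The regularity hypothesis concerns fixed vector arguments; the expansion in
      the basis turns it into joint continuity.\<close>
    moreover have "continuous_on S (\<lambda>(t, x, v). g t x v v)"
    proof -
      have "continuous_on (J \<times> B) (\<lambda>(t, x). g t x i j)" for i j
        by (rule continuous_on_subset[OF Ck_on_imp_continuous_on[OF g] sub])
      then have *: "continuous_on S (\<lambda>z. (\<lambda>(t, x). g t x i j) (fst z, fst (snd z)))" for i j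
        by (rule continuous_on_compose2) (auto simp: S_def intro!: continuous_intros)
      have "continuous_on S (\<lambda>z. \<Sum>i\<in>Basis. \<Sum>j\<in>Basis. (\<lambda>(t, x). g t x i j) (fst z, fst (snd z)) *
          ((snd (snd z) \<bullet> i) * (snd (snd z) \<bullet> j)))"
        by (intro continuous_on_sum continuous_on_mult * continuous_intros)
      then show ?thesis
        by (rule continuous_on_eq) (auto simp: S_def g_rep)
    qed
    ultimately obtain z where z: "z \<in> S" "\<And>y. y \<in> S \<Longrightarrow> (\<lambda>(t, x, v). g t x v v) z \<le> (\<lambda>(t, x, v). g t x v v) y"
      using continuous_attains_inf by meson
    define \<kappa> where "\<kappa> = (\<lambda>(t, x, v). g t x v v) z"
    have "\<kappa> > 0" using z(1) by (auto simp: \<kappa>_def S_def intro!: pos)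
    moreover have "\<kappa> * (norm v)\<^sup>2 \<le> g t x v v" if t: "t \<in> J" "x \<in> B" for t x v
    proof (cases "v = 0")
      case True
      then show ?thesis using bilinear_lzero[OF bil[OF t]] by simp
    next
      case False
      define w where "w = (1 / norm v) *\<^sub>R v"
      have "norm w = 1" using False by (simp add: w_def)
      then have "\<kappa> \<le> g t x w w" using z(2)[of "(t, x, w)"] t by (simp add: \<kappa>_def S_def)
      also have "g t x w w = g t x v v / (norm v)\<^sup>2"
        unfolding w_def by (simp add: bilinear_lmul[OF bil[OF t]] bilinear_rmul[OF bil[OF t]] power2_eq_square)
      finally show ?thesis using False by (simp add: field_simps)
    qed
    ultimately show ?thesis using that by blast
  qed
  have var: "variational J B L Lx Lv \<kappa>"
  proof
    show "tame J B L Lx Lv" "compact B" "\<kappa> > 0" by (rule tm cpt(2) \<kappa>(1))+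
  next
    fix t x v w assume t: "t \<in> J" "x \<in> B"
    show "\<kappa> * (norm (v - w))\<^sup>2 \<le> (Lv t x v - Lv t x w) \<bullet> (v - w)"
      using \<kappa>(2)[OF t, of "v - w"] bilinear_lsub[OF bil[OF t]] by (simp add: inner_diff_left grad[OF t])
  next
    fix t x p assume t: "t \<in> J" "x \<in> B"
    note b = bil[OF t]
    \<comment> \<open>The linear part of the affine map \<open>Lv t x\<close>. It represents the
      metric, so it is injective by positivity, hence onto in finite dimension.\<close>
    define \<phi> where "\<phi> v = Lv t x v - Lv t x 0" for v
    have \<phi>: "\<phi> v \<bullet> z = g t x v z" for v z
      by (simp add: \<phi>_def inner_diff_left grad[OF t] bilinear_lzero[OF b])
    have "linear \<phi>"
    proof (rule linearI)
      show "\<phi> (v + w) = \<phi> v + \<phi> w" for v w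
        by (rule euclidean_eqI) (simp add: inner_add_left \<phi> bilinear_ladd[OF b])
      show "\<phi> (c *\<^sub>R v) = c *\<^sub>R \<phi> v" for c v
        by (rule euclidean_eqI) (simp add: \<phi> bilinear_lmul[OF b])
    qed
    moreover have "inj \<phi>"
      unfolding linear_injective_0[OF \<open>linear \<phi>\<close>]
    proof (intro allI impI)
      fix v assume "\<phi> v = 0"
      then have "g t x v v = 0" using \<phi>[of v v] by simp
      then show "v = 0" using pos[OF t, of v] by fastforce
    qed
    ultimately have "surj \<phi>" using linear_inj_imp_surj by blast
    then obtain v where "\<phi> v = p - Lv t x 0" by (metis surjD)
    then show "\<exists>v. Lv t x v = p" by (auto simp: \<phi>_def)
  qed
  obtain C1 where C1: "C1 \<ge> 0" "\<And>z. z \<in> J \<times> B \<Longrightarrow> norm ((\<lambda>(t, x). V t x) z) \<le> C1"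
    using compact_bound[OF compact_Times[OF cpt(1,2)]
        continuous_on_subset[OF Ck_on_imp_continuous_on[OF V] sub]] by blast
  obtain C2 where C2: "C2 \<ge> 0" "\<And>t x v. \<lbrakk>t \<in> J; x \<in> B\<rbrakk> \<Longrightarrow> norm (Lv t x v) \<le> C2 * (1 + norm v)"
    by (rule tameD[OF tm]) blast
  \<comment> \<open>The kinetic term is at least \<open>\<kappa>/2 * n\<^sup>2\<close>. One half of
    this absorbs the 1-form by Young's inequality (fact \<open>5\<close>, from a completed square);
    the other half pays for \<open>\<kappa>/8 * (1 + n)\<^sup>2\<close>, which is at most
    \<open>\<kappa>/4 + \<kappa>/4 * n\<^sup>2\<close>.\<close>
  have low: "\<kappa>/8 * (1 + norm v)\<^sup>2 - (C1 + \<kappa>/4 + C2\<^sup>2 / \<kappa>) \<le> L t x v" if t: "t \<in> J" "x \<in> B" for t x v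
  proof -
    define n where "n = norm v"
    have "Lv t x 0 \<bullet> v = \<beta> t x v" using grad[OF t, of 0 v] bilinear_lzero[OF bil[OF t]] by simp
    then have "\<bar>\<beta> t x v\<bar> \<le> norm (Lv t x 0) * n" unfolding n_def using Cauchy_Schwarz_ineq2 by metis
    also have "\<dots> \<le> C2 * n" unfolding n_def using C2(2)[OF t, of 0] by (intro mult_right_mono) auto
    finally have 1: "- (C2 * n) \<le> \<beta> t x v" by linarith
    have 2: "V t x \<le> C1" using C1(2)[of "(t, x)"] t by auto
    have 3: "\<kappa> * n\<^sup>2 \<le> g t x v v" unfolding n_def by (rule \<kappa>(2)[OF t])
    have 4: "\<kappa>/8 * (1 + n)\<^sup>2 \<le> \<kappa>/8 * (2 * 1\<^sup>2 + 2 * n\<^sup>2)"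
      using \<kappa>(1) by (intro mult_left_mono square_sum_le) auto
    have 5: "C2 * n \<le> \<kappa>/4 * n\<^sup>2 + C2\<^sup>2 / \<kappa>"
    proof -
      have "0 \<le> (\<kappa> * n - 2 * C2)\<^sup>2" by simp
      then have "\<kappa> * (4 * (C2 * n)) \<le> \<kappa> * (\<kappa> * n\<^sup>2) + 4 * C2\<^sup>2"
        by (simp add: power2_eq_square algebra_simps)
      then show ?thesis using \<kappa>(1) by (simp add: field_simps power2_eq_square)
    qed
    show ?thesis unfolding n_def[symmetric] L_def using 1 2 3 4 5 by (simp add: algebra_simps)
  qed
  show ?thesis by (rule that[OF var _ low]) (use \<kappa>(1) in simp_all)
qed


section \<open>Curves in charts\<close>

lemma smooth_step:
  fixes s t :: real
  assumes "s < t"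
  obtains \<sigma> \<sigma>' where "\<And>\<tau>. (\<sigma> has_real_derivative \<sigma>' \<tau>) (at \<tau>)" "continuous_on UNIV \<sigma>'"
    "\<And>\<tau>. \<tau> \<le> s \<Longrightarrow> \<sigma> \<tau> = 0" "\<And>\<tau>. t \<le> \<tau> \<Longrightarrow> \<sigma> \<tau> = 1" "\<And>\<tau>. 0 \<le> \<sigma> \<tau> \<and> \<sigma> \<tau> \<le> 1"
proof -
  \<comment> \<open>\<open>\<phi>\<close> is the square of the positive part, which is C^1; the step
    is the quotient of \<open>\<phi> (\<tau> - s)\<close> by
    \<open>\<phi> (\<tau> - s) + \<phi> (t - \<tau>)\<close>. Because of \<open>s < t\<close> the
    two summands never vanish together, so the denominator is positive.\<close>
  define \<phi> :: "real \<Rightarrow> real" where "\<phi> u = (if u \<in> {0..} then u\<^sup>2 else 0)" for u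
  define \<phi>' :: "real \<Rightarrow> real" where "\<phi>' u = (if u \<in> {0..} then 2 * u else 0)" for u
  have "(\<phi> has_vector_derivative \<phi>' u) (at u)" for u
    unfolding \<phi>_def \<phi>'_def
  proof (rule has_vector_derivative_If_within_closures[where T = "{..0}" and f' = "\<lambda>u. 2 * u" and g' = "\<lambda>_. 0"])
    show "((\<lambda>u. u\<^sup>2) has_vector_derivative 2 * u) (at u within W)" for W
      unfolding has_real_derivative_iff_has_vector_derivative[symmetric]
      by (auto intro!: derivative_eq_intros)
  qed auto
  then have d\<phi>: "(\<phi> has_real_derivative \<phi>' u) (at u)" for u
    by (simp add: has_real_derivative_iff_has_vector_derivative)
  have c\<phi>': "continuous_on UNIV \<phi>'"
  proof -
    have "\<phi>' = (\<lambda>u. 2 * max 0 u)" by (auto simp: \<phi>'_def fun_eq_iff max_def)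
    then show ?thesis by (auto intro!: continuous_intros)
  qed
  have c\<phi>: "continuous_on UNIV \<phi>"
    using d\<phi> by (auto intro!: continuous_at_imp_continuous_on DERIV_isCont)
  define D where "D \<tau> = \<phi> (\<tau> - s) + \<phi> (t - \<tau>)" for \<tau>
  have D: "D \<tau> > 0" for \<tau>
  proof (cases "\<tau> > s")
    case True
    then have "\<phi> (\<tau> - s) > 0" "\<phi> (t - \<tau>) \<ge> 0" by (auto simp: \<phi>_def)
    then show ?thesis by (simp add: D_def)
  next
    case False
    then have "\<phi> (\<tau> - s) \<ge> 0" "\<phi> (t - \<tau>) > 0" using assms by (auto simp: \<phi>_def)
    then show ?thesis by (simp add: D_def)
  qed
  have cD: "continuous_on UNIV D"
    unfolding D_def by (intro continuous_intros continuous_on_compose2[OF c\<phi>]) auto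
  define \<sigma> where "\<sigma> \<tau> = \<phi> (\<tau> - s) / D \<tau>" for \<tau>
  define \<sigma>' where "\<sigma>' \<tau> = (\<phi>' (\<tau> - s) * D \<tau> - \<phi> (\<tau> - s) * (\<phi>' (\<tau> - s) - \<phi>' (t - \<tau>))) / (D \<tau> * D \<tau>)" for \<tau>
  show ?thesis
  proof (rule that[of \<sigma> \<sigma>'])
    fix \<tau>
    have 1: "((\<lambda>\<tau>. \<phi> (\<tau> - s)) has_real_derivative \<phi>' (\<tau> - s)) (at \<tau>)"
    proof -
      have "((\<lambda>\<tau>. \<tau> - s) has_real_derivative 1) (at \<tau>)" by (auto intro!: derivative_eq_intros)
      from DERIV_chain2[OF d\<phi> this] show ?thesis by simp
    qed
    have 2: "((\<lambda>\<tau>. \<phi> (t - \<tau>)) has_real_derivative - \<phi>' (t - \<tau>)) (at \<tau>)"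
    proof -
      have "((\<lambda>\<tau>. t - \<tau>) has_real_derivative - 1) (at \<tau>)" by (auto intro!: derivative_eq_intros)
      from DERIV_chain2[OF d\<phi> this] show ?thesis by simp
    qed
    have 3: "(D has_real_derivative \<phi>' (\<tau> - s) - \<phi>' (t - \<tau>)) (at \<tau>)"
      unfolding D_def using DERIV_add[OF 1 2] by simp
    show "(\<sigma> has_real_derivative \<sigma>' \<tau>) (at \<tau>)"
      unfolding \<sigma>_def \<sigma>'_def using DERIV_divide[OF 1 3] D[of \<tau>] by simp
    show "0 \<le> \<sigma> \<tau> \<and> \<sigma> \<tau> \<le> 1" using D[of \<tau>] by (auto simp: \<sigma>_def D_def \<phi>_def)
  next
    show "continuous_on UNIV \<sigma>'"
      unfolding \<sigma>'_def
    proof (intro continuous_intros cD continuous_on_compose2[OF c\<phi>'] continuous_on_compose2[OF c\<phi>])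
      show "\<forall>\<tau>\<in>UNIV. D \<tau> * D \<tau> \<noteq> 0" using D by (simp add: less_imp_neq[symmetric])
    qed auto
    show "\<sigma> \<tau> = 0" if "\<tau> \<le> s" for \<tau> using that by (auto simp: \<sigma>_def \<phi>_def)
    show "\<sigma> \<tau> = 1" if "t \<le> \<tau>" for \<tau>
      using that assms D[of \<tau>] by (auto simp: \<sigma>_def D_def \<phi>_def)
  qed
qed

lemma continuous_within_openin:
  assumes "continuous_on (U \<inter> I) f" "open U" "t \<in> U" "t \<in> I" "S \<subseteq> I"
  shows "continuous (at t within S) f"
proof -
  have "continuous (at t within U \<inter> I) f" using assms by (simp add: continuous_on_eq_continuous_within)
  then have "continuous (at t within U \<inter> S) f" by (rule continuous_within_subset) (use assms in auto)
  moreover have "at t within U \<inter> S = at t within S"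
    by (rule at_within_nhd[of t U]) (use assms in auto)
  ultimately show ?thesis by simp
qed

text \<open>At both ends \<open>h\<close> and its derivative agree with zero, so the one-sided
  derivatives match and the extended derivative has no jump.\<close>

lemma extend_by_zero:
  fixes h :: "real \<Rightarrow> 'e::real_normed_vector"
  assumes "\<alpha> < \<beta>" and h: "\<And>t. t \<in> {\<alpha>..\<beta>} \<Longrightarrow> (h has_vector_derivative h' t) (at t within {\<alpha>..\<beta>})"
    and c: "continuous_on {\<alpha>..\<beta>} h'" and z: "h \<alpha> = 0" "h \<beta> = 0" "h' \<alpha> = 0" "h' \<beta> = 0"
  shows "((\<lambda>t. if t \<in> {\<alpha>..\<beta>} then h t else 0) has_vector_derivative
      (if t \<in> {\<alpha>..\<beta>} then h' t else 0)) (at t)"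
    and "continuous_on UNIV (\<lambda>t. if t \<in> {\<alpha>..\<beta>} then h' t else 0)"
proof -
  let ?T = "{..\<alpha>} \<union> {\<beta>..}"
  have U: "UNIV = {\<alpha>..\<beta>} \<union> ?T" using assms(1) by auto
  have cl: "closure {\<alpha>..\<beta>} \<inter> closure ?T = {\<alpha>, \<beta>}" using assms(1) by (auto simp: closure_Un)
  have sub: "{\<alpha>..\<beta>} \<union> {\<alpha>, \<beta>} = {\<alpha>..\<beta>}" using assms(1) by auto
  show "((\<lambda>t. if t \<in> {\<alpha>..\<beta>} then h t else 0) has_vector_derivative
      (if t \<in> {\<alpha>..\<beta>} then h' t else 0)) (at t)"
  proof (rule has_vector_derivative_If_within_closures[where T = ?T and f' = h' and g' = "\<lambda>_. 0"])
    show "t \<in> {\<alpha>..\<beta>} \<union> ?T" using U by auto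
    show "UNIV = {\<alpha>..\<beta>} \<union> ?T" by (rule U)
    show "(h has_vector_derivative h' t) (at t within {\<alpha>..\<beta>} \<union> closure {\<alpha>..\<beta>} \<inter> closure ?T)"
      if "t \<in> {\<alpha>..\<beta>} \<union> closure {\<alpha>..\<beta>} \<inter> closure ?T"
      using that unfolding cl sub by (rule h)
    show "((\<lambda>_. 0) has_vector_derivative 0) (at t within ?T \<union> closure {\<alpha>..\<beta>} \<inter> closure ?T)" by simp
    have "t = \<alpha> \<or> t = \<beta>" if "t \<in> closure {\<alpha>..\<beta>}" "t \<in> closure ?T" using cl that by blast
    then show "h t = 0" "h' t = 0" if "t \<in> closure {\<alpha>..\<beta>}" "t \<in> closure ?T" using that z by auto
  qed
  have "continuous_on ({\<alpha>..\<beta>} \<union> ?T) (\<lambda>t. if t \<in> {\<alpha>..\<beta>} then h' t else 0)"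
    by (rule continuous_on_cases) (use c z in \<open>auto simp: order_antisym_conv\<close>)
  then show "continuous_on UNIV (\<lambda>t. if t \<in> {\<alpha>..\<beta>} then h' t else 0)" using U by simp
qed

abbreviation chart_inv :: "('q, 'e) chart \<Rightarrow> 'e \<Rightarrow> 'q" where
  "chart_inv c \<equiv> inv_into (fst c) (snd c)"

definition transition_deriv :: "('q, 'e::euclidean_space) chart \<Rightarrow> ('q, 'e) chart \<Rightarrow> 'e \<Rightarrow> 'e \<Rightarrow> 'e" where
  "transition_deriv c c' x = frechet_derivative (transition c c') (at x)"

text \<open>One chart around each point of the curve is enough to test for \<open>C\<^sup>1\<close> regularity.\<close>

definition C1_near :: "('q::topological_space, 'e::euclidean_space) chart set \<Rightarrow> real set \<Rightarrow> (real \<Rightarrow> 'q) \<Rightarrow> real \<Rightarrow> bool" where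
  "C1_near A I q t \<longleftrightarrow> (\<exists>c\<in>A. \<exists>U D. open U \<and> t \<in> U \<and> continuous_on (U \<inter> I) D \<and>
     (\<forall>s\<in>U \<inter> I. q s \<in> fst c \<and> ((snd c \<circ> q) has_vector_derivative D s) (at s within I)))"

locale C1_atlas =
  fixes A :: "('q::t2_space, 'e::euclidean_space) chart set"
  assumes atlas: "Ck_atlas 1 A"
begin

section \<open>Transition maps and their derivatives\<close>

lemma chart:
  assumes "c \<in> A"
  shows "open (fst c)" "open (snd c ` fst c)" "continuous_on (fst c) (snd c)"
    "continuous_on (snd c ` fst c) (chart_inv c)"
    "\<And>p. p \<in> fst c \<Longrightarrow> chart_inv c (snd c p) = p"
    "\<And>x. x \<in> snd c ` fst c \<Longrightarrow> snd c (chart_inv c x) = x"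
    "\<And>x. x \<in> snd c ` fst c \<Longrightarrow> chart_inv c x \<in> fst c"
  using assms atlas unfolding Ck_atlas_def is_chart_def homeomorphism_def
  by (auto simp: inv_into_into f_inv_into_f)

lemma chart_cover: obtains c where "c \<in> A" "p \<in> fst c"
  using atlas unfolding Ck_atlas_def by blast

lemma open_overlap:
  assumes "c \<in> A" "c' \<in> A"
  shows "open (snd c ` (fst c \<inter> fst c'))"
proof -
  have "snd c ` (fst c \<inter> fst c') = snd c ` fst c \<inter> chart_inv c -` fst c'"
    using chart(5-7)[OF assms(1)] by force
  then show ?thesis
    using continuous_open_preimage[OF chart(4,2)[OF assms(1)] chart(1)[OF assms(2)]] by simp
qed

lemma transition_apply: "c \<in> A \<Longrightarrow> p \<in> fst c \<Longrightarrow> transition c c' (snd c p) = snd c' p"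
  by (simp add: transition_def chart(5))

lemma transition_has_derivative:
  assumes "c \<in> A" "c' \<in> A" "x \<in> snd c ` (fst c \<inter> fst c')"
  shows "(transition c c' has_derivative transition_deriv c c' x) (at x)"
proof -
  have "Ck_on (Suc 0) (transition c c') (snd c ` (fst c \<inter> fst c'))"
    using atlas assms unfolding Ck_atlas_def by simp
  then show ?thesis using assms(3) frechet_derivative_at unfolding transition_deriv_def
    by (metis Ck_on.simps(2))
qed

lemma transition_deriv_continuous:
  assumes "c \<in> A" "c' \<in> A"
  shows "continuous_on (snd c ` (fst c \<inter> fst c')) (\<lambda>x. transition_deriv c c' x v)"
proof -
  have "Ck_on (Suc 0) (transition c c') (snd c ` (fst c \<inter> fst c'))"
    using atlas assms unfolding Ck_atlas_def by simp
  then obtain f' where f': "\<forall>x\<in>snd c ` (fst c \<inter> fst c'). (transition c c' has_derivative f' x) (at x)"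
    "\<forall>v. continuous_on (snd c ` (fst c \<inter> fst c')) (\<lambda>x. f' x v)" by auto
  have "f' x = transition_deriv c c' x" if "x \<in> snd c ` (fst c \<inter> fst c')" for x
    unfolding transition_deriv_def using f'(1) that frechet_derivative_at by blast
  then have "continuous_on (snd c ` (fst c \<inter> fst c')) (\<lambda>x. transition_deriv c c' x v)
      = continuous_on (snd c ` (fst c \<inter> fst c')) (\<lambda>x. f' x v)"
    by (intro continuous_on_cong) auto
  then show ?thesis using f'(2) by simp
qed

lemma transition_deriv_linear:
  assumes "c \<in> A" "c' \<in> A" "p \<in> fst c" "p \<in> fst c'"
  shows "linear (transition_deriv c c' (snd c p))"
  by (rule has_derivative_linear[OF transition_has_derivative]) (use assms in auto)

text \<open>Continuity in the base point is known for one fixed vector at a time; expanding the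
  vector in the finite basis gives joint continuity by linearity.\<close>

lemma transition_deriv_continuous2:
  assumes "c \<in> A" "c' \<in> A" and x: "continuous_on I x" and w: "continuous_on I w"
    and "x ` I \<subseteq> snd c ` (fst c \<inter> fst c')"
  shows "continuous_on I (\<lambda>s. transition_deriv c c' (x s) (w s))"
proof -
  have "continuous_on I (\<lambda>s. \<Sum>i\<in>Basis. (w s \<bullet> i) *\<^sub>R transition_deriv c c' (x s) i)"
    by (intro continuous_intros w continuous_on_compose2[OF transition_deriv_continuous[OF assms(1,2)] x assms(5)])
  moreover have "transition_deriv c c' (x s) (w s) = (\<Sum>i\<in>Basis. (w s \<bullet> i) *\<^sub>R transition_deriv c c' (x s) i)"
    if "s \<in> I" for s
  proof -
    have l: "linear (transition_deriv c c' (x s))"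
      by (rule has_derivative_linear[OF transition_has_derivative[OF assms(1,2)]]) (use assms(5) that in auto)
    have "transition_deriv c c' (x s) (w s) = transition_deriv c c' (x s) (\<Sum>i\<in>Basis. (w s \<bullet> i) *\<^sub>R i)"
      by (simp add: euclidean_representation)
    also have "\<dots> = (\<Sum>i\<in>Basis. (w s \<bullet> i) *\<^sub>R transition_deriv c c' (x s) i)"
      by (simp add: linear_sum[OF l] linear_cmul[OF l])
    finally show ?thesis .
  qed
  ultimately show ?thesis by (simp cong: continuous_on_cong)
qed

text \<open>Chain rule. The composite of two transitions coincides with the direct one on the whole
  overlap of \<open>c\<close> and \<open>c'\<close>, an open set, because \<open>snd c''\<close> is
  a total function.\<close>

lemma transition_deriv_cocycle:
  assumes c: "c \<in> A" "c' \<in> A" "c'' \<in> A" and p: "p \<in> fst c" "p \<in> fst c'" "p \<in> fst c''"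
  shows "transition_deriv c' c'' (snd c' p) (transition_deriv c c' (snd c p) v) = transition_deriv c c'' (snd c p) v"
proof -
  have d1: "(transition c c' has_derivative transition_deriv c c' (snd c p)) (at (snd c p))"
    by (rule transition_has_derivative) (use assms in auto)
  have d2: "(transition c' c'' has_derivative transition_deriv c' c'' (snd c' p)) (at (transition c c' (snd c p)))"
    unfolding transition_apply[OF c(1) p(1)] by (rule transition_has_derivative) (use assms in auto)
  have "(transition c' c'' \<circ> transition c c' has_derivative
      transition_deriv c' c'' (snd c' p) \<circ> transition_deriv c c' (snd c p)) (at (snd c p))"
    by (rule diff_chain_at[OF d1 d2])
  then have "(transition c c'' has_derivative
      transition_deriv c' c'' (snd c' p) \<circ> transition_deriv c c' (snd c p)) (at (snd c p))"
  proof (rule has_derivative_transform_within_open[OF _ open_overlap[OF c(1,2)]])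
    show "snd c p \<in> snd c ` (fst c \<inter> fst c')" using p by auto
    fix x assume "x \<in> snd c ` (fst c \<inter> fst c')"
    then obtain z where z: "z \<in> fst c" "z \<in> fst c'" "x = snd c z" by auto
    then show "(transition c' c'' \<circ> transition c c') x = transition c c'' x"
      using transition_apply c by simp
  qed
  moreover have "(transition c c'' has_derivative transition_deriv c c'' (snd c p)) (at (snd c p))"
    by (rule transition_has_derivative) (use assms in auto)
  ultimately have "transition_deriv c' c'' (snd c' p) \<circ> transition_deriv c c' (snd c p) = transition_deriv c c'' (snd c p)"
    by (rule has_derivative_unique)
  then show ?thesis by (metis comp_apply)
qed

lemma transition_deriv_refl:
  assumes "c \<in> A" "p \<in> fst c"
  shows "transition_deriv c c (snd c p) v = v"
proof -
  have "((\<lambda>x. x) has_derivative (\<lambda>v. v)) (at (snd c p))" by (rule has_derivative_ident)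
  then have "(transition c c has_derivative (\<lambda>v. v)) (at (snd c p))"
    by (rule has_derivative_transform_within_open[OF _ chart(2)[OF assms(1)]])
       (use assms chart(6) in \<open>auto simp: transition_def\<close>)
  moreover have "(transition c c has_derivative transition_deriv c c (snd c p)) (at (snd c p))"
    by (rule transition_has_derivative) (use assms in auto)
  ultimately have "transition_deriv c c (snd c p) = (\<lambda>v. v)" using has_derivative_unique by blast
  then show ?thesis by simp
qed

section \<open>Tangent vectors in coordinates\<close>

lemma coord_vec_eq:
  "coord_vec A c p v = (\<lambda>c'. if c' \<in> charts_at A p then transition_deriv c c' (snd c p) v else 0)"
  unfolding coord_vec_def transition_deriv_def ..

text \<open>The cocycle identity is the transformation law required of a tangent vector.\<close>

lemma coord_vec_tangent:
  assumes "c \<in> A" "p \<in> fst c"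
  shows "coord_vec A c p v \<in> tangent_space A p"
  unfolding tangent_space_def mem_Collect_eq transition_deriv_def[symmetric]
proof (intro conjI ballI allI impI)
  fix c1 c2 assume "c1 \<in> charts_at A p" "c2 \<in> charts_at A p"
  then show "coord_vec A c p v c2 = transition_deriv c1 c2 (snd c1 p) (coord_vec A c p v c1)"
    using transition_deriv_cocycle[of c c1 c2 p v] assms by (simp add: coord_vec_eq charts_at_def)
qed (simp add: coord_vec_eq)

lemma tangent_eq_coord_vec:
  assumes "\<xi> \<in> tangent_space A p" "c \<in> A" "p \<in> fst c"
  shows "\<xi> = coord_vec A c p (\<xi> c)"
proof
  fix c'
  have "c \<in> charts_at A p" using assms by (simp add: charts_at_def)
  with assms(1) have "c' \<in> charts_at A p \<Longrightarrow> \<xi> c' = transition_deriv c c' (snd c p) (\<xi> c)"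
    "c' \<notin> charts_at A p \<Longrightarrow> \<xi> c' = 0"
    unfolding tangent_space_def transition_deriv_def by blast+
  then show "\<xi> c' = coord_vec A c p (\<xi> c) c'" unfolding coord_vec_eq by simp
qed

lemma coord_vec_same: "c \<in> A \<Longrightarrow> p \<in> fst c \<Longrightarrow> coord_vec A c p v c = v"
  by (simp add: coord_vec_eq charts_at_def transition_deriv_refl)

lemma coord_vec_lincomb:
  assumes "c \<in> A" "p \<in> fst c"
  shows "coord_vec A c p (s *\<^sub>R v + u *\<^sub>R w) = lincomb s (coord_vec A c p v) u (coord_vec A c p w)"
proof
  fix c'
  show "coord_vec A c p (s *\<^sub>R v + u *\<^sub>R w) c' = lincomb s (coord_vec A c p v) u (coord_vec A c p w) c'"
  proof (cases "c' \<in> charts_at A p")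
    case True
    then have "linear (transition_deriv c c' (snd c p))"
      using assms by (intro transition_deriv_linear) (auto simp: charts_at_def)
    then show ?thesis by (simp add: coord_vec_eq lincomb_def linear_add linear_cmul)
  qed (simp add: coord_vec_eq lincomb_def)
qed

section \<open>Local description of C^1 curves\<close>

lemma change_chart:
  assumes c: "c \<in> A" "c' \<in> A" and U: "open U" "t \<in> U" "t \<in> I" and D: "continuous_on (U \<inter> I) D"
    and d: "\<And>s. s \<in> U \<inter> I \<Longrightarrow> q s \<in> fst c \<and> ((snd c \<circ> q) has_vector_derivative D s) (at s within I)"
    and t: "q t \<in> fst c'"
  shows "\<exists>W. open W \<and> t \<in> W \<and> W \<subseteq> U \<and>
    continuous_on (W \<inter> I) (\<lambda>s. transition_deriv c c' (snd c (q s)) (D s)) \<and>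
    (\<forall>s\<in>W \<inter> I. q s \<in> fst c' \<and>
       ((snd c' \<circ> q) has_vector_derivative transition_deriv c c' (snd c (q s)) (D s)) (at s within I))"
proof -
  \<comment> \<open>Continuity of \<open>q\<close> is recovered from its coordinates: they are
    differentiable, hence continuous, and \<open>chart_inv c\<close> carries this back to the
    manifold. It makes the set of times at which \<open>q\<close> lies in the second chart
    relatively open.\<close>
  have cq: "continuous_on (U \<inter> I) (\<lambda>s. snd c (q s))"
    unfolding continuous_on_eq_continuous_within
  proof
    fix s assume s: "s \<in> U \<inter> I"
    then have "continuous (at s within I) (snd c \<circ> q)" using d has_vector_derivative_continuous by blast
    then show "continuous (at s within U \<inter> I) (\<lambda>s. snd c (q s))"
      unfolding o_def by (rule continuous_within_subset) auto
  qed
  have "continuous_on (U \<inter> I) (\<lambda>s. chart_inv c (snd c (q s)))"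
    by (rule continuous_on_compose2[OF chart(4)[OF c(1)] cq]) (use d in auto)
  then have q: "continuous_on (U \<inter> I) q"
    by (rule continuous_on_eq) (use d chart(5)[OF c(1)] in auto)
  obtain W0 where W0: "open W0" "(U \<inter> I) \<inter> q -` fst c' = (U \<inter> I) \<inter> W0"
    using continuous_openin_preimage_gen[OF q chart(1)[OF c(2)]] unfolding openin_open by blast
  define W where "W = U \<inter> W0"
  have WI: "s \<in> U \<inter> I \<and> q s \<in> fst c'" if "s \<in> W \<inter> I" for s using that W0(2) by (auto simp: W_def)
  show ?thesis
  proof (intro exI[of _ W] conjI ballI)
    show "open W" "W \<subseteq> U" using U W0 by (auto simp: W_def)
    show "t \<in> W" using U t W0(2) by (auto simp: W_def)
    show "continuous_on (W \<inter> I) (\<lambda>s. transition_deriv c c' (snd c (q s)) (D s))"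
      by (rule transition_deriv_continuous2[OF c continuous_on_subset[OF cq] continuous_on_subset[OF D]])
         (use WI d in auto)
    fix s assume s: "s \<in> W \<inter> I"
    show "q s \<in> fst c'" using WI[OF s] by simp
    have "(transition c c' has_derivative transition_deriv c c' (snd c (q s))) (at ((snd c \<circ> q) s))"
      using transition_has_derivative[OF c, of "snd c (q s)"] WI[OF s] d by auto
    then have "((transition c c' \<circ> (snd c \<circ> q)) has_vector_derivative transition_deriv c c' (snd c (q s)) (D s))
        (at s within I)"
      using WI[OF s] d by (blast intro: vector_derivative_diff_chain_within has_derivative_at_withinI)
    moreover have "\<forall>\<^sub>F r in nhds s. r \<in> I \<longrightarrow> (transition c c' \<circ> (snd c \<circ> q)) r = (snd c' \<circ> q) r"
      unfolding eventually_nhds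
      using U s W0 transition_apply[OF c(1)] d by (intro exI[of _ W]) (auto simp: W_def)
    moreover have "(transition c c' \<circ> (snd c \<circ> q)) s = (snd c' \<circ> q) s"
      using transition_apply[OF c(1)] d WI[OF s] by auto
    ultimately show "((snd c' \<circ> q) has_vector_derivative transition_deriv c c' (snd c (q s)) (D s)) (at s within I)"
      using has_vector_derivative_cong_ev by blast
  qed
qed

lemma C1_nearE:
  assumes "C1_near A I q t" "t \<in> I" "c' \<in> A" "q t \<in> fst c'"
  obtains U D where "open U" "t \<in> U" "continuous_on (U \<inter> I) D"
    "\<And>s. s \<in> U \<inter> I \<Longrightarrow> q s \<in> fst c'"
    "\<And>s. s \<in> U \<inter> I \<Longrightarrow> ((snd c' \<circ> q) has_vector_derivative D s) (at s within I)"
proof -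
  obtain c U D where c: "c \<in> A" and U: "open U" "t \<in> U" and D: "continuous_on (U \<inter> I) D"
    and d: "\<And>s. s \<in> U \<inter> I \<Longrightarrow> q s \<in> fst c \<and> ((snd c \<circ> q) has_vector_derivative D s) (at s within I)"
    using assms(1) unfolding C1_near_def by blast
  from change_chart[OF c assms(3) U assms(2) D d assms(4)] that show ?thesis by blast
qed

lemma C1_near_imp_continuous:
  assumes "C1_near A I q t" "t \<in> I"
  shows "continuous (at t within I) q"
proof -
  obtain c U D where c: "c \<in> A" and U: "open U" "t \<in> U" and D: "continuous_on (U \<inter> I) D"
    and d: "\<And>s. s \<in> U \<inter> I \<Longrightarrow> q s \<in> fst c \<and> ((snd c \<circ> q) has_vector_derivative D s) (at s within I)"
    using assms(1) unfolding C1_near_def by blast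
  have cq: "continuous_on (U \<inter> I) (\<lambda>s. snd c (q s))"
    unfolding continuous_on_eq_continuous_within
  proof
    fix s assume s: "s \<in> U \<inter> I"
    then have "continuous (at s within I) (snd c \<circ> q)" using d has_vector_derivative_continuous by blast
    then show "continuous (at s within U \<inter> I) (\<lambda>s. snd c (q s))"
      unfolding o_def by (rule continuous_within_subset) auto
  qed
  have "continuous_on (U \<inter> I) (\<lambda>s. chart_inv c (snd c (q s)))"
    by (rule continuous_on_compose2[OF chart(4)[OF c] cq]) (use d in auto)
  then have "continuous_on (U \<inter> I) q"
    by (rule continuous_on_eq) (use d chart(5)[OF c] in auto)
  then show ?thesis by (rule continuous_within_openin) (use U assms in auto)
qed

text \<open>The candidate derivative is the globally defined \<open>vector_derivative\<close>. On a
  nondegenerate interval derivatives are unique, so near every time it equals the local derivative,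
  whose continuity is known.\<close>

lemma C1_curveI:
  assumes "t0 < t1" and near: "\<And>t. t \<in> {t0..t1} \<Longrightarrow> C1_near A {t0..t1} q t"
  shows "C1_curve A t0 t1 q"
  unfolding C1_curve_def
proof (intro conjI ballI)
  show "continuous_on {t0..t1} q"
    unfolding continuous_on_eq_continuous_within using C1_near_imp_continuous[OF near] by blast
  fix c assume c: "c \<in> A"
  let ?S = "{t \<in> {t0..t1}. q t \<in> fst c}"
  define D where "D t = vector_derivative (snd c \<circ> q) (at t within {t0..t1})" for t
  have *: "continuous (at t within ?S) D \<and> ((snd c \<circ> q) has_vector_derivative D t) (at t within {t0..t1})"
    if t: "t \<in> ?S" for t
  proof -
    obtain U E where U: "open U" "t \<in> U" "continuous_on (U \<inter> {t0..t1}) E"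
      and E: "\<And>s. s \<in> U \<inter> {t0..t1} \<Longrightarrow> q s \<in> fst c"
        "\<And>s. s \<in> U \<inter> {t0..t1} \<Longrightarrow> ((snd c \<circ> q) has_vector_derivative E s) (at s within {t0..t1})"
      by (rule C1_nearE[OF near _ c]) (use t in auto)
    have DE: "D s = E s" if "s \<in> U \<inter> {t0..t1}" for s
      unfolding D_def by (rule vector_derivative_within_closed_interval[OF assms(1)]) (use that E in auto)
    have "continuous_on (U \<inter> {t0..t1}) D" using U(3) by (rule continuous_on_eq) (use DE in auto)
    then have "continuous (at t within ?S) D"
      by (rule continuous_within_openin) (use U t in auto)
    then show ?thesis using E(2)[of t] DE[of t] U t by auto
  qed
  show "\<exists>D. continuous_on ?S D \<and>
      (\<forall>t\<in>?S. ((snd c \<circ> q) has_vector_derivative D t) (at t within {t0..t1}))"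
    using * by (intro exI[of _ D]) (simp add: continuous_on_eq_continuous_within)
qed

lemma C1_curveD:
  assumes q: "C1_curve A t0 t1 q" and t: "t \<in> {t0..t1}"
  shows "C1_near A {t0..t1} q t"
proof -
  obtain c where c: "c \<in> A" "q t \<in> fst c" by (rule chart_cover)
  have qc: "continuous_on {t0..t1} q" using q by (simp add: C1_curve_def)
  obtain D where D: "continuous_on {t \<in> {t0..t1}. q t \<in> fst c} D"
    "\<And>t. t \<in> {t \<in> {t0..t1}. q t \<in> fst c} \<Longrightarrow> ((snd c \<circ> q) has_vector_derivative D t) (at t within {t0..t1})"
    using q c unfolding C1_curve_def by blast
  obtain U where U: "open U" "{t0..t1} \<inter> q -` fst c = {t0..t1} \<inter> U"
    using continuous_openin_preimage_gen[OF qc chart(1)[OF c(1)]] unfolding openin_open by blast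
  have "{t \<in> {t0..t1}. q t \<in> fst c} = {t0..t1} \<inter> q -` fst c" by blast
  then have eq: "{t \<in> {t0..t1}. q t \<in> fst c} = U \<inter> {t0..t1}" unfolding U(2) by blast
  have tU: "t \<in> U" using eq t c(2) by blast
  have D1: "continuous_on (U \<inter> {t0..t1}) D" using D(1) unfolding eq .
  have D2: "\<forall>s\<in>U \<inter> {t0..t1}. q s \<in> fst c \<and> ((snd c \<circ> q) has_vector_derivative D s) (at s within {t0..t1})"
  proof
    fix s assume "s \<in> U \<inter> {t0..t1}"
    then have s: "s \<in> {t \<in> {t0..t1}. q t \<in> fst c}" unfolding eq .
    then show "q s \<in> fst c \<and> ((snd c \<circ> q) has_vector_derivative D s) (at s within {t0..t1})"
      using D(2)[OF s] by simp
  qed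
  show ?thesis unfolding C1_near_def
    by (intro bexI[OF _ c(1)] exI[of _ U] exI[of _ D] conjI U(1) tU D1 D2)
qed

lemma C1_near_subset:
  assumes "C1_near A I q t" "S \<subseteq> I"
  shows "C1_near A S q t"
proof -
  obtain c U D where c: "c \<in> A" and U: "open U" "t \<in> U" and D: "continuous_on (U \<inter> I) D"
    and d: "\<And>s. s \<in> U \<inter> I \<Longrightarrow> q s \<in> fst c \<and> ((snd c \<circ> q) has_vector_derivative D s) (at s within I)"
    using assms(1) unfolding C1_near_def by blast
  have "continuous_on (U \<inter> S) D" using D by (rule continuous_on_subset) (use assms(2) in auto)
  moreover have "q s \<in> fst c \<and> ((snd c \<circ> q) has_vector_derivative D s) (at s within S)" if "s \<in> U \<inter> S" for s
    using d[of s] that assms(2) has_vector_derivative_within_subset[OF _ assms(2)] by blast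
  ultimately show ?thesis unfolding C1_near_def using c U by blast
qed

text \<open>\<open>velocity\<close> differentiates separately in every chart. By the chain rule in
  \<open>change_chart\<close> these derivatives transform like the coordinates of one tangent
  vector, and uniqueness on a nondegenerate interval ties them to the given
  \<open>w\<close>.\<close>

lemma velocity_eq_coord_vec:
  assumes "t0 < t1" "C1_curve A t0 t1 q" "t \<in> {t0..t1}" "c \<in> A" "q t \<in> fst c"
    and w: "((snd c \<circ> q) has_vector_derivative w) (at t within {t0..t1})"
  shows "velocity A t0 t1 q t = coord_vec A c (q t) w"
proof
  fix c'
  obtain U D where U: "open U" "t \<in> U" "continuous_on (U \<inter> {t0..t1}) D"
    and D: "\<And>s. s \<in> U \<inter> {t0..t1} \<Longrightarrow> q s \<in> fst c"
      "\<And>s. s \<in> U \<inter> {t0..t1} \<Longrightarrow> ((snd c \<circ> q) has_vector_derivative D s) (at s within {t0..t1})"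
    by (rule C1_nearE[OF C1_curveD[OF assms(2,3)] assms(3-5)]) auto
  have Dt: "D t = w"
    using vector_derivative_within_closed_interval[OF assms(1,3) w]
      vector_derivative_within_closed_interval[OF assms(1,3) D(2)] U(2) assms(3) by simp
  show "velocity A t0 t1 q t c' = coord_vec A c (q t) w c'"
  proof (cases "c' \<in> charts_at A (q t)")
    case True
    then have c': "c' \<in> A" "q t \<in> fst c'" by (auto simp: charts_at_def)
    have dd: "q s \<in> fst c \<and> ((snd c \<circ> q) has_vector_derivative D s) (at s within {t0..t1})"
      if "s \<in> U \<inter> {t0..t1}" for s using D that by blast
    obtain W where "t \<in> W" "\<forall>s\<in>W \<inter> {t0..t1}. q s \<in> fst c' \<and>
       ((snd c' \<circ> q) has_vector_derivative transition_deriv c c' (snd c (q s)) (D s)) (at s within {t0..t1})"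
      using change_chart[where q = q, OF assms(4) c'(1) U(1,2) assms(3) U(3) dd c'(2)] by blast
    then have "((snd c' \<circ> q) has_vector_derivative transition_deriv c c' (snd c (q t)) w) (at t within {t0..t1})"
      using assms(3) Dt by auto
    then have "vector_derivative (snd c' \<circ> q) (at t within {t0..t1}) = transition_deriv c c' (snd c (q t)) w"
      by (rule vector_derivative_within_closed_interval[OF assms(1,3)])
    then show ?thesis using True by (simp add: velocity_def coord_vec_eq)
  qed (simp add: velocity_def coord_vec_eq)
qed

lemma C1_curve_coordinates:
  assumes "t0 < t1" "C1_curve A t0 t1 q" "c \<in> A" "J \<subseteq> {t0..t1}" "\<And>t. t \<in> J \<Longrightarrow> q t \<in> fst c"
  obtains v where "continuous_on J v"
    "\<And>t. t \<in> J \<Longrightarrow> ((snd c \<circ> q) has_vector_derivative v t) (at t within {t0..t1})"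
    "\<And>t. t \<in> J \<Longrightarrow> velocity A t0 t1 q t = coord_vec A c (q t) (v t)"
proof -
  obtain D where D: "continuous_on {t\<in>{t0..t1}. q t \<in> fst c} D"
    "\<And>t. t\<in>{t\<in>{t0..t1}. q t \<in> fst c} \<Longrightarrow> ((snd c \<circ> q) has_vector_derivative D t) (at t within {t0..t1})"
    using assms(2,3) unfolding C1_curve_def by blast
  show ?thesis
  proof (rule that[of D])
    show "continuous_on J D" using D(1) by (rule continuous_on_subset) (use assms in auto)
    fix t assume t: "t \<in> J"
    show d: "((snd c \<circ> q) has_vector_derivative D t) (at t within {t0..t1})"
      using D(2) t assms by auto
    show "velocity A t0 t1 q t = coord_vec A c (q t) (D t)"
      by (rule velocity_eq_coord_vec[OF assms(1,2) _ assms(3) _ d]) (use t assms in auto)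
  qed
qed

lemma C1_near_cong:
  assumes "C1_near A I q t" "t \<in> I" "open W" "t \<in> W" and eq: "\<And>s. s \<in> W \<inter> I \<Longrightarrow> q s = q' s"
  shows "C1_near A I q' t"
proof -
  obtain c U D where c: "c \<in> A" and U: "open U" "t \<in> U" and D: "continuous_on (U \<inter> I) D"
    and d: "\<And>s. s \<in> U \<inter> I \<Longrightarrow> q s \<in> fst c \<and> ((snd c \<circ> q) has_vector_derivative D s) (at s within I)"
    using assms(1) unfolding C1_near_def by blast
  have "q' s \<in> fst c \<and> ((snd c \<circ> q') has_vector_derivative D s) (at s within I)" if s: "s \<in> (U \<inter> W) \<inter> I" for s
  proof -
    have "\<forall>\<^sub>F r in nhds s. r \<in> I \<longrightarrow> (snd c \<circ> q) r = (snd c \<circ> q') r"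
      unfolding eventually_nhds using eq s assms(3) by (intro exI[of _ W]) auto
    moreover have "(snd c \<circ> q) s = (snd c \<circ> q') s" using eq s by auto
    ultimately have "((snd c \<circ> q') has_vector_derivative D s) (at s within I)"
      using has_vector_derivative_cong_ev d s by blast
    then show ?thesis using d[of s] eq[of s] s by auto
  qed
  moreover have "continuous_on ((U \<inter> W) \<inter> I) D" by (rule continuous_on_subset[OF D]) auto
  ultimately show ?thesis unfolding C1_near_def using c U assms(3,4) by blast
qed

lemma C1_near_chartI:
  assumes "c \<in> A" "open U" "t \<in> U" "continuous_on (U \<inter> I) D"
    and y: "\<And>s. s \<in> U \<inter> I \<Longrightarrow> y s \<in> snd c ` fst c"
    and d: "\<And>s. s \<in> U \<inter> I \<Longrightarrow> (y has_vector_derivative D s) (at s within I)"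
    and q: "\<And>s. s \<in> U \<inter> I \<Longrightarrow> q s = chart_inv c (y s)"
  shows "C1_near A I q t"
    and "s \<in> U \<inter> I \<Longrightarrow> ((snd c \<circ> q) has_vector_derivative D s) (at s within I)"
proof -
  have *: "((snd c \<circ> q) has_vector_derivative D s) (at s within I)" if s: "s \<in> U \<inter> I" for s
  proof -
    have "\<forall>\<^sub>F r in nhds s. r \<in> I \<longrightarrow> y r = (snd c \<circ> q) r"
      unfolding eventually_nhds using q y chart(6)[OF assms(1)] s assms(2) by (intro exI[of _ U]) auto
    moreover have "y s = (snd c \<circ> q) s" using q y chart(6)[OF assms(1)] s by auto
    ultimately show ?thesis using has_vector_derivative_cong_ev d s by blast
  qed
  have **: "q s \<in> fst c" if "s \<in> U \<inter> I" for s using q[OF that] y[OF that] chart(7)[OF assms(1)] by simp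
  show "C1_near A I q t" unfolding C1_near_def
    by (intro bexI[OF _ assms(1)] exI[of _ U] exI[of _ D] conjI assms(2-4) ballI) (use * ** in blast)+
  show "s \<in> U \<inter> I \<Longrightarrow> ((snd c \<circ> q) has_vector_derivative D s) (at s within I)" by (rule *)
qed

text \<open>The curves live on the whole line and rest before \<open>s\<close> and after
  \<open>t\<close>, so concatenation produces no corners. Quantifying over all \<open>s < t\<close>
  makes the relation independent of the time available, which transitivity needs when it divides the
  time interval.\<close>

definition joinable :: "'q \<Rightarrow> 'q \<Rightarrow> bool" where
  "joinable p p' \<longleftrightarrow> (\<forall>s t. s < t \<longrightarrow> (\<exists>\<gamma>. (\<forall>\<tau>. C1_near A UNIV \<gamma> \<tau>) \<and>
     (\<forall>\<tau>\<le>s. \<gamma> \<tau> = p) \<and> (\<forall>\<tau>\<ge>t. \<gamma> \<tau> = p')))"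

lemma joinable_segment:
  assumes c: "c \<in> A" and p: "p \<in> fst c" "p' \<in> fst c" and seg: "closed_segment (snd c p) (snd c p') \<subseteq> snd c ` fst c"
  shows "joinable p p'"
  unfolding joinable_def
proof (intro allI impI)
  fix s t :: real assume "s < t"
  then obtain \<sigma> \<sigma>' where \<sigma>: "\<And>\<tau>. (\<sigma> has_real_derivative \<sigma>' \<tau>) (at \<tau>)" "continuous_on UNIV \<sigma>'"
    "\<And>\<tau>. \<tau> \<le> s \<Longrightarrow> \<sigma> \<tau> = 0" "\<And>\<tau>. t \<le> \<tau> \<Longrightarrow> \<sigma> \<tau> = 1" "\<And>\<tau>. 0 \<le> \<sigma> \<tau> \<and> \<sigma> \<tau> \<le> 1"
    using smooth_step by blast
  define y where "y \<tau> = snd c p + \<sigma> \<tau> *\<^sub>R (snd c p' - snd c p)" for \<tau>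
  define \<gamma> where "\<gamma> \<tau> = chart_inv c (y \<tau>)" for \<tau>
  have y: "y \<tau> \<in> snd c ` fst c" for \<tau>
    using \<sigma>(5)[of \<tau>] seg unfolding closed_segment_def y_def
    by (force simp: algebra_simps)
  have d: "(y has_vector_derivative \<sigma>' \<tau> *\<^sub>R (snd c p' - snd c p)) (at \<tau>)" for \<tau>
  proof -
    have "((\<lambda>\<tau>. \<sigma> \<tau> *\<^sub>R (snd c p' - snd c p)) has_vector_derivative \<sigma>' \<tau> *\<^sub>R (snd c p' - snd c p)) (at \<tau>)"
      using has_vector_derivative_scaleR[OF \<sigma>(1) has_vector_derivative_const] by simp
    from has_vector_derivative_add[OF has_vector_derivative_const this]
    show ?thesis unfolding y_def by simp
  qed
  have "C1_near A UNIV \<gamma> \<tau>" for \<tau>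
    by (rule C1_near_chartI(1)[OF c open_UNIV, of _ _ "\<lambda>\<tau>. \<sigma>' \<tau> *\<^sub>R (snd c p' - snd c p)" y])
       (use y d \<gamma>_def \<sigma>(2) in \<open>auto intro!: continuous_intros\<close>)
  moreover have "\<gamma> \<tau> = p" if "\<tau> \<le> s" for \<tau>
    using \<sigma>(3)[OF that] chart(5)[OF c p(1)] by (simp add: \<gamma>_def y_def)
  moreover have "\<gamma> \<tau> = p'" if "t \<le> \<tau>" for \<tau>
    using \<sigma>(4)[OF that] chart(5)[OF c p(2)] by (simp add: \<gamma>_def y_def)
  ultimately show "\<exists>\<gamma>. (\<forall>\<tau>. C1_near A UNIV \<gamma> \<tau>) \<and> (\<forall>\<tau>\<le>s. \<gamma> \<tau> = p) \<and> (\<forall>\<tau>\<ge>t. \<gamma> \<tau> = p')" by blast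
qed

lemma joinable_trans:
  assumes "joinable p p'" "joinable p' p''"
  shows "joinable p p''"
  unfolding joinable_def
proof (intro allI impI)
  fix s t :: real assume st: "s < t"
  \<comment> \<open>The middle third is a pause at \<open>p'\<close>. Both curves agree there, so
    near every time the glued curve coincides with one of them.\<close>
  define s1 where "s1 = s + (t - s) / 3"
  define s2 where "s2 = s1 + (t - s) / 3"
  have o: "s < s1" "s1 < s2" "s2 < t" using st by (auto simp: s1_def s2_def field_simps)
  obtain \<gamma>1 where \<gamma>1: "\<And>\<tau>. C1_near A UNIV \<gamma>1 \<tau>" "\<And>\<tau>. \<tau> \<le> s \<Longrightarrow> \<gamma>1 \<tau> = p" "\<And>\<tau>. s1 \<le> \<tau> \<Longrightarrow> \<gamma>1 \<tau> = p'"
    using assms(1) o(1) unfolding joinable_def by blast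
  obtain \<gamma>2 where \<gamma>2: "\<And>\<tau>. C1_near A UNIV \<gamma>2 \<tau>" "\<And>\<tau>. \<tau> \<le> s2 \<Longrightarrow> \<gamma>2 \<tau> = p'" "\<And>\<tau>. t \<le> \<tau> \<Longrightarrow> \<gamma>2 \<tau> = p''"
    using assms(2) o(3) unfolding joinable_def by blast
  define \<gamma> where "\<gamma> \<tau> = (if \<tau> \<le> s1 then \<gamma>1 \<tau> else \<gamma>2 \<tau>)" for \<tau>
  have "C1_near A UNIV \<gamma> \<tau>" for \<tau>
  proof (cases "\<tau> < s2")
    case True
    show ?thesis
      by (rule C1_near_cong[OF \<gamma>1(1), of _ "{..<s2}"]) (use True \<gamma>1(3) \<gamma>2(2) in \<open>auto simp: \<gamma>_def\<close>)
  next
    case False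
    show ?thesis
      by (rule C1_near_cong[OF \<gamma>2(1), of _ "{s1<..}"]) (use False o in \<open>auto simp: \<gamma>_def\<close>)
  qed
  moreover have "\<gamma> \<tau> = p" if "\<tau> \<le> s" for \<tau> using \<gamma>1(2) that o by (auto simp: \<gamma>_def)
  moreover have "\<gamma> \<tau> = p''" if "t \<le> \<tau>" for \<tau> using \<gamma>2(3) that o by (auto simp: \<gamma>_def)
  ultimately show "\<exists>\<gamma>. (\<forall>\<tau>. C1_near A UNIV \<gamma> \<tau>) \<and> (\<forall>\<tau>\<le>s. \<gamma> \<tau> = p) \<and> (\<forall>\<tau>\<ge>t. \<gamma> \<tau> = p'')" by blast
qed

text \<open>Points near \<open>p\<close> are reached by segments inside a coordinate ball, so the
  classes of the relation are open, and connectedness leaves only one. Symmetry is built into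
  \<open>R\<close>, in place of a reversal of time.\<close>

lemma all_joinable:
  assumes "connected (UNIV :: 'q set)"
  shows "joinable p p'"
proof -
  define R where "R p p' \<longleftrightarrow> joinable p p' \<and> joinable p' p" for p p'
  have "R p p'"
  proof (rule connected_equivalence_relation[OF assms])
    show "R x y \<Longrightarrow> R y x" for x y by (simp add: R_def)
    show "R x y \<Longrightarrow> R y z \<Longrightarrow> R x z" for x y z unfolding R_def using joinable_trans by blast
    fix p
    obtain c where c: "c \<in> A" "p \<in> fst c" by (rule chart_cover)
    obtain e where e: "e > 0" "ball (snd c p) e \<subseteq> snd c ` fst c"
      using open_contains_ball chart(2)[OF c(1)] c(2) by blast
    define W where "W = fst c \<inter> snd c -` ball (snd c p) e"
    have "open W" unfolding W_def by (rule continuous_open_preimage[OF chart(3,1)[OF c(1)]]) simp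
    moreover have "p \<in> W" using c e by (simp add: W_def)
    moreover have "R p z" if z: "z \<in> W" for z
    proof -
      have "closed_segment (snd c p) (snd c z) \<subseteq> ball (snd c p) e"
        using z e by (intro closed_segment_subset) (auto simp: W_def)
      then have "closed_segment (snd c p) (snd c z) \<subseteq> snd c ` fst c" using e by blast
      then show ?thesis
        using joinable_segment[OF c(1)] c(2) z unfolding R_def W_def
        by (metis IntD1 closed_segment_commute)
    qed
    ultimately show "\<exists>T. openin (top_of_set UNIV) T \<and> p \<in> T \<and> (\<forall>x\<in>T. R p x)"
      by (intro exI[of _ W]) simp
  qed auto
  then show ?thesis by (simp add: R_def)
qed

lemma C1_curves_nonempty:
  assumes "connected (UNIV :: 'q set)" "fst e0 < fst e1"
  shows "C1_curves A e0 e1 \<noteq> {}"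
proof -
  obtain \<gamma> where \<gamma>: "\<And>\<tau>. C1_near A UNIV \<gamma> \<tau>" "\<And>\<tau>. \<tau> \<le> fst e0 \<Longrightarrow> \<gamma> \<tau> = snd e0"
    "\<And>\<tau>. fst e1 \<le> \<tau> \<Longrightarrow> \<gamma> \<tau> = snd e1"
    using all_joinable[OF assms(1), of "snd e0" "snd e1"] assms(2) unfolding joinable_def by blast
  have "C1_curve A (fst e0) (fst e1) \<gamma>"
    by (rule C1_curveI[OF assms(2) C1_near_subset[OF \<gamma>(1)]]) simp
  then have "\<gamma> \<in> C1_curves A e0 e1" using \<gamma> by (simp add: C1_curves_def)
  then show ?thesis by blast
qed

text \<open>Carries a variation in coordinates over to the manifold. The conditions on
  \<open>h\<close> and \<open>h'\<close> at \<alpha> and \<beta> make the extension by zero C^1, so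
  the result is a competitor on the full time interval with the same end points.\<close>

lemma perturbed_curve:
  assumes "t0 < t1" and q: "C1_curve A t0 t1 q" and I: "t0 \<le> \<alpha>" "\<alpha> < \<beta>" "\<beta> \<le> t1"
    and c: "c \<in> A" "\<And>t. t \<in> {\<alpha>..\<beta>} \<Longrightarrow> q t \<in> fst c"
    and h: "\<And>t. t \<in> {\<alpha>..\<beta>} \<Longrightarrow> (h has_vector_derivative h' t) (at t within {\<alpha>..\<beta>})"
      "continuous_on {\<alpha>..\<beta>} h'" "h \<alpha> = 0" "h \<beta> = 0" "h' \<alpha> = 0" "h' \<beta> = 0"
    and xh: "\<And>t. t \<in> {\<alpha>..\<beta>} \<Longrightarrow> snd c (q t) + h t \<in> snd c ` fst c"
  obtains q' where "C1_curve A t0 t1 q'" "\<And>t. t \<notin> {\<alpha><..<\<beta>} \<Longrightarrow> q' t = q t"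
    "\<And>t. t \<in> {\<alpha>..\<beta>} \<Longrightarrow> q' t \<in> fst c \<and> snd c (q' t) = snd c (q t) + h t"
    "\<And>t v. t \<in> {\<alpha>..\<beta>} \<Longrightarrow> ((snd c \<circ> q) has_vector_derivative v) (at t within {t0..t1}) \<Longrightarrow>
       ((snd c \<circ> q') has_vector_derivative v + h' t) (at t within {t0..t1})"
    "\<And>t. t \<in> {t0..t1} - {\<alpha>..\<beta>} \<Longrightarrow> velocity A t0 t1 q' t = velocity A t0 t1 q t"
proof -
  define H where "H t = (if t \<in> {\<alpha>..\<beta>} then h t else 0)" for t
  define H' where "H' t = (if t \<in> {\<alpha>..\<beta>} then h' t else 0)" for t
  have H: "(H has_vector_derivative H' t) (at t)" and H'c: "continuous_on UNIV H'" for t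
    using extend_by_zero[OF I(2) h] unfolding H_def H'_def by auto
  have Hc: "continuous_on UNIV H"
    using H by (auto intro!: continuous_at_imp_continuous_on dest: has_vector_derivative_continuous)
  define q' where "q' t = (if t \<in> {\<alpha>..\<beta>} then chart_inv c (snd c (q t) + h t) else q t)" for t
  have off: "q' t = q t" if "t \<notin> {\<alpha><..<\<beta>}" for t
  proof (cases "t \<in> {\<alpha>..\<beta>}")
    case True
    then have "t = \<alpha> \<or> t = \<beta>" using that by auto
    then show ?thesis using True h(3,4) chart(5)[OF c(1) c(2)[OF True]] by (auto simp: q'_def)
  qed (auto simp: q'_def)
  have on: "q' t \<in> fst c \<and> snd c (q' t) = snd c (q t) + h t" if "t \<in> {\<alpha>..\<beta>}" for t
    using that xh[OF that] chart(6,7)[OF c(1)] by (simp add: q'_def)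
  have near: "C1_near A {t0..t1} q' t \<and> (((snd c \<circ> q) has_vector_derivative v) (at t within {t0..t1}) \<longrightarrow>
       ((snd c \<circ> q') has_vector_derivative v + h' t) (at t within {t0..t1}))" if t: "t \<in> {\<alpha>..\<beta>}" for t v
  proof -
    have tI: "t \<in> {t0..t1}" using t I by auto
    obtain U D where U: "open U" "t \<in> U" and D: "continuous_on (U \<inter> {t0..t1}) D"
      and qU: "\<And>s. s \<in> U \<inter> {t0..t1} \<Longrightarrow> q s \<in> fst c"
      and d: "\<And>s. s \<in> U \<inter> {t0..t1} \<Longrightarrow> ((snd c \<circ> q) has_vector_derivative D s) (at s within {t0..t1})"
      by (rule C1_nearE[OF C1_curveD[OF q tI] tI c(1) c(2)[OF t]]) blast
    \<comment> \<open>With the extension \<open>H\<close> instead of \<open>h\<close>, a single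
      coordinate formula describes \<open>q'\<close> on both sides of \<alpha> and \<beta>, and
      differentiability at these times needs no separate argument.\<close>
    define y where "y s = snd c (q s) + H s" for s
    have yc: "continuous_on (U \<inter> {t0..t1}) y"
      unfolding y_def
    proof (intro continuous_on_add)
      show "continuous_on (U \<inter> {t0..t1}) (\<lambda>s. snd c (q s))"
        unfolding continuous_on_eq_continuous_within
      proof
        fix s assume "s \<in> U \<inter> {t0..t1}"
        then have "continuous (at s within {t0..t1}) (snd c \<circ> q)" using d has_vector_derivative_continuous by blast
        then show "continuous (at s within U \<inter> {t0..t1}) (\<lambda>s. snd c (q s))"
          unfolding o_def by (rule continuous_within_subset) auto
      qed
    qed (rule continuous_on_subset[OF Hc], simp)
    obtain W where W: "open W" "(U \<inter> {t0..t1}) \<inter> y -` (snd c ` fst c) = (U \<inter> {t0..t1}) \<inter> W"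
      using continuous_openin_preimage_gen[OF yc chart(2)[OF c(1)]] unfolding openin_open by blast
    have tW: "t \<in> U \<inter> W"
    proof -
      have "y t \<in> snd c ` fst c" using xh[OF t] t by (simp add: y_def H_def)
      then have "t \<in> (U \<inter> {t0..t1}) \<inter> y -` (snd c ` fst c)" using U tI by blast
      then show ?thesis unfolding W(2) by blast
    qed
    have yW: "y s \<in> snd c ` fst c" if "s \<in> (U \<inter> W) \<inter> {t0..t1}" for s
    proof -
      have "s \<in> (U \<inter> {t0..t1}) \<inter> W" using that by blast
      then show ?thesis unfolding W(2)[symmetric] by blast
    qed
    have q'y: "q' s = chart_inv c (y s)" if "s \<in> (U \<inter> W) \<inter> {t0..t1}" for s
      using qU[of s] that chart(5)[OF c(1)] by (auto simp: q'_def y_def H_def)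
    have dy: "(y has_vector_derivative D s + H' s) (at s within {t0..t1})" if "s \<in> (U \<inter> W) \<inter> {t0..t1}" for s
      unfolding y_def using has_vector_derivative_add[OF d[of s] has_vector_derivative_at_within[OF H[of s]]] that
      by (auto simp: o_def)
    have Dc: "continuous_on ((U \<inter> W) \<inter> {t0..t1}) (\<lambda>s. D s + H' s)"
      by (intro continuous_on_add continuous_on_subset[OF D] continuous_on_subset[OF H'c]) auto
    note * = C1_near_chartI[OF c(1) open_Int[OF U(1) W(1)] tW Dc yW dy q'y]
    have "D t = v" if "((snd c \<circ> q) has_vector_derivative v) (at t within {t0..t1})"
      using vector_derivative_within_closed_interval[OF assms(1) tI] that d[of t] U(2) tI by (metis IntI)
    then show ?thesis using *(1) *(2)[of t] tW tI t by (auto simp: H'_def)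
  qed
  have near2: "C1_near A {t0..t1} q' t" if t: "t \<in> {t0..t1}" for t
  proof (cases "t \<in> {\<alpha>..\<beta>}")
    case False
    show ?thesis
      by (rule C1_near_cong[OF C1_curveD[OF q t] t, of "- {\<alpha>..\<beta>}"]) (use False in \<open>auto simp: q'_def\<close>)
  qed (use near in blast)
  have C1: "C1_curve A t0 t1 q'" by (rule C1_curveI[OF assms(1) near2])
  have vel: "velocity A t0 t1 q' t = velocity A t0 t1 q t" if t: "t \<in> {t0..t1} - {\<alpha>..\<beta>}" for t
  proof -
    have q't: "q' t = q t" using t by (auto simp: q'_def)
    obtain c1 where c1: "c1 \<in> A" "q t \<in> fst c1" by (rule chart_cover)
    obtain U D where U: "t \<in> U"
      and d: "\<And>s. s \<in> U \<inter> {t0..t1} \<Longrightarrow> ((snd c1 \<circ> q) has_vector_derivative D s) (at s within {t0..t1})"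
      by (rule C1_nearE[OF C1_curveD[OF q, of t] _ c1]) (use t in auto)
    have d1: "((snd c1 \<circ> q) has_vector_derivative D t) (at t within {t0..t1})" using d t U by blast
    have "\<forall>\<^sub>F r in nhds t. r \<in> {t0..t1} \<longrightarrow> (snd c1 \<circ> q) r = (snd c1 \<circ> q') r"
      unfolding eventually_nhds by (rule exI[of _ "- {\<alpha>..\<beta>}"]) (use t in \<open>auto simp: q'_def\<close>)
    then have d2: "((snd c1 \<circ> q') has_vector_derivative D t) (at t within {t0..t1})"
      using has_vector_derivative_cong_ev[where x = t and S = "{t0..t1}" and f = "snd c1 \<circ> q" and g = "snd c1 \<circ> q'"] d1 q't by simp
    show ?thesis
      using velocity_eq_coord_vec[OF assms(1) q _ c1 d1] velocity_eq_coord_vec[OF assms(1) C1 _ c1(1) _ d2] t c1 q't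
      by simp
  qed
  show ?thesis by (rule that[OF C1 off on _ vel]) (use near in blast)+
qed

end


section \<open>Lagrangians on manifolds\<close>

lemma finite_uniform_bound:
  fixes P :: "'a \<Rightarrow> real \<Rightarrow> bool"
  assumes "finite N" "\<And>x. x \<in> N \<Longrightarrow> \<exists>C. P x C" "\<And>x C C'. P x C \<Longrightarrow> C \<le> C' \<Longrightarrow> P x C'"
  shows "\<exists>C. \<forall>x\<in>N. P x C"
  using assms(1,2)
proof (induction N)
  case (insert z N)
  then obtain C where C: "\<forall>x\<in>N. P x C" by auto
  obtain C' where C': "P z C'" using insert.prems by auto
  have "P x (max C C')" if "x \<in> insert z N" for x
    using that C C' assms(3)[of _ C "max C C'"] assms(3)[of _ C' "max C C'"] by auto
  then show ?case by blast
qed simp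

locale lagrangian_system = C1_atlas A for A :: "('q::t2_space, 'e::euclidean_space) chart set" +
  fixes T :: "real set" and a :: "real \<Rightarrow> 'q \<Rightarrow> ('q, 'e) tvec \<Rightarrow> ('q, 'e) tvec \<Rightarrow> real"
    and b :: "real \<Rightarrow> 'q \<Rightarrow> ('q, 'e) tvec \<Rightarrow> real" and V :: "real \<Rightarrow> 'q \<Rightarrow> real"
  assumes metric: "Cr_riemannian_metric 2 A T a"
    and one_form: "Cr_one_form 2 A T b"
    and potential: "Cr_function 2 A T V"
begin

definition coord_lag :: "('q, 'e) chart \<Rightarrow> real \<Rightarrow> 'e \<Rightarrow> 'e \<Rightarrow> real" where
  "coord_lag c t x v = lagrangian a b V t (chart_inv c x) (coord_vec A c (chart_inv c x) v)"

definition lag_along :: "real \<Rightarrow> real \<Rightarrow> (real \<Rightarrow> 'q) \<Rightarrow> real \<Rightarrow> real" where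
  "lag_along t0 t1 q t = lagrangian a b V t (q t) (velocity A t0 t1 q t)"

text \<open>Over a chart \<open>coord_vec\<close> identifies the tangent spaces with the model
  space: it is linear by \<open>coord_vec_lincomb\<close> and injective because its value at
  \<open>c\<close> is the vector itself. So the metric becomes a positive definite symmetric form
  and the 1-form a linear one.\<close>

lemma chart_variational:
  assumes c: "c \<in> A" and cpt: "compact J" "compact B" "convex B" and sub: "J \<subseteq> T" "B \<subseteq> snd c ` fst c"
  obtains Lx Lv \<kappa> k C where "variational J B (coord_lag c) Lx Lv \<kappa>" "k > 0"
    "\<And>t x v. \<lbrakk>t \<in> J; x \<in> B\<rbrakk> \<Longrightarrow> k * (1 + norm v)\<^sup>2 - C \<le> coord_lag c t x v"
proof -
  define cv where "cv x v = coord_vec A c (chart_inv c x) v" for x v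
  define g where "g t x v w = a t (chart_inv c x) (cv x v) (cv x w)" for t x v w
  define \<beta> where "\<beta> t x v = b t (chart_inv c x) (cv x v)" for t x v
  have L: "coord_lag c = (\<lambda>t x v. 1/2 * g t x v v + \<beta> t x v - V t (chart_inv c x))"
    by (simp add: coord_lag_def lagrangian_def g_def \<beta>_def cv_def fun_eq_iff)
  have inv: "chart_inv c x \<in> fst c" if "x \<in> B" for x using chart(7)[OF c] sub(2) that by blast
  have cvt: "cv x v \<in> tangent_space A (chart_inv c x)" if "x \<in> B" for x v
    unfolding cv_def by (rule coord_vec_tangent[OF c inv[OF that]])
  have cv_add: "cv x (v + w) = lincomb 1 (cv x v) 1 (cv x w)" if "x \<in> B" for x v w
    using coord_vec_lincomb[OF c inv[OF that], of 1 v 1 w] by (simp add: cv_def)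
  have cv_scale: "cv x (s *\<^sub>R v) = lincomb s (cv x v) 0 (cv x v)" if "x \<in> B" for x v s
    using coord_vec_lincomb[OF c inv[OF that], of s v 0 v] by (simp add: cv_def)
  have m: "\<And>t p \<xi> \<eta>. \<lbrakk>t \<in> T; \<xi> \<in> tangent_space A p; \<eta> \<in> tangent_space A p\<rbrakk> \<Longrightarrow> a t p \<xi> \<eta> = a t p \<eta> \<xi>"
    "\<And>t p \<xi> \<eta> \<zeta> s u. \<lbrakk>t \<in> T; \<xi> \<in> tangent_space A p; \<eta> \<in> tangent_space A p; \<zeta> \<in> tangent_space A p\<rbrakk> \<Longrightarrow>
        a t p (lincomb s \<xi> u \<eta>) \<zeta> = s * a t p \<xi> \<zeta> + u * a t p \<eta> \<zeta>"
    "\<And>t p \<xi>. \<lbrakk>t \<in> T; \<xi> \<in> tangent_space A p; \<xi> \<noteq> (\<lambda>c. 0)\<rbrakk> \<Longrightarrow> a t p \<xi> \<xi> > 0"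
    using metric unfolding Cr_riemannian_metric_def by blast+
  have f: "\<And>t p \<xi> \<eta> s u. \<lbrakk>t \<in> T; \<xi> \<in> tangent_space A p; \<eta> \<in> tangent_space A p\<rbrakk> \<Longrightarrow>
        b t p (lincomb s \<xi> u \<eta>) = s * b t p \<xi> + u * b t p \<eta>"
    using one_form unfolding Cr_one_form_def by blast
  have symm: "g t x v w = g t x w v" if "t \<in> J" "x \<in> B" for t x v w
    unfolding g_def by (rule m(1)) (use that sub cvt in auto)
  have lin1: "linear (\<lambda>v. g t x v w)" if t: "t \<in> J" and x: "x \<in> B" for t x w
  proof (rule linearI)
    have "t \<in> T" using t sub by blast
    note m2 = m(2)[OF this cvt[OF x] cvt[OF x] cvt[OF x]]
    show "g t x (v + v') w = g t x v w + g t x v' w" for v v'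
      unfolding g_def cv_add[OF x] m2 by simp
    show "g t x (s *\<^sub>R v) w = s *\<^sub>R g t x v w" for s v
      unfolding g_def cv_scale[OF x] m2 by simp
  qed
  have sub2: "J \<times> B \<subseteq> T \<times> snd c ` fst c" using sub by blast
  show ?thesis
  proof (rule quadratic_lagrangian[of J B "T \<times> snd c ` fst c" g \<beta> "\<lambda>t x. V t (chart_inv c x)", OF cpt sub2])
    show "bilinear (g t x)" if t: "t \<in> J" "x \<in> B" for t x
      unfolding bilinear_def
    proof (intro conjI allI)
      show "linear (\<lambda>v. g t x v w)" for w by (rule lin1[OF t])
      show "linear (g t x v)" for v
      proof -
        have "g t x v = (\<lambda>w. g t x w v)" using symm[OF t, of v] by auto
        then show ?thesis using lin1[OF t, of v] by simp
      qed
    qed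
    show "g t x v w = g t x w v" if "t \<in> J" "x \<in> B" for t x v w by (rule symm[OF that])
    show "g t x v v > 0" if t: "t \<in> J" "x \<in> B" "v \<noteq> 0" for t x v
    proof -
      have "cv x v c = v" unfolding cv_def by (rule coord_vec_same[OF c inv[OF t(2)]])
      then have "cv x v \<noteq> (\<lambda>c. 0)" using t(3) by (metis)
      then show ?thesis unfolding g_def using t sub cvt[OF t(2)] by (intro m(3)) auto
    qed
    show "linear (\<beta> t x)" if t: "t \<in> J" and x: "x \<in> B" for t x
    proof (rule linearI)
      have "t \<in> T" using t sub by blast
      note f2 = f[OF this cvt[OF x] cvt[OF x]]
      show "\<beta> t x (v + w) = \<beta> t x v + \<beta> t x w" for v w unfolding \<beta>_def cv_add[OF x] f2 by simp
      show "\<beta> t x (s *\<^sub>R v) = s *\<^sub>R \<beta> t x v" for s v unfolding \<beta>_def cv_scale[OF x] f2 by simp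
    qed
    show "Ck_on 2 (\<lambda>(t, x). g t x v w) (T \<times> snd c ` fst c)" for v w
      using metric c unfolding Cr_riemannian_metric_def Let_def g_def cv_def by blast
    show "Ck_on 2 (\<lambda>(t, x). \<beta> t x v) (T \<times> snd c ` fst c)" for v
      using one_form c unfolding Cr_one_form_def Let_def \<beta>_def cv_def by blast
    show "Ck_on 2 (\<lambda>(t, x). V t (chart_inv c x)) (T \<times> snd c ` fst c)"
      using potential c unfolding Cr_function_def by blast
  next
    fix Lx Lv \<kappa> k C
    assume "variational J B (\<lambda>t x v. 1/2 * g t x v v + \<beta> t x v - V t (chart_inv c x)) Lx Lv \<kappa>" "k > 0"
      "\<And>t x v. \<lbrakk>t \<in> J; x \<in> B\<rbrakk> \<Longrightarrow> k * (1 + norm v)\<^sup>2 - C \<le> 1/2 * g t x v v + \<beta> t x v - V t (chart_inv c x)"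
    then show thesis using that[of Lx Lv \<kappa> k C] unfolding L by blast
  qed
qed

lemma lagrangian_coord_vec:
  "c \<in> A \<Longrightarrow> p \<in> fst c \<Longrightarrow> lagrangian a b V t p (coord_vec A c p v) = coord_lag c t (snd c p) v"
  by (simp add: coord_lag_def chart(5))

lemma lag_along_eq:
  assumes "t0 < t1" "C1_curve A t0 t1 q" "t \<in> {t0..t1}" "c \<in> A" "q t \<in> fst c"
    "((snd c \<circ> q) has_vector_derivative w) (at t within {t0..t1})"
  shows "lag_along t0 t1 q t = coord_lag c t (snd c (q t)) w"
  unfolding lag_along_def velocity_eq_coord_vec[OF assms] by (rule lagrangian_coord_vec[OF assms(4,5)])

text \<open>Makes the action the integral of a continuous function. The claim is local: near each
  time the coordinates and their derivative are continuous, and the coordinate Lagrangian is jointly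
  continuous in its arguments.\<close>

lemma lag_along_continuous:
  assumes "t0 < t1" and q: "C1_curve A t0 t1 q" and T: "{t0..t1} \<subseteq> T"
  shows "continuous_on {t0..t1} (lag_along t0 t1 q)"
  unfolding continuous_on_eq_continuous_within
proof
  fix t assume t: "t \<in> {t0..t1}"
  obtain c where c: "c \<in> A" "q t \<in> fst c" by (rule chart_cover)
  obtain e where e: "e > 0" "cball (snd c (q t)) e \<subseteq> snd c ` fst c"
    using open_contains_cball chart(2)[OF c(1)] c(2) by blast
  obtain Lx Lv \<kappa> k C where "variational {t0..t1} (cball (snd c (q t)) e) (coord_lag c) Lx Lv \<kappa>"
    by (rule chart_variational[OF c(1) compact_Icc compact_cball convex_cball T e(2)])
  then have tame: "tame {t0..t1} (cball (snd c (q t)) e) (coord_lag c) Lx Lv"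
    by (simp add: variational_def)
  have qc: "continuous_on {t0..t1} q" using q by (simp add: C1_curve_def)
  have "open (fst c \<inter> snd c -` ball (snd c (q t)) e)"
    by (rule continuous_open_preimage[OF chart(3,1)[OF c(1)]]) simp
  then obtain W where W: "open W" "{t0..t1} \<inter> q -` (fst c \<inter> snd c -` ball (snd c (q t)) e) = {t0..t1} \<inter> W"
    using continuous_openin_preimage_gen[OF qc] unfolding openin_open by blast
  have tW: "t \<in> W"
  proof -
    have "t \<in> {t0..t1} \<inter> q -` (fst c \<inter> snd c -` ball (snd c (q t)) e)" using t c e by simp
    then show ?thesis unfolding W(2) by blast
  qed
  have qW: "q s \<in> fst c \<and> snd c (q s) \<in> ball (snd c (q t)) e" if "s \<in> W \<inter> {t0..t1}" for s
  proof -
    have "s \<in> {t0..t1} \<inter> W" using that by blast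
    then show ?thesis unfolding W(2)[symmetric] by blast
  qed
  obtain v where v: "continuous_on (W \<inter> {t0..t1}) v"
    "\<And>t. t \<in> W \<inter> {t0..t1} \<Longrightarrow> ((snd c \<circ> q) has_vector_derivative v t) (at t within {t0..t1})"
    by (rule C1_curve_coordinates[OF assms(1) q c(1), of "W \<inter> {t0..t1}"]) (use qW in auto)
  have xc: "continuous_on (W \<inter> {t0..t1}) (\<lambda>s. snd c (q s))"
    by (rule continuous_on_compose2[OF chart(3)[OF c(1)] continuous_on_subset[OF qc]]) (use qW in auto)
  have "continuous_on (W \<inter> {t0..t1}) (\<lambda>s. coord_lag c s (snd c (q s)) (v s))"
    by (rule tame_continuous(1)[OF tame _ xc v(1)]) (use qW ball_subset_cball in blast)+
  then have "continuous_on (W \<inter> {t0..t1}) (lag_along t0 t1 q)"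
  proof (rule continuous_on_eq)
    fix s assume s: "s \<in> W \<inter> {t0..t1}"
    then show "coord_lag c s (snd c (q s)) (v s) = lag_along t0 t1 q s"
      using lag_along_eq[OF assms(1) q _ c(1) _ v(2)[OF s]] qW[OF s] by simp
  qed
  then show "continuous (at t within {t0..t1}) (lag_along t0 t1 q)"
    by (rule continuous_within_openin) (use W tW t in auto)
qed

section \<open>Uniform estimates for curves in a compact set\<close>

lemma velocity_tangent:
  assumes "t0 < t1" "C1_curve A t0 t1 q" "t \<in> {t0..t1}"
  shows "velocity A t0 t1 q t \<in> tangent_space A (q t)"
proof -
  obtain c where c: "c \<in> A" "q t \<in> fst c" by (rule chart_cover)
  obtain v where "velocity A t0 t1 q t = coord_vec A c (q t) (v t)"
    by (rule C1_curve_coordinates[OF assms(1,2) c(1), of "{t}"]) (use c assms in auto)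
  then show ?thesis using coord_vec_tangent[OF c] by simp
qed

text \<open>The radii serve three purposes: a curve is caught within \<open>R\<close> of the centre,
  stays within \<open>2 * R\<close> for a short time, and may then be varied by \<open>R\<close>
  without leaving the chart.\<close>

lemma finite_chart_cover:
  assumes "compact K"
  obtains N :: "(('q, 'e) chart \<times> 'e \<times> real) set" where "finite N"
    "\<And>c y R. (c, y, R) \<in> N \<Longrightarrow> c \<in> A \<and> R > 0 \<and> cball y (3 * R) \<subseteq> snd c ` fst c"
    "\<And>p. p \<in> K \<Longrightarrow> \<exists>c y R. (c, y, R) \<in> N \<and> p \<in> fst c \<and> dist (snd c p) y < R"
proof -
  have "\<exists>c R. c \<in> A \<and> p \<in> fst c \<and> R > 0 \<and> cball (snd c p) (3 * R) \<subseteq> snd c ` fst c" for p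
  proof -
    obtain c where c: "c \<in> A" "p \<in> fst c" by (rule chart_cover)
    obtain e where "e > 0" "cball (snd c p) e \<subseteq> snd c ` fst c"
      using open_contains_cball chart(2)[OF c(1)] c(2) by blast
    then show ?thesis using c by (intro exI[of _ c] exI[of _ "e / 3"]) auto
  qed
  then obtain C R where CR: "\<And>p. C p \<in> A" "\<And>p. p \<in> fst (C p)" "\<And>p. R p > 0"
    "\<And>p. cball (snd (C p) p) (3 * R p) \<subseteq> snd (C p) ` fst (C p)" by metis
  define W where "W p = fst (C p) \<inter> snd (C p) -` ball (snd (C p) p) (R p)" for p
  have "open (W p)" for p
    unfolding W_def by (rule continuous_open_preimage[OF chart(3,1)[OF CR(1)]]) simp
  moreover have "K \<subseteq> (\<Union>p\<in>K. W p)" using CR by (auto simp: W_def)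
  ultimately obtain P where P: "P \<subseteq> K" "finite P" "K \<subseteq> (\<Union>p\<in>P. W p)"
    using compactE_image[OF assms, of K W] by auto
  show ?thesis
  proof (rule that[of "(\<lambda>p. (C p, snd (C p) p, R p)) ` P"])
    show "finite ((\<lambda>p. (C p, snd (C p) p, R p)) ` P)" using P by simp
    show "c \<in> A \<and> r > 0 \<and> cball y (3 * r) \<subseteq> snd c ` fst c"
      if in_P: "(c, y, r) \<in> (\<lambda>p. (C p, snd (C p) p, R p)) ` P" for c y r
    proof -
      obtain p where "c = C p" "y = snd (C p) p" "r = R p" using in_P by auto
      then show ?thesis using CR by simp
    qed
    fix z assume "z \<in> K"
    then obtain p where "p \<in> P" "z \<in> W p" using P by auto
    then show "\<exists>c y r. (c, y, r) \<in> (\<lambda>p. (C p, snd (C p) p, R p)) ` P \<and> z \<in> fst c \<and> dist (snd c z) y < r"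
      by (intro exI[of _ "C p"] exI[of _ "snd (C p) p"] exI[of _ "R p"]) (auto simp: W_def dist_commute)
  qed
qed

text \<open>In each of finitely many coordinate balls the growth bound leaves a constant once its
  nonnegative quadratic term is dropped. As it holds for all velocities at once, it serves both for
  the finiteness of the infimum and for the energy estimates.\<close>

lemma lagrangian_bounded_below:
  assumes "compact K" and T: "{t0..t1} \<subseteq> T"
  obtains C where "C \<ge> 0" "\<And>t p \<xi>. \<lbrakk>t \<in> {t0..t1}; p \<in> K; \<xi> \<in> tangent_space A p\<rbrakk> \<Longrightarrow> - C \<le> lagrangian a b V t p \<xi>"
proof -
  obtain N :: "(('q, 'e) chart \<times> 'e \<times> real) set" where N: "finite N"
    "\<And>c y R. (c, y, R) \<in> N \<Longrightarrow> c \<in> A \<and> R > 0 \<and> cball y (3 * R) \<subseteq> snd c ` fst c"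
    "\<And>p. p \<in> K \<Longrightarrow> \<exists>c y R. (c, y, R) \<in> N \<and> p \<in> fst c \<and> dist (snd c p) y < R"
    by (rule finite_chart_cover[OF assms(1)]) (rule that, assumption+)
  define P where "P z C \<longleftrightarrow> (\<forall>t\<in>{t0..t1}. \<forall>x\<in>cball (fst (snd z)) (snd (snd z)). \<forall>v. - C \<le> coord_lag (fst z) t x v)"
    for z :: "('q, 'e) chart \<times> 'e \<times> real" and C
  have "\<exists>C. \<forall>z\<in>N. P z C"
  proof (rule finite_uniform_bound[OF N(1)])
    fix z assume z: "z \<in> N"
    obtain c y R where zc: "z = (c, y, R)" by (cases z) auto
    have c: "c \<in> A" "R > 0" "cball y (3 * R) \<subseteq> snd c ` fst c" using N(2) z unfolding zc by auto
    have "cball y R \<subseteq> cball y (3 * R)" using c(2) by auto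
    then have sub: "cball y R \<subseteq> snd c ` fst c" using c(3) by blast
    obtain Lx Lv \<kappa> k C where kC: "k > 0"
      "\<And>t x v. \<lbrakk>t \<in> {t0..t1}; x \<in> cball y R\<rbrakk> \<Longrightarrow> k * (1 + norm v)\<^sup>2 - C \<le> coord_lag c t x v"
      by (rule chart_variational[OF c(1) compact_Icc compact_cball convex_cball T sub]) blast
    have "- C \<le> coord_lag c t x v" if "t \<in> {t0..t1}" "x \<in> cball y R" for t x v
    proof -
      have "0 \<le> k * (1 + norm v)\<^sup>2" using kC(1) by simp
      then show ?thesis using kC(2)[OF that, of v] by linarith
    qed
    then have "P z C" unfolding P_def zc by auto
    then show "\<exists>C. P z C" ..
  next
    fix z C C' assume "P z C" "(C::real) \<le> C'"
    then show "P z C'" unfolding P_def by (meson neg_le_iff_le order_trans)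
  qed
  then obtain C where C: "\<forall>z\<in>N. P z C" by blast
  show ?thesis
  proof (rule that[of "max C 0"])
    fix t p \<xi> assume t: "t \<in> {t0..t1}" and p: "p \<in> K" and \<xi>: "\<xi> \<in> tangent_space A p"
    obtain c y R where cyR: "(c, y, R) \<in> N" "p \<in> fst c" "dist (snd c p) y < R" using N(3)[OF p] by blast
    have c: "c \<in> A" using N(2)[OF cyR(1)] by blast
    have "lagrangian a b V t p \<xi> = coord_lag c t (snd c p) (\<xi> c)"
      using lagrangian_coord_vec[OF c cyR(2)] tangent_eq_coord_vec[OF \<xi> c cyR(2)] by metis
    moreover have "- C \<le> coord_lag c t (snd c p) (\<xi> c)"
      using C cyR t unfolding P_def by (force simp: dist_commute)
    ultimately show "- max C 0 \<le> lagrangian a b V t p \<xi>" by linarith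
  qed simp
qed

text \<open>Adding \<open>D\<close> makes the Lagrangian along the curve nonnegative, so the action
  over a part of the interval is controlled by the whole; in the chart the bound
  \<open>k * (1 + norm v)\<^sup>2 - C\<close> then turns action into energy.\<close>

lemma energy_bound:
  assumes "t0 < t1" and T: "{t0..t1} \<subseteq> T" and K: "compact K"
    and c: "c \<in> A" and B: "compact B" "convex B" "B \<subseteq> snd c ` fst c"
  obtains E where "E \<ge> 0"
    "\<And>q v \<alpha> \<beta>. \<lbrakk>C1_curve A t0 t1 q; q ` {t0..t1} \<subseteq> K; integral {t0..t1} (lag_along t0 t1 q) \<le> Mb;
       t0 \<le> \<alpha>; \<alpha> \<le> \<beta>; \<beta> \<le> t1; \<forall>t\<in>{\<alpha>..\<beta>}. q t \<in> fst c \<and> snd c (q t) \<in> B;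
       continuous_on {\<alpha>..\<beta>} v;
       \<forall>t\<in>{\<alpha>..\<beta>}. ((snd c \<circ> q) has_vector_derivative v t) (at t within {t0..t1})\<rbrakk>
     \<Longrightarrow> integral {\<alpha>..\<beta>} (\<lambda>t. (1 + norm (v t))\<^sup>2) \<le> E"
proof -
  obtain Lx Lv \<kappa> k C where k: "k > 0"
    and kC: "\<And>t x v. \<lbrakk>t \<in> {t0..t1}; x \<in> B\<rbrakk> \<Longrightarrow> k * (1 + norm v)\<^sup>2 - C \<le> coord_lag c t x v"
    by (rule chart_variational[OF c compact_Icc B(1,2) T B(3)]) blast
  obtain D where D: "D \<ge> 0" "\<And>t p \<xi>. \<lbrakk>t \<in> {t0..t1}; p \<in> K; \<xi> \<in> tangent_space A p\<rbrakk> \<Longrightarrow> - D \<le> lagrangian a b V t p \<xi>"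
    by (rule lagrangian_bounded_below[OF K T]) (rule that, assumption+)
  define l where "l = t1 - t0"
  \<comment> \<open>The action bound plus the two shifts over the full length, divided by
    \<open>k\<close>. The sign of \<open>C\<close> is unknown, hence the absolute value.\<close>
  define E where "E = max 0 ((Mb + D * l + \<bar>C\<bar> * l) / k)"
  show ?thesis
  proof (rule that[of E])
    fix q v \<alpha> \<beta>
    assume q: "C1_curve A t0 t1 q" and qK: "q ` {t0..t1} \<subseteq> K"
      and Mb: "integral {t0..t1} (lag_along t0 t1 q) \<le> Mb"
      and I: "t0 \<le> \<alpha>" "\<alpha> \<le> \<beta>" "\<beta> \<le> t1"
      and qB0: "\<forall>t\<in>{\<alpha>..\<beta>}. q t \<in> fst c \<and> snd c (q t) \<in> B"
      and v: "continuous_on {\<alpha>..\<beta>} v"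
      and d0: "\<forall>t\<in>{\<alpha>..\<beta>}. ((snd c \<circ> q) has_vector_derivative v t) (at t within {t0..t1})"
    have qB: "q t \<in> fst c \<and> snd c (q t) \<in> B"
      and d: "((snd c \<circ> q) has_vector_derivative v t) (at t within {t0..t1})" if "t \<in> {\<alpha>..\<beta>}" for t
      using qB0 d0 that by blast+
    have sub: "{\<alpha>..\<beta>} \<subseteq> {t0..t1}" using I by auto
    note Lc = lag_along_continuous[OF assms(1) q T]
    have "integral {\<alpha>..\<beta>} (\<lambda>t. lag_along t0 t1 q t + D) \<le> integral {t0..t1} (\<lambda>t. lag_along t0 t1 q t + D)"
    proof (rule integral_mono_subinterval)
      show "continuous_on {t0..t1} (\<lambda>t. lag_along t0 t1 q t + D)" by (intro continuous_intros Lc)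
      show "0 \<le> lag_along t0 t1 q t + D" if "t \<in> {t0..t1}" for t
        using D(2)[OF that _ velocity_tangent[OF assms(1) q that]] qK that unfolding lag_along_def by force
    qed (use I in auto)
    moreover have "integral {\<alpha>..\<beta>} (\<lambda>t. lag_along t0 t1 q t + D) = integral {\<alpha>..\<beta>} (lag_along t0 t1 q) + D * (\<beta> - \<alpha>)"
      using I by (subst integral_add) (auto intro!: integrable_continuous_real continuous_on_subset[OF Lc sub])
    moreover have "integral {t0..t1} (\<lambda>t. lag_along t0 t1 q t + D) = integral {t0..t1} (lag_along t0 t1 q) + D * l"
      using assms(1) by (subst integral_add) (auto intro!: integrable_continuous_real Lc simp: l_def)
    moreover have "0 \<le> D * (\<beta> - \<alpha>)" using D(1) I by simp
    ultimately have 1: "integral {\<alpha>..\<beta>} (lag_along t0 t1 q) \<le> Mb + D * l" using Mb by linarith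
    have "integral {\<alpha>..\<beta>} (\<lambda>t. k * (1 + norm (v t))\<^sup>2 - C) \<le> integral {\<alpha>..\<beta>} (lag_along t0 t1 q)"
    proof (rule integral_le)
      fix t assume t: "t \<in> {\<alpha>..\<beta>}"
      have tI: "t \<in> {t0..t1}" using t sub by blast
      show "k * (1 + norm (v t))\<^sup>2 - C \<le> lag_along t0 t1 q t"
        using kC[OF tI, of "snd c (q t)" "v t"] qB[OF t] lag_along_eq[OF assms(1) q tI c _ d[OF t]] by simp
    qed (intro integrable_continuous_real continuous_intros v continuous_on_subset[OF Lc sub])+
    moreover have "integral {\<alpha>..\<beta>} (\<lambda>t. k * (1 + norm (v t))\<^sup>2 - C)
        = k * integral {\<alpha>..\<beta>} (\<lambda>t. (1 + norm (v t))\<^sup>2) - C * (\<beta> - \<alpha>)"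
      using I by (subst integral_diff) (auto intro!: integrable_continuous_real continuous_intros v)
    moreover have "C * (\<beta> - \<alpha>) \<le> \<bar>C\<bar> * l" using I by (intro mult_mono) (auto simp: l_def)
    ultimately have "k * integral {\<alpha>..\<beta>} (\<lambda>t. (1 + norm (v t))\<^sup>2) \<le> Mb + D * l + \<bar>C\<bar> * l"
      using 1 by linarith
    then have "integral {\<alpha>..\<beta>} (\<lambda>t. (1 + norm (v t))\<^sup>2) \<le> (Mb + D * l + \<bar>C\<bar> * l) / k"
      using k by (simp add: pos_le_divide_eq mult.commute)
    then show "integral {\<alpha>..\<beta>} (\<lambda>t. (1 + norm (v t))\<^sup>2) \<le> E" unfolding E_def by linarith
  qed (simp add: E_def)
qed

text \<open>
  By Cauchy-Schwarz the displacement in the chart over a time \<open>\<delta>\<close> is at most \<open>sqrt (\<delta> E)\<close>, with the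
  energy \<open>E\<close> controlled by the action; so at the first exit time from the ball of radius \<open>2 R\<close> it has
  not been long enough to leave it.
\<close>

lemma stays_in_chart:
  assumes "t0 < t1" and T: "{t0..t1} \<subseteq> T" and K: "compact K"
    and c: "c \<in> A" and R: "R > 0" "cball y (3 * R) \<subseteq> snd c ` fst c"
  obtains \<delta> where "\<delta> > 0"
    "\<And>q s t. \<lbrakk>C1_curve A t0 t1 q; q ` {t0..t1} \<subseteq> K; integral {t0..t1} (lag_along t0 t1 q) \<le> Mb;
       t0 \<le> s; s \<le> t; t \<le> t1; t \<le> s + \<delta>; q s \<in> fst c; dist (snd c (q s)) y < R\<rbrakk>
     \<Longrightarrow> q t \<in> fst c \<and> snd c (q t) \<in> cball y (2 * R)"
proof -
  have B: "cball y (2 * R) \<subseteq> snd c ` fst c"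
    by (rule order_trans[OF _ R(2)]) (use R in auto)
  obtain E where E: "E \<ge> 0"
    "\<And>q v \<alpha> \<beta>. \<lbrakk>C1_curve A t0 t1 q; q ` {t0..t1} \<subseteq> K; integral {t0..t1} (lag_along t0 t1 q) \<le> Mb;
       t0 \<le> \<alpha>; \<alpha> \<le> \<beta>; \<beta> \<le> t1; \<forall>t\<in>{\<alpha>..\<beta>}. q t \<in> fst c \<and> snd c (q t) \<in> cball y (2 * R);
       continuous_on {\<alpha>..\<beta>} v;
       \<forall>t\<in>{\<alpha>..\<beta>}. ((snd c \<circ> q) has_vector_derivative v t) (at t within {t0..t1})\<rbrakk>
     \<Longrightarrow> integral {\<alpha>..\<beta>} (\<lambda>t. (1 + norm (v t))\<^sup>2) \<le> E"
    by (rule energy_bound[OF assms(1) T K c compact_cball convex_cball B, where Mb = Mb]) (rule that, assumption+)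
  \<comment> \<open>Chosen so that \<open>\<delta> * E < R\<^sup>2\<close>; the summand 1 makes the
    inequality strict and covers \<open>E = 0\<close>.\<close>
  define \<delta> where "\<delta> = R\<^sup>2 / (E + 1)"
  have \<delta>: "\<delta> > 0" using R E(1) by (simp add: \<delta>_def)
  have \<delta>E: "\<delta> * E < R\<^sup>2" using R E(1) by (simp add: \<delta>_def field_simps)
  \<comment> \<open>\<open>W\<close> is open, so there is a first time outside it. \<open>W'\<close>
    is compact, hence closed in a Hausdorff space, so at that time the curve is still in the chart,
    over the closed ball, where its coordinates and the energy bound are available.\<close>
  define W where "W = fst c \<inter> snd c -` ball y (2 * R)"
  define W' where "W' = chart_inv c ` cball y (2 * R)"
  have Wo: "open W" unfolding W_def by (rule continuous_open_preimage[OF chart(3,1)[OF c]]) simp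
  have W'c: "closed W'" unfolding W'_def
    by (intro compact_imp_closed compact_continuous_image continuous_on_subset[OF chart(4)[OF c] B]) simp
  have W'1: "p \<in> fst c \<and> snd c p \<in> cball y (2 * R)" if "p \<in> W'" for p
    using that B chart(6,7)[OF c] unfolding W'_def by force
  have WW': "W \<subseteq> W'"
  proof
    fix p assume "p \<in> W"
    then have "p = chart_inv c (snd c p)" "snd c p \<in> cball y (2 * R)" using chart(5)[OF c] by (auto simp: W_def)
    then show "p \<in> W'" unfolding W'_def by blast
  qed
  have main: "q t \<in> W"
    if q: "C1_curve A t0 t1 q" and qK: "q ` {t0..t1} \<subseteq> K" and Mb: "integral {t0..t1} (lag_along t0 t1 q) \<le> Mb"
      and st: "t0 \<le> s" "s \<le> t" "t \<le> t1" "t \<le> s + \<delta>" and qs: "q s \<in> fst c" "dist (snd c (q s)) y < R"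
    for q s t
  proof (rule ccontr)
    assume nt: "q t \<notin> W"
    have qc: "continuous_on {t0..t1} q" using q by (simp add: C1_curve_def)
    have qst: "continuous_on {s..t} q" by (rule continuous_on_subset[OF qc]) (use st in auto)
    define F where "F = {s..t} \<inter> q -` (- W)"
    have "closed F" unfolding F_def by (rule continuous_closed_preimage[OF qst]) (use Wo in auto)
    moreover have "F \<noteq> {}" using nt st by (auto simp: F_def)
    moreover have bF: "bdd_below F" unfolding F_def by (rule bdd_belowI[of _ s]) auto
    ultimately have IF: "Inf F \<in> F" using closed_contains_Inf by blast
    define \<tau> where "\<tau> = Inf F"
    have \<tau>: "s \<le> \<tau>" "\<tau> \<le> t" "q \<tau> \<notin> W" using IF by (auto simp: \<tau>_def F_def)
    have "q s \<in> W" using qs R by (simp add: W_def dist_commute)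
    then have "s < \<tau>" using \<tau> by (metis order_le_less)
    have before: "q r \<in> W" if "s \<le> r" "r < \<tau>" for r
    proof (rule ccontr)
      assume "q r \<notin> W"
      then have "r \<in> F" using that \<tau> by (auto simp: F_def)
      then have "\<tau> \<le> r" unfolding \<tau>_def by (rule cInf_lower[OF _ bF])
      then show False using that by simp
    qed
    have "closed ({s..\<tau>} \<inter> q -` W')"
      by (rule continuous_closed_preimage[OF continuous_on_subset[OF qst]]) (use \<tau> W'c in auto)
    moreover have "{s..<\<tau>} \<subseteq> {s..\<tau>} \<inter> q -` W'"
    proof
      fix r assume "r \<in> {s..<\<tau>}"
      then show "r \<in> {s..\<tau>} \<inter> q -` W'" using before[of r] WW' by auto
    qed
    ultimately have "closure {s..<\<tau>} \<subseteq> {s..\<tau>} \<inter> q -` W'" by (rule closure_minimal[rotated])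
    then have inW': "q r \<in> W'" if "r \<in> {s..\<tau>}" for r using that \<open>s < \<tau>\<close> by auto
    obtain v where v: "continuous_on {s..\<tau>} v"
      "\<And>r. r \<in> {s..\<tau>} \<Longrightarrow> ((snd c \<circ> q) has_vector_derivative v r) (at r within {t0..t1})"
      by (rule C1_curve_coordinates[OF assms(1) q c, of "{s..\<tau>}"]) (use st \<tau> inW' W'1 in auto)
    have e: "integral {s..\<tau>} (\<lambda>r. (1 + norm (v r))\<^sup>2) \<le> E"
      by (rule E(2)[OF q qK Mb _ _ _ _ v(1)]) (use st \<tau> inW' W'1 v(2) in auto)
    have "(v has_integral ((snd c \<circ> q) \<tau> - (snd c \<circ> q) s)) {s..\<tau>}"
      by (rule fundamental_theorem_of_calculus[OF \<tau>(1)], rule has_vector_derivative_within_subset[OF v(2)])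
         (use st \<tau> in auto)
    then have "(norm (snd c (q \<tau>) - snd c (q s)))\<^sup>2 = (norm (integral {s..\<tau>} v))\<^sup>2"
      by (simp add: integral_unique)
    also have "\<dots> \<le> (\<tau> - s) * integral {s..\<tau>} (\<lambda>r. (norm (v r))\<^sup>2)"
      by (rule norm_integral_square_le[OF \<tau>(1) v(1)])
    also have "\<dots> \<le> (\<tau> - s) * integral {s..\<tau>} (\<lambda>r. (1 + norm (v r))\<^sup>2)"
      using \<tau> by (intro mult_left_mono integral_le integrable_continuous_real continuous_intros v(1) power_mono) auto
    also have "\<dots> \<le> \<delta> * E" using e st \<tau> \<delta> E(1)
      by (intro mult_mono) (auto intro!: integral_nonneg integrable_continuous_real continuous_intros v(1))
    finally have "(norm (snd c (q \<tau>) - snd c (q s)))\<^sup>2 < R\<^sup>2" using \<delta>E by simp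
    then have "norm (snd c (q \<tau>) - snd c (q s)) < R" using R(1) power_less_imp_less_base[of _ 2 R] by simp
    then have "dist y (snd c (q \<tau>)) < 2 * R"
      using qs(2) dist_triangle[of y "snd c (q \<tau>)" "snd c (q s)"] by (simp add: dist_norm norm_minus_commute)
    then have "q \<tau> \<in> W" using W'1[OF inW'[of \<tau>]] \<tau> by (simp add: W_def)
    then show False using \<tau>(3) by simp
  qed
  show ?thesis
    by (rule that[OF \<delta>]) (use main WW' W'1 in blast)
qed

text \<open>The limit is recorded in coordinates because no limit curve on the manifold exists yet.
  Convergence of the action is demanded on all subintervals since the intervals used later overlap,
  while the total action is a sum over cells that do not.\<close>

definition converges_on :: "real \<Rightarrow> real \<Rightarrow> (nat \<Rightarrow> real \<Rightarrow> 'q) \<Rightarrow> real \<Rightarrow> real \<Rightarrow> bool" where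
  "converges_on t0 t1 q \<alpha> \<beta> \<longleftrightarrow> (\<exists>c\<in>A. \<exists>y u. continuous_on {\<alpha>..\<beta>} u \<and>
     (\<forall>t\<in>{\<alpha>..\<beta>}. y t \<in> snd c ` fst c \<and> (y has_vector_derivative u t) (at t within {\<alpha>..\<beta>}) \<and>
        (\<lambda>n. q n t) \<longlonglongrightarrow> chart_inv c (y t)) \<and>
     (\<forall>s t. \<alpha> \<le> s \<and> s \<le> t \<and> t \<le> \<beta> \<longrightarrow> (\<lambda>n. integral {s..t} (lag_along t0 t1 (q n)))
        \<longlonglongrightarrow> integral {s..t} (\<lambda>\<tau>. coord_lag c \<tau> (y \<tau>) (u \<tau>))))"

lemma converges_on_subseq:
  assumes "converges_on t0 t1 q \<alpha> \<beta>" "strict_mono (k :: nat \<Rightarrow> nat)"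
  shows "converges_on t0 t1 (\<lambda>n. q (k n)) \<alpha> \<beta>"
proof -
  obtain c y u where c: "c \<in> A" "continuous_on {\<alpha>..\<beta>} u"
    and 1: "\<forall>t\<in>{\<alpha>..\<beta>}. y t \<in> snd c ` fst c \<and> (y has_vector_derivative u t) (at t within {\<alpha>..\<beta>}) \<and>
        (\<lambda>n. q n t) \<longlonglongrightarrow> chart_inv c (y t)"
    and 2: "\<forall>s t. \<alpha> \<le> s \<and> s \<le> t \<and> t \<le> \<beta> \<longrightarrow> (\<lambda>n. integral {s..t} (lag_along t0 t1 (q n)))
        \<longlonglongrightarrow> integral {s..t} (\<lambda>\<tau>. coord_lag c \<tau> (y \<tau>) (u \<tau>))"
    using assms(1) unfolding converges_on_def by blast
  have "(\<lambda>n. q (k n) t) \<longlonglongrightarrow> chart_inv c (y t)" if "t \<in> {\<alpha>..\<beta>}" for t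
    using LIMSEQ_subseq_LIMSEQ[OF _ assms(2), of "\<lambda>n. q n t"] 1 that by (auto simp: o_def)
  moreover have "(\<lambda>n. integral {s..t} (lag_along t0 t1 (q (k n))))
        \<longlonglongrightarrow> integral {s..t} (\<lambda>\<tau>. coord_lag c \<tau> (y \<tau>) (u \<tau>))" if "\<alpha> \<le> s \<and> s \<le> t \<and> t \<le> \<beta>" for s t
    using LIMSEQ_subseq_LIMSEQ[OF _ assms(2), of "\<lambda>n. integral {s..t} (lag_along t0 t1 (q n))"] 2 that
    by (auto simp: o_def)
  ultimately show ?thesis unfolding converges_on_def using c 1
    by (intro bexI[OF _ c(1)] exI[of _ y] exI[of _ u]) blast
qed

lemma converges_in_chart:
  fixes q :: "nat \<Rightarrow> real \<Rightarrow> 'q"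
  assumes "t0 < t1" and T: "{t0..t1} \<subseteq> T" and K: "compact K"
    and c: "c \<in> A" and R: "R > 0" "cball y0 (3 * R) \<subseteq> snd c ` fst c"
    and q: "\<And>n. C1_curve A t0 t1 (q n)" "\<And>n. q n ` {t0..t1} \<subseteq> K"
      "\<And>n. integral {t0..t1} (lag_along t0 t1 (q n)) \<le> Mb"
    and \<epsilon>: "\<And>n. \<epsilon> n > 0" "\<epsilon> \<longlonglongrightarrow> 0"
    and near_min: "\<And>n q'. \<lbrakk>C1_curve A t0 t1 q'; q' t0 = q n t0; q' t1 = q n t1\<rbrakk> \<Longrightarrow>
      integral {t0..t1} (lag_along t0 t1 (q n)) \<le> integral {t0..t1} (lag_along t0 t1 q') + \<epsilon> n"
    and I: "t0 \<le> \<alpha>" "\<alpha> < \<beta>" "\<beta> \<le> t1"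
    and qB: "\<And>n t. t \<in> {\<alpha>..\<beta>} \<Longrightarrow> q n t \<in> fst c \<and> snd c (q n t) \<in> cball y0 (2 * R)"
  obtains k where "strict_mono (k :: nat \<Rightarrow> nat)" "converges_on t0 t1 (\<lambda>n. q (k n)) \<alpha> \<beta>"
proof -
  have sub: "{\<alpha>..\<beta>} \<subseteq> {t0..t1}" using I by auto
  have B2: "cball y0 (2 * R) \<subseteq> snd c ` fst c"
    by (rule order_trans[OF _ R(2)]) (use R in auto)
  have "\<exists>w. continuous_on {\<alpha>..\<beta>} w \<and>
      (\<forall>t\<in>{\<alpha>..\<beta>}. ((snd c \<circ> q n) has_vector_derivative w t) (at t within {t0..t1}))" for n
  proof -
    obtain w where "continuous_on {\<alpha>..\<beta>} w"
      "\<And>t. t \<in> {\<alpha>..\<beta>} \<Longrightarrow> ((snd c \<circ> q n) has_vector_derivative w t) (at t within {t0..t1})"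
      by (rule C1_curve_coordinates[OF assms(1) q(1) c sub]) (use qB in auto)
    then show ?thesis by blast
  qed
  from choice[OF allI[OF this]] obtain v where "\<forall>n. continuous_on {\<alpha>..\<beta>} (v n) \<and>
      (\<forall>t\<in>{\<alpha>..\<beta>}. ((snd c \<circ> q n) has_vector_derivative v n t) (at t within {t0..t1}))" ..
  then have v: "continuous_on {\<alpha>..\<beta>} (v n)"
    "t \<in> {\<alpha>..\<beta>} \<Longrightarrow> ((snd c \<circ> q n) has_vector_derivative v n t) (at t within {t0..t1})" for n t by blast+
  obtain E where E: "E \<ge> 0"
    "\<And>q v \<alpha> \<beta>. \<lbrakk>C1_curve A t0 t1 q; q ` {t0..t1} \<subseteq> K; integral {t0..t1} (lag_along t0 t1 q) \<le> Mb;
       t0 \<le> \<alpha>; \<alpha> \<le> \<beta>; \<beta> \<le> t1; \<forall>t\<in>{\<alpha>..\<beta>}. q t \<in> fst c \<and> snd c (q t) \<in> cball y0 (2 * R);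
       continuous_on {\<alpha>..\<beta>} v;
       \<forall>t\<in>{\<alpha>..\<beta>}. ((snd c \<circ> q) has_vector_derivative v t) (at t within {t0..t1})\<rbrakk>
     \<Longrightarrow> integral {\<alpha>..\<beta>} (\<lambda>t. (1 + norm (v t))\<^sup>2) \<le> E"
    by (rule energy_bound[OF assms(1) T K c compact_cball convex_cball B2, where Mb = Mb]) (rule that, assumption+)
  obtain Lx Lv \<kappa> k0 C0 where var: "variational {t0..t1} (cball y0 (3 * R)) (coord_lag c) Lx Lv \<kappa>"
    by (rule chart_variational[OF c compact_Icc compact_cball convex_cball T R(2)])
  interpret variational "{t0..t1}" "cball y0 (3 * R)" "coord_lag c" Lx Lv \<kappa> by (rule var)
  \<comment> \<open>Positions within \<open>2 * R\<close> of the centre, varied by at most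
    \<open>R\<close>, remain in the ball of radius \<open>3 * R\<close>.\<close>
  have inB: "z \<in> cball y0 (3 * R)" if "t \<in> {\<alpha>..\<beta>}" "norm (z - (snd c \<circ> q n) t) \<le> R" for n t z
  proof -
    have "dist y0 ((snd c \<circ> q n) t) \<le> 2 * R" using qB[OF that(1)] by simp
    moreover have "dist ((snd c \<circ> q n) t) z \<le> R" using that(2) by (simp add: dist_norm norm_minus_commute)
    ultimately show ?thesis using dist_triangle[of y0 z "(snd c \<circ> q n) t"] by simp
  qed
  have lag: "lag_along t0 t1 (q n) t = coord_lag c t ((snd c \<circ> q n) t) (v n t)" if "t \<in> {\<alpha>..\<beta>}" for n t
    using lag_along_eq[OF assms(1) q(1) _ c _ v(2)[OF that]] qB[OF that] that sub by auto
  \<comment> \<open>A variation confined to [\<alpha>, \<beta>] leaves the Lagrangian along the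
    curve unchanged outside, so near-minimality on the whole interval passes to the piece with the
    same defect \<open>\<epsilon> n\<close>.\<close>
  have minB: "integral {\<alpha>..\<beta>} (\<lambda>t. coord_lag c t ((snd c \<circ> q n) t) (v n t))
      \<le> integral {\<alpha>..\<beta>} (\<lambda>t. coord_lag c t ((snd c \<circ> q n) t + h t) (v n t + h' t)) + \<epsilon> n"
    if h: "\<And>t. t \<in> {\<alpha>..\<beta>} \<Longrightarrow> (h has_vector_derivative h' t) (at t within {\<alpha>..\<beta>})"
         "continuous_on {\<alpha>..\<beta>} h'" "h \<alpha> = 0" "h \<beta> = 0" "h' \<alpha> = 0" "h' \<beta> = 0"
         and hR: "\<And>t. t \<in> {\<alpha>..\<beta>} \<Longrightarrow> norm (h t) \<le> R" for n h h'
  proof -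
    have xh: "snd c (q n t) + h t \<in> snd c ` fst c" if "t \<in> {\<alpha>..\<beta>}" for t
      using inB[OF that, of "snd c (q n t) + h t" n] hR[OF that] R(2) by auto
    have qc: "q n t \<in> fst c" if "t \<in> {\<alpha>..\<beta>}" for t using qB[OF that] by blast
    obtain q' where q': "C1_curve A t0 t1 q'" "\<And>t. t \<notin> {\<alpha><..<\<beta>} \<Longrightarrow> q' t = q n t"
      "\<And>t. t \<in> {\<alpha>..\<beta>} \<Longrightarrow> q' t \<in> fst c \<and> snd c (q' t) = snd c (q n t) + h t"
      "\<And>t v. t \<in> {\<alpha>..\<beta>} \<Longrightarrow> ((snd c \<circ> q n) has_vector_derivative v) (at t within {t0..t1}) \<Longrightarrow>
         ((snd c \<circ> q') has_vector_derivative v + h' t) (at t within {t0..t1})"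
      "\<And>t. t \<in> {t0..t1} - {\<alpha>..\<beta>} \<Longrightarrow> velocity A t0 t1 q' t = velocity A t0 t1 (q n) t"
      using perturbed_curve[OF assms(1) q(1) I c qc h xh] by blast
    let ?L = "lag_along t0 t1 (q n)" and ?L' = "lag_along t0 t1 q'"
    have lag': "?L' t = coord_lag c t ((snd c \<circ> q n) t + h t) (v n t + h' t)" if t: "t \<in> {\<alpha>..\<beta>}" for t
      using lag_along_eq[OF assms(1) q'(1) _ c _ q'(4)[OF t v(2)[OF t]]] q'(3)[OF t] t sub by auto
    have out: "?L' t = ?L t" if t: "t \<in> {t0..t1} - {\<alpha><..<\<beta>}" for t
    proof (cases "t \<in> {\<alpha>..\<beta>}")
      case True
      then have "t = \<alpha> \<or> t = \<beta>" using t by auto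
      then show ?thesis using lag'[OF True] lag[OF True, of n] h(3-6) by auto
    next
      case False
      then show ?thesis using q'(2,5)[of t] t by (auto simp: lag_along_def)
    qed
    have Lc: "continuous_on {t0..t1} ?L" "continuous_on {t0..t1} ?L'"
      by (rule lag_along_continuous[OF assms(1) _ T], rule q(1) q'(1))+
    have split: "integral {t0..t1} f = integral {t0..\<alpha>} f + integral {\<alpha>..\<beta>} f + integral {\<beta>..t1} f"
      if f: "continuous_on {t0..t1} f" for f :: "real \<Rightarrow> real"
    proof -
      have "integral {t0..\<beta>} f + integral {\<beta>..t1} f = integral {t0..t1} f"
        using I by (intro Henstock_Kurzweil_Integration.integral_combine integrable_continuous_real f) auto
      moreover have "integral {t0..\<alpha>} f + integral {\<alpha>..\<beta>} f = integral {t0..\<beta>} f"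
        using I by (intro Henstock_Kurzweil_Integration.integral_combine integrable_continuous_real
            continuous_on_subset[OF f]) auto
      ultimately show ?thesis by simp
    qed
    have "integral {t0..t1} ?L \<le> integral {t0..t1} ?L' + \<epsilon> n"
      by (rule near_min[OF q'(1)]) (use q'(2) I in auto)
    moreover have "integral {t0..\<alpha>} ?L' = integral {t0..\<alpha>} ?L" "integral {\<beta>..t1} ?L' = integral {\<beta>..t1} ?L"
      by (rule integral_cong, rule out, use I in auto)+
    ultimately have "integral {\<alpha>..\<beta>} ?L \<le> integral {\<alpha>..\<beta>} ?L' + \<epsilon> n"
      unfolding split[OF Lc(1)] split[OF Lc(2)] by linarith
    moreover have "integral {\<alpha>..\<beta>} ?L = integral {\<alpha>..\<beta>} (\<lambda>t. coord_lag c t ((snd c \<circ> q n) t) (v n t))"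
      by (rule integral_cong) (rule lag)
    moreover have "integral {\<alpha>..\<beta>} ?L' = integral {\<alpha>..\<beta>} (\<lambda>t. coord_lag c t ((snd c \<circ> q n) t + h t) (v n t + h' t))"
      by (rule integral_cong) (rule lag')
    ultimately show ?thesis by simp
  qed
  have dv: "((snd c \<circ> q n) has_vector_derivative v n t) (at t within {\<alpha>..\<beta>})" if "t \<in> {\<alpha>..\<beta>}" for n t
    by (rule has_vector_derivative_within_subset[OF v(2)[OF that] sub])
  have En: "integral {\<alpha>..\<beta>} (\<lambda>t. (1 + norm (v n t))\<^sup>2) \<le> E" for n
    by (rule E(2)[OF q(1)[of n] q(2)[of n] q(3)[of n] I(1) less_imp_le[OF I(2)] I(3) _ v(1)[of n]]) (use qB v(2) in auto)
  obtain k y u where k: "strict_mono (k :: nat \<Rightarrow> nat)" and u: "continuous_on {\<alpha>..\<beta>} u"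
    and y: "\<And>t. t \<in> {\<alpha>..\<beta>} \<Longrightarrow> (y has_vector_derivative u t) (at t within {\<alpha>..\<beta>})"
    and lim: "\<And>t. t \<in> {\<alpha>..\<beta>} \<Longrightarrow> (\<lambda>n. (snd c \<circ> q (k n)) t) \<longlonglongrightarrow> y t"
    and act: "\<And>s t. \<lbrakk>\<alpha> \<le> s; s \<le> t; t \<le> \<beta>\<rbrakk> \<Longrightarrow>
       (\<lambda>n. integral {s..t} (\<lambda>\<tau>. coord_lag c \<tau> ((snd c \<circ> q (k n)) \<tau>) (v (k n) \<tau>)))
         \<longlonglongrightarrow> integral {s..t} (\<lambda>\<tau>. coord_lag c \<tau> (y \<tau>) (u \<tau>))"
    by (rule near_minimisers_converge[where x = "\<lambda>n. snd c \<circ> q n" and v = v and \<rho> = R and M = E and \<epsilon> = \<epsilon>,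
          OF I(2) sub R(1) dv v(1) inB En \<epsilon> minB]) (assumption | rule that)+
  \<comment> \<open>The closed ball keeps the limit inside the chart image, where
    \<open>chart_inv c\<close> is continuous.\<close>
  have yin: "y t \<in> snd c ` fst c" if t: "t \<in> {\<alpha>..\<beta>}" for t
  proof -
    have "y t \<in> cball y0 (2 * R)"
      by (rule closed_sequentially[OF closed_cball _ lim[OF t]]) (use qB[OF t] in simp)
    then show ?thesis using B2 by blast
  qed
  have qlim: "(\<lambda>n. q (k n) t) \<longlonglongrightarrow> chart_inv c (y t)" if t: "t \<in> {\<alpha>..\<beta>}" for t
  proof -
    have "isCont (chart_inv c) (y t)"
      using chart(4)[OF c] chart(2)[OF c] yin[OF t] continuous_on_eq_continuous_at by blast
    from isCont_tendsto_compose[OF this lim[OF t]]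
    show ?thesis using chart(5)[OF c] qB[OF t] by simp
  qed
  have "converges_on t0 t1 (\<lambda>n. q (k n)) \<alpha> \<beta>"
    unfolding converges_on_def
  proof (rule bexI[OF _ c], rule exI[of _ y], rule exI[of _ u], intro conjI ballI allI impI u)
    fix s t assume st: "\<alpha> \<le> s \<and> s \<le> t \<and> t \<le> \<beta>"
    have "integral {s..t} (lag_along t0 t1 (q (k n))) =
        integral {s..t} (\<lambda>\<tau>. coord_lag c \<tau> ((snd c \<circ> q (k n)) \<tau>) (v (k n) \<tau>))" for n
      by (rule integral_cong) (rule lag, use st in auto)
    then show "(\<lambda>n. integral {s..t} (lag_along t0 t1 (q (k n))))
        \<longlonglongrightarrow> integral {s..t} (\<lambda>\<tau>. coord_lag c \<tau> (y \<tau>) (u \<tau>))"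
      using act st by simp
  qed (use yin y qlim in auto)
  then show ?thesis using that k by blast
qed

text \<open>
  The intervals overlap, so that every time has a relative neighbourhood on which the limit is known
  to be \<open>C\<^sup>1\<close>; in particular no corners can occur at the grid points.
\<close>

lemma limit_of_minimising:
  fixes q :: "nat \<Rightarrow> real \<Rightarrow> 'q" and m :: nat
  assumes "t0 < t1" and T: "{t0..t1} \<subseteq> T" and "m > 0" and d: "d = (t1 - t0) / m"
    and q: "\<And>n. C1_curve A t0 t1 (q n)"
    and conv: "\<And>j. j < m \<Longrightarrow> converges_on t0 t1 q (max t0 (t0 + j * d - d)) (min t1 (t0 + j * d + 2 * d))"
  obtains p where "C1_curve A t0 t1 p" "\<And>t. t \<in> {t0..t1} \<Longrightarrow> (\<lambda>n. q n t) \<longlonglongrightarrow> p t"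
    "(\<lambda>n. integral {t0..t1} (lag_along t0 t1 (q n))) \<longlonglongrightarrow> integral {t0..t1} (lag_along t0 t1 p)"
proof -
  define s where "s j = t0 + real j * d" for j :: nat
  have d0: "d > 0" using assms by simp
  have "real m * d = t1 - t0" using assms(3) d by simp
  then have s0: "s 0 = t0" and sm: "s m = t1" and sS: "s (Suc j) = s j + d" for j
    by (simp_all add: s_def distrib_right)
  have s_mono: "s i \<le> s j" if "i \<le> j" for i j using that d0 by (simp add: s_def mult_right_mono)
  have s_in: "s j \<in> {t0..t1}" if "j \<le> m" for j
    using s_mono[of 0 j] s_mono[OF that] s0 sm by simp
  define J where "J j = {max t0 (s j - d)..min t1 (s j + 2 * d)}" for j
  define W where "W j = {s j - d<..<s j + 2 * d}" for j
  have WJ: "W j \<inter> {t0..t1} \<subseteq> J j" for j by (auto simp: W_def J_def)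
  have JI: "J j \<subseteq> {t0..t1}" for j by (auto simp: J_def)
  \<comment> \<open>Defined without charts, so that the coordinate limits on overlapping pieces
    describe one and the same curve.\<close>
  define p where "p t = lim (\<lambda>n. q n t)" for t
  have "\<forall>j\<in>{..<m}. \<exists>c y u. c \<in> A \<and> continuous_on (J j) u \<and>
     (\<forall>t\<in>J j. y t \<in> snd c ` fst c \<and> (y has_vector_derivative u t) (at t within J j) \<and>
        (\<lambda>n. q n t) \<longlonglongrightarrow> chart_inv c (y t)) \<and>
     (\<forall>r t. max t0 (s j - d) \<le> r \<and> r \<le> t \<and> t \<le> min t1 (s j + 2 * d) \<longrightarrow> (\<lambda>n. integral {r..t} (lag_along t0 t1 (q n)))
        \<longlonglongrightarrow> integral {r..t} (\<lambda>\<tau>. coord_lag c \<tau> (y \<tau>) (u \<tau>)))"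
    using conv unfolding converges_on_def J_def s_def by blast
  then obtain c y u where *: "\<forall>j\<in>{..<m}. c j \<in> A \<and> continuous_on (J j) (u j) \<and>
     (\<forall>t\<in>J j. y j t \<in> snd (c j) ` fst (c j) \<and> (y j has_vector_derivative u j t) (at t within J j) \<and>
        (\<lambda>n. q n t) \<longlonglongrightarrow> chart_inv (c j) (y j t)) \<and>
     (\<forall>r t. max t0 (s j - d) \<le> r \<and> r \<le> t \<and> t \<le> min t1 (s j + 2 * d) \<longrightarrow> (\<lambda>n. integral {r..t} (lag_along t0 t1 (q n)))
        \<longlonglongrightarrow> integral {r..t} (\<lambda>\<tau>. coord_lag (c j) \<tau> (y j \<tau>) (u j \<tau>)))"
    unfolding bchoice_iff by (elim exE) (rule that)
  have c: "c j \<in> A" and u: "continuous_on (J j) (u j)"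
    and y: "t \<in> J j \<Longrightarrow> y j t \<in> snd (c j) ` fst (c j)"
      "t \<in> J j \<Longrightarrow> (y j has_vector_derivative u j t) (at t within J j)"
      "t \<in> J j \<Longrightarrow> (\<lambda>n. q n t) \<longlonglongrightarrow> chart_inv (c j) (y j t)"
    and act: "\<lbrakk>max t0 (s j - d) \<le> r; r \<le> t; t \<le> min t1 (s j + 2 * d)\<rbrakk> \<Longrightarrow>
       (\<lambda>n. integral {r..t} (lag_along t0 t1 (q n))) \<longlonglongrightarrow> integral {r..t} (\<lambda>\<tau>. coord_lag (c j) \<tau> (y j \<tau>) (u j \<tau>))"
    if "j < m" for j r t
    using bspec[OF *, of j] that by simp_all
  have p_eq: "p t = chart_inv (c j) (y j t)" if "j < m" "t \<in> J j" for j t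
    unfolding p_def by (rule limI) (rule y(3)[OF that])
  \<comment> \<open>Near a time in the open window \<open>W j\<close> the interval
    \<open>J j\<close> and the whole time interval coincide, so derivatives within the two are the
    same. An end of \<open>J j\<close> in the interior of the time interval would give only a
    one-sided derivative.\<close>
  have dW: "(y j has_vector_derivative u j t) (at t within {t0..t1})" if "j < m" "t \<in> W j \<inter> {t0..t1}" for j t
  proof -
    have "at t within {t0..t1} = at t within J j"
      by (rule at_within_nhd[of t "W j"]) (use that WJ[of j] JI[of j] in \<open>auto simp: W_def\<close>)
    then show ?thesis using y(2)[OF that(1), of t] that WJ[of j] by auto
  qed
  have near: "C1_near A {t0..t1} p t" "((snd (c j) \<circ> p) has_vector_derivative u j t) (at t within {t0..t1})"
    if j: "j < m" and t: "t \<in> W j \<inter> {t0..t1}" for j t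
  proof -
    have o: "open (W j)" by (simp add: W_def)
    have tW: "t \<in> W j" using t by simp
    have uc: "continuous_on (W j \<inter> {t0..t1}) (u j)" by (rule continuous_on_subset[OF u[OF j] WJ])
    have yW: "y j r \<in> snd (c j) ` fst (c j)" and pW: "p r = chart_inv (c j) (y j r)"
      if "r \<in> W j \<inter> {t0..t1}" for r using y(1)[OF j] p_eq[OF j] that WJ[of j] by blast+
    note * = C1_near_chartI[OF c[OF j] o tW uc yW dW[OF j] pW]
    show "C1_near A {t0..t1} p t" by (rule *(1))
    show "((snd (c j) \<circ> p) has_vector_derivative u j t) (at t within {t0..t1})" by (rule *(2)[OF _ _ _ t])
  qed
  have cover: "\<exists>j<m. t \<in> W j" if t: "t \<in> {t0..t1}" for t
  proof -
    \<comment> \<open>The last of the first \<open>m\<close> grid points that is not after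
      \<open>t\<close>; for \<open>t = t1\<close> this selects the final cell. The cell of
      \<open>j\<close> lies in the open window \<open>W j\<close> with a margin \<open>d\<close> on
      both sides.\<close>
    define j where "j = (GREATEST j. j < m \<and> s j \<le> t)"
    have ex: "0 < m \<and> s 0 \<le> t" using assms(3) t s0 by simp
    have j: "j < m \<and> s j \<le> t"
      unfolding j_def by (rule GreatestI_nat[of _ 0 m]) (use ex in auto)
    have "t \<le> s (Suc j)"
    proof (cases "Suc j < m")
      case True
      show ?thesis
      proof (rule ccontr)
        assume "\<not> t \<le> s (Suc j)"
        then have "Suc j \<le> j" unfolding j_def
          by (intro Greatest_le_nat[of _ _ m]) (use True j_def in auto)
        then show False by simp
      qed
    next
      case False
      then have "Suc j = m" using j by simp
      then show ?thesis using sm t by simp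
    qed
    then show ?thesis using j d0 sS[of j] by (intro exI[of _ j]) (auto simp: W_def)
  qed
  have C1: "C1_curve A t0 t1 p"
    by (rule C1_curveI[OF assms(1)]) (use cover near(1) in blast)
  have plim: "(\<lambda>n. q n t) \<longlonglongrightarrow> p t" if t: "t \<in> {t0..t1}" for t
  proof -
    obtain j where j: "j < m" "t \<in> W j" using cover[OF t] by blast
    then have "t \<in> J j" using WJ[of j] t by blast
    then show ?thesis using y(3)[OF j(1)] p_eq[OF j(1)] by simp
  qed
  have step: "(\<lambda>n. integral {s j..s (Suc j)} (lag_along t0 t1 (q n))) \<longlonglongrightarrow> integral {s j..s (Suc j)} (lag_along t0 t1 p)"
    if j: "j < m" for j
  proof -
    have sj: "s j \<in> {t0..t1}" "s (Suc j) \<in> {t0..t1}" using s_in[of j] s_in[of "Suc j"] j by auto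
    have "(\<lambda>n. integral {s j..s (Suc j)} (lag_along t0 t1 (q n)))
        \<longlonglongrightarrow> integral {s j..s (Suc j)} (\<lambda>\<tau>. coord_lag (c j) \<tau> (y j \<tau>) (u j \<tau>))"
      by (rule act[OF j]) (use sj d0 sS[of j] in auto)
    moreover have "integral {s j..s (Suc j)} (lag_along t0 t1 p) =
        integral {s j..s (Suc j)} (\<lambda>\<tau>. coord_lag (c j) \<tau> (y j \<tau>) (u j \<tau>))"
    proof (rule integral_cong)
      fix \<tau> assume \<tau>: "\<tau> \<in> {s j..s (Suc j)}"
      have tW: "\<tau> \<in> W j \<inter> {t0..t1}" using \<tau> sj d0 sS[of j] by (auto simp: W_def)
      then have tJ: "\<tau> \<in> J j" using WJ[of j] by blast
      have pc: "p \<tau> \<in> fst (c j)" "snd (c j) (p \<tau>) = y j \<tau>"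
        using p_eq[OF j tJ] y(1)[OF j tJ] chart(6,7)[OF c[OF j]] by auto
      show "lag_along t0 t1 p \<tau> = coord_lag (c j) \<tau> (y j \<tau>) (u j \<tau>)"
        using lag_along_eq[OF assms(1) C1 _ c[OF j] pc(1) near(2)[OF j tW]] pc(2) tW by simp
    qed
    ultimately show ?thesis by simp
  qed
  have "(\<lambda>n. integral {t0..s j} (lag_along t0 t1 (q n))) \<longlonglongrightarrow> integral {t0..s j} (lag_along t0 t1 p)"
    if "j \<le> m" for j
    using that
  proof (induction j)
    case 0
    then show ?case by (simp add: s0)
  next
    case (Suc j)
    have split: "integral {t0..s (Suc j)} f = integral {t0..s j} f + integral {s j..s (Suc j)} f"
      if "continuous_on {t0..t1} f" for f :: "real \<Rightarrow> real"
      using s_in[of j] s_in[of "Suc j"] Suc.prems d0 sS[of j] that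
      by (intro Henstock_Kurzweil_Integration.integral_combine[symmetric] integrable_continuous_real
          continuous_on_subset[OF that]) auto
    have "(\<lambda>n. integral {t0..s j} (lag_along t0 t1 (q n)) + integral {s j..s (Suc j)} (lag_along t0 t1 (q n)))
        \<longlonglongrightarrow> integral {t0..s j} (lag_along t0 t1 p) + integral {s j..s (Suc j)} (lag_along t0 t1 p)"
      by (intro tendsto_add step Suc.IH) (use Suc.prems in auto)
    then show ?case
      by (simp only: split[OF lag_along_continuous[OF assms(1) q T]] split[OF lag_along_continuous[OF assms(1) C1 T]])
  qed
  from this[of m] show ?thesis using that[OF C1 plim] sm by simp
qed

text \<open>The length of the time windows is uniform along the sequence by
  \<open>stays_in_chart\<close>, but the chart may vary with \<open>n\<close>. Charts and windows
  are finite in number, so finitely many passages to subsequences settle both.\<close>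

theorem minimising_sequence_converges:
  fixes q :: "nat \<Rightarrow> real \<Rightarrow> 'q"
  assumes "t0 < t1" and T: "{t0..t1} \<subseteq> T" and K: "compact K"
    and q: "\<And>n. C1_curve A t0 t1 (q n)" "\<And>n. q n ` {t0..t1} \<subseteq> K"
      "\<And>n. integral {t0..t1} (lag_along t0 t1 (q n)) \<le> Mb"
    and \<epsilon>: "\<And>n. \<epsilon> n > 0" "\<epsilon> \<longlonglongrightarrow> 0"
    and near_min: "\<And>n q'. \<lbrakk>C1_curve A t0 t1 q'; q' t0 = q n t0; q' t1 = q n t1\<rbrakk> \<Longrightarrow>
      integral {t0..t1} (lag_along t0 t1 (q n)) \<le> integral {t0..t1} (lag_along t0 t1 q') + \<epsilon> n"
  obtains k p where "strict_mono (k :: nat \<Rightarrow> nat)" "C1_curve A t0 t1 p"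
    "\<And>t. t \<in> {t0..t1} \<Longrightarrow> (\<lambda>n. q (k n) t) \<longlonglongrightarrow> p t"
    "(\<lambda>n. integral {t0..t1} (lag_along t0 t1 (q (k n)))) \<longlonglongrightarrow> integral {t0..t1} (lag_along t0 t1 p)"
proof -
  obtain N :: "(('q, 'e) chart \<times> 'e \<times> real) set" where N: "finite N"
    "\<And>c y R. (c, y, R) \<in> N \<Longrightarrow> c \<in> A \<and> R > 0 \<and> cball y (3 * R) \<subseteq> snd c ` fst c"
    "\<And>p. p \<in> K \<Longrightarrow> \<exists>c y R. (c, y, R) \<in> N \<and> p \<in> fst c \<and> dist (snd c p) y < R"
    by (rule finite_chart_cover[OF K]) (rule that, assumption+)
  define S where "S z \<delta> \<longleftrightarrow> (\<forall>n s t. t0 \<le> s \<and> s \<le> t \<and> t \<le> t1 \<and> t \<le> s + \<delta> \<and>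
      q n s \<in> fst (fst z) \<and> dist (snd (fst z) (q n s)) (fst (snd z)) < snd (snd z) \<longrightarrow>
      q n t \<in> fst (fst z) \<and> snd (fst z) (q n t) \<in> cball (fst (snd z)) (2 * snd (snd z)))"
    for z :: "('q, 'e) chart \<times> 'e \<times> real" and \<delta> :: real
  \<comment> \<open>\<open>S z \<delta>\<close> survives shrinking \<open>\<delta>\<close>; with the
    reciprocal as parameter it survives enlarging, and one constant serves all balls.\<close>
  have "\<exists>C. \<forall>z\<in>N. C > 0 \<and> S z (1 / C)"
  proof (rule finite_uniform_bound[OF N(1)])
    fix z assume z: "z \<in> N"
    obtain c y R where zc: "z = (c, y, R)" by (cases z) auto
    have c: "c \<in> A" "R > 0" "cball y (3 * R) \<subseteq> snd c ` fst c" using N(2) z unfolding zc by auto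
    obtain \<delta> where \<delta>: "\<delta> > 0"
      "\<And>q s t. \<lbrakk>C1_curve A t0 t1 q; q ` {t0..t1} \<subseteq> K; integral {t0..t1} (lag_along t0 t1 q) \<le> Mb;
         t0 \<le> s; s \<le> t; t \<le> t1; t \<le> s + \<delta>; q s \<in> fst c; dist (snd c (q s)) y < R\<rbrakk>
       \<Longrightarrow> q t \<in> fst c \<and> snd c (q t) \<in> cball y (2 * R)"
      by (rule stays_in_chart[OF assms(1) T K c, where Mb = Mb]) (rule that, assumption+)
    have "S z \<delta>" unfolding S_def zc fst_conv snd_conv using \<delta>(2)[OF q] by blast
    then show "\<exists>C. C > 0 \<and> S z (1 / C)" using \<delta>(1) by (intro exI[of _ "1 / \<delta>"]) simp
  next
    fix z and C C' :: real assume C: "C > 0 \<and> S z (1 / C)" and le: "C \<le> C'"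
    then have "C' > 0" "1 / C' \<le> 1 / C" by (auto simp: frac_le)
    moreover have "S z (1 / C')" unfolding S_def
    proof (intro allI impI)
      fix n s t
      assume st: "t0 \<le> s \<and> s \<le> t \<and> t \<le> t1 \<and> t \<le> s + 1 / C' \<and>
        q n s \<in> fst (fst z) \<and> dist (snd (fst z) (q n s)) (fst (snd z)) < snd (snd z)"
      then have "t \<le> s + 1 / C" using \<open>1 / C' \<le> 1 / C\<close> by linarith
      then show "q n t \<in> fst (fst z) \<and> snd (fst z) (q n t) \<in> cball (fst (snd z)) (2 * snd (snd z))"
        using C st unfolding S_def by blast
    qed
    ultimately show "C' > 0 \<and> S z (1 / C')" by simp
  qed
  then obtain C where C: "\<forall>z\<in>N. C > 0 \<and> S z (1 / C)" by blast
  define \<delta> where "\<delta> = 1 / max C 1"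
  have "\<delta> > 0" by (simp add: \<delta>_def)
  \<comment> \<open>A window reaches from one mesh width before its grid point to two after it, so
    \<open>3 * d \<le> \<delta>\<close> keeps a curve caught at the start of the window inside one
    chart throughout.\<close>
  obtain m :: nat where m: "real m > 3 * (t1 - t0) / \<delta>" using reals_Archimedean2 by blast
  have "0 < 3 * (t1 - t0) / \<delta>" using assms(1) \<open>\<delta> > 0\<close> by simp
  then have "0 < real m" using m by linarith
  then have m0: "m > 0" by simp
  define d where "d = (t1 - t0) / m"
  have d0: "d > 0" using m0 assms(1) by (simp add: d_def)
  have d3: "3 * d \<le> \<delta>" using m m0 \<open>\<delta> > 0\<close> by (simp add: d_def field_simps)
  have jd: "t0 \<le> t0 + real j * d" "t0 + real j * d < t1" if "j < m" for j
  proof -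
    show "t0 \<le> t0 + real j * d" using d0 by simp
    have "real j * d < real m * d" using that d0 by simp
    then show "t0 + real j * d < t1" using m0 by (simp add: d_def)
  qed
  define \<alpha> where "\<alpha> j = max t0 (t0 + real j * d - d)" for j :: nat
  define \<beta> where "\<beta> j = min t1 (t0 + real j * d + 2 * d)" for j :: nat
  have ab: "t0 \<le> \<alpha> j" "\<alpha> j < \<beta> j" "\<beta> j \<le> t1" "\<beta> j \<le> \<alpha> j + \<delta>" if "j < m" for j
  proof -
    define w where "w = real j * d"
    have "0 \<le> w" "t0 + w < t1" using jd[OF that] by (simp_all add: w_def)
    then show "t0 \<le> \<alpha> j" "\<alpha> j < \<beta> j" "\<beta> j \<le> t1" "\<beta> j \<le> \<alpha> j + \<delta>"
      unfolding \<alpha>_def \<beta>_def w_def[symmetric] using d0 d3 assms(1) by auto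
  qed
  have piece: "\<exists>k'. strict_mono (k' :: nat \<Rightarrow> nat) \<and> converges_on t0 t1 (\<lambda>n. q (k (k' n))) (\<alpha> j) (\<beta> j)"
    if k: "strict_mono (k :: nat \<Rightarrow> nat)" and j: "j < m" for k j
  proof -
    have "\<exists>z\<in>N. q (k n) (\<alpha> j) \<in> fst (fst z) \<and> dist (snd (fst z) (q (k n) (\<alpha> j))) (fst (snd z)) < snd (snd z)" for n
    proof -
      have "q (k n) (\<alpha> j) \<in> K" using q(2)[of "k n"] ab[OF j] by auto
      from N(3)[OF this] obtain c y R where
        "(c, y, R) \<in> N" "q (k n) (\<alpha> j) \<in> fst c" "dist (snd c (q (k n) (\<alpha> j))) y < R" by blast
      then show ?thesis by (intro bexI[of _ "(c, y, R)"]) auto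
    qed
    then obtain f where f: "\<And>n. f n \<in> N"
      "\<And>n. q (k n) (\<alpha> j) \<in> fst (fst (f n)) \<and> dist (snd (fst (f n)) (q (k n) (\<alpha> j))) (fst (snd (f n))) < snd (snd (f n))"
      by metis
    \<comment> \<open>The ball that catches the curve at the start of the window depends on
      \<open>n\<close>; by the pigeonhole principle one ball serves infinitely many
      \<open>n\<close>.\<close>
    have "finite (range f)" using f(1) N(1) by (meson finite_subset image_subsetI)
    then obtain n0 where "infinite {n. f n = f n0}"
      using pigeonhole_infinite[of UNIV f] by auto
    then obtain k1 where k1: "strict_mono (k1 :: nat \<Rightarrow> nat)" "\<And>n. f (k1 n) = f n0"
      using infinite_enumerate[of "{n. f n = f n0}"] by auto
    obtain c y R where z: "f n0 = (c, y, R)" by (cases "f n0") auto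
    have c: "c \<in> A" "R > 0" "cball y (3 * R) \<subseteq> snd c ` fst c" using N(2) f(1)[of n0] unfolding z by auto
    have k2: "strict_mono (\<lambda>n. k (k1 n))" using k k1(1) by (simp add: strict_mono_def)
    have Sz: "S (c, y, R) (1 / C)" "C > 0" using C f(1)[of n0] unfolding z by auto
    have \<delta>C: "\<delta> \<le> 1 / C" unfolding \<delta>_def using Sz(2) by (intro frac_le) auto
    have stay: "q (k (k1 n)) t \<in> fst c \<and> snd c (q (k (k1 n)) t) \<in> cball y (2 * R)" if t: "t \<in> {\<alpha> j..\<beta> j}" for n t
    proof -
      have "q (k (k1 n)) (\<alpha> j) \<in> fst c" "dist (snd c (q (k (k1 n)) (\<alpha> j))) y < R"
        using f(2)[of "k1 n"] unfolding k1(2) z by auto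
      moreover have "t0 \<le> \<alpha> j" "\<alpha> j \<le> t" "t \<le> t1" "t \<le> \<alpha> j + 1 / C" using ab[OF j] t \<delta>C by auto
      ultimately show ?thesis using Sz(1) unfolding S_def fst_conv snd_conv by blast
    qed
    have \<epsilon>k: "(\<lambda>n. \<epsilon> (k (k1 n))) \<longlonglongrightarrow> 0" using LIMSEQ_subseq_LIMSEQ[OF \<epsilon>(2) k2] by (simp add: o_def)
    obtain k3 where "strict_mono (k3 :: nat \<Rightarrow> nat)" "converges_on t0 t1 (\<lambda>n. q (k (k1 (k3 n)))) (\<alpha> j) (\<beta> j)"
      by (rule converges_in_chart[OF assms(1) T K c q \<epsilon>(1) \<epsilon>k near_min ab(1-3)[OF j] stay]) assumption
    moreover have "strict_mono (\<lambda>n. k1 (k3 n))" using k1(1) calculation(1) by (simp add: strict_mono_def)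
    ultimately show ?thesis by (intro exI[of _ "\<lambda>n. k1 (k3 n)"]) simp
  qed
  \<comment> \<open>The windows are treated one at a time; those already settled keep converging
    along every further subsequence.\<close>
  have "\<exists>k. strict_mono (k :: nat \<Rightarrow> nat) \<and> (\<forall>i<j. converges_on t0 t1 (\<lambda>n. q (k n)) (\<alpha> i) (\<beta> i))"
    if "j \<le> m" for j
    using that
  proof (induction j)
    case 0
    show ?case by (intro exI[of _ id]) (simp add: strict_mono_def)
  next
    case (Suc j)
    then obtain k where k: "strict_mono (k :: nat \<Rightarrow> nat)"
      "\<And>i. i < j \<Longrightarrow> converges_on t0 t1 (\<lambda>n. q (k n)) (\<alpha> i) (\<beta> i)" by auto
    obtain k' where k': "strict_mono (k' :: nat \<Rightarrow> nat)" "converges_on t0 t1 (\<lambda>n. q (k (k' n))) (\<alpha> j) (\<beta> j)"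
      using piece[OF k(1), of j] Suc.prems by auto
    have "converges_on t0 t1 (\<lambda>n. q (k (k' n))) (\<alpha> i) (\<beta> i)" if "i < Suc j" for i
    proof (cases "i = j")
      case False
      then show ?thesis using converges_on_subseq[OF k(2) k'(1), of i] that by simp
    qed (use k'(2) in simp)
    moreover have "strict_mono (\<lambda>n. k (k' n))" using k(1) k'(1) by (simp add: strict_mono_def)
    ultimately show ?case by (intro exI[of _ "\<lambda>n. k (k' n)"]) simp
  qed
  from this[of m] obtain k where k: "strict_mono (k :: nat \<Rightarrow> nat)"
    "\<And>i. i < m \<Longrightarrow> converges_on t0 t1 (\<lambda>n. q (k n)) (\<alpha> i) (\<beta> i)" by auto
  show ?thesis
    by (rule limit_of_minimising[OF assms(1) T m0 d_def q(1) k(2)[unfolded \<alpha>_def \<beta>_def]])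
       (assumption | rule that k(1))+
qed

text \<open>Coercivity is used twice: along a hypothetical sequence with actions tending to minus
  infinity, and along a minimising sequence. Convergence is pointwise, so the limit keeps the
  prescribed end points.\<close>

theorem coercive_imp_attains_infimum:
  assumes "connected (UNIV :: 'q set)" "fst e0 < fst e1" and T: "{fst e0..fst e1} \<subseteq> T"
    and coercive: "coercive_on (C1_curves A e0 e1) (fst e0) (fst e1) (action A a b V e0 e1)"
  shows "attains_infimum_on (C1_curves A e0 e1) (action A a b V e0 e1)"
proof -
  define t0 where "t0 = fst e0"
  define t1 where "t1 = fst e1"
  have t: "t0 < t1" "{t0..t1} \<subseteq> T" using assms by (auto simp: t0_def t1_def)
  let ?C = "C1_curves A e0 e1" and ?S = "action A a b V e0 e1"
  have S: "?S q = integral {t0..t1} (lag_along t0 t1 q)" for q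
    by (simp add: action_def lag_along_def[abs_def] t0_def t1_def)
  have C: "q \<in> ?C \<longleftrightarrow> C1_curve A t0 t1 q \<and> q t0 = snd e0 \<and> q t1 = snd e1" for q
    by (simp add: C1_curves_def t0_def t1_def)
  have compact_range: "\<exists>K. compact K \<and> (\<forall>n. q n ` {t0..t1} \<subseteq> K)"
    if "\<And>n. q n \<in> ?C" "bdd_above (range (\<lambda>n. ?S (q n)))" for q :: "nat \<Rightarrow> real \<Rightarrow> 'q"
    by (rule coercive[unfolded coercive_on_def, folded t0_def t1_def, rule_format]) (use that in blast)
  have ne: "?C \<noteq> {}" by (rule C1_curves_nonempty[OF assms(1,2)])
  \<comment> \<open>Curves with action below \<open>- real n\<close> have actions bounded above, so
    coercivity puts them into one compact set, where the Lagrangian and hence the action is bounded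
    below.\<close>
  have bdd: "bdd_below (?S ` ?C)"
  proof (rule ccontr)
    assume "\<not> bdd_below (?S ` ?C)"
    then have "\<forall>n. \<exists>q\<in>?C. ?S q < - real n" unfolding bdd_below_def by (force simp: not_le)
    then obtain q where q: "\<And>n. q n \<in> ?C" "\<And>n. ?S (q n) < - real n" by metis
    have "?S (q n) \<le> 0" for n using q(2)[of n] of_nat_0_le_iff[of n, where 'a = real] by linarith
    then have "bdd_above (range (\<lambda>n. ?S (q n)))" by (intro bdd_aboveI[of _ 0]) auto
    then obtain K where K: "compact K" "\<And>n. q n ` {t0..t1} \<subseteq> K"
      using compact_range[of q] q(1) by auto
    obtain D where D: "D \<ge> 0" "\<And>t p \<xi>. \<lbrakk>t \<in> {t0..t1}; p \<in> K; \<xi> \<in> tangent_space A p\<rbrakk> \<Longrightarrow> - D \<le> lagrangian a b V t p \<xi>"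
      by (rule lagrangian_bounded_below[OF K(1) t(2)]) (rule that, assumption+)
    have "- (D * (t1 - t0)) \<le> ?S (q n)" for n
    proof -
      have qn: "C1_curve A t0 t1 (q n)" using q(1) C by blast
      have "integral {t0..t1} (\<lambda>t. - D) \<le> integral {t0..t1} (lag_along t0 t1 (q n))"
      proof (rule integral_le)
        show "- D \<le> lag_along t0 t1 (q n) r" if "r \<in> {t0..t1}" for r
          unfolding lag_along_def
          by (rule D(2)[OF that _ velocity_tangent[OF t(1) qn that]]) (use K(2)[of n] that in auto)
      qed (intro integrable_continuous_real continuous_intros lag_along_continuous[OF t(1) qn t(2)])+
      then show ?thesis using t(1) by (simp add: S mult.commute)
    qed
    moreover obtain n where "real n > D * (t1 - t0)" using reals_Archimedean2 by blast
    ultimately show False using q(2)[of n] by (meson less_le_not_le neg_less_iff_less order_less_le_trans order_trans)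
  qed
  define m where "m = Inf (?S ` ?C)"
  have m_le: "m \<le> ?S q" if "q \<in> ?C" for q unfolding m_def by (rule cInf_lower[OF _ bdd]) (use that in simp)
  have "\<exists>q\<in>?C. ?S q < m + 1 / real (Suc n)" for n
  proof -
    have "\<exists>x\<in>?S ` ?C. x < m + 1 / real (Suc n)"
      unfolding m_def by (rule cInf_lessD) (use ne in auto)
    then show ?thesis by blast
  qed
  then obtain q where q: "\<And>n. q n \<in> ?C" "\<And>n. ?S (q n) < m + 1 / real (Suc n)" by metis
  have q1: "?S (q n) \<le> m + 1" for n
  proof -
    have "1 / real (Suc n) \<le> 1" by simp
    then show ?thesis using q(2)[of n] by linarith
  qed
  then have "bdd_above (range (\<lambda>n. ?S (q n)))" by (intro bdd_aboveI[of _ "m + 1"]) auto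
  then obtain K where K: "compact K" "\<And>n. q n ` {t0..t1} \<subseteq> K"
    using compact_range[of q] q(1) by auto
  have qC: "C1_curve A t0 t1 (q n)" and qe: "q n t0 = snd e0" "q n t1 = snd e1" for n using q(1) C by blast+
  \<comment> \<open>A competitor with the end points of \<open>q n\<close> belongs to the class
    whose infimum is \<open>m\<close>. \<open>Suc n\<close> makes the defect positive from the
    start.\<close>
  have nm: "integral {t0..t1} (lag_along t0 t1 (q n)) \<le> integral {t0..t1} (lag_along t0 t1 q') + 1 / real (Suc n)"
    if "C1_curve A t0 t1 q'" "q' t0 = q n t0" "q' t1 = q n t1" for n q'
    using m_le[of q'] q(2)[of n] that qe[of n] unfolding C S by simp
  have \<epsilon>: "(\<lambda>n. 1 / real (Suc n)) \<longlonglongrightarrow> 0" by (rule LIMSEQ_Suc[OF lim_1_over_n])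
  obtain k p where k: "strict_mono (k :: nat \<Rightarrow> nat)" and p: "C1_curve A t0 t1 p"
    and pl: "\<And>t. t \<in> {t0..t1} \<Longrightarrow> (\<lambda>n. q (k n) t) \<longlonglongrightarrow> p t"
    and act: "(\<lambda>n. integral {t0..t1} (lag_along t0 t1 (q (k n)))) \<longlonglongrightarrow> integral {t0..t1} (lag_along t0 t1 p)"
    by (rule minimising_sequence_converges[OF t K(1) qC K(2) q1[unfolded S] _ \<epsilon> nm])
       (simp | assumption | rule that)+
  have "p t0 = snd e0" "p t1 = snd e1"
    using pl[of t0] pl[of t1] t(1) qe by (simp_all add: LIMSEQ_const_iff)
  then have pC: "p \<in> ?C" using p C by blast
  have "?S p \<le> m"
  proof -
    have "(\<lambda>n. m + 1 / real (Suc (k n))) \<longlonglongrightarrow> m + 0"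
      using LIMSEQ_subseq_LIMSEQ[OF \<epsilon> k] by (intro tendsto_add tendsto_const) (simp add: o_def)
    from LIMSEQ_le[OF act this] show ?thesis using q(2) unfolding S by (auto simp: less_imp_le)
  qed
  then have "?S p \<le> ?S q" if "q \<in> ?C" for q using m_le[OF that] by linarith
  then have "ereal (?S p) = (INF q\<in>?C. ereal (?S q))"
    by (intro antisym INF_greatest INF_lower[OF pC]) auto
  then show ?thesis unfolding attains_infimum_on_def using pC by blast
qed

end

theorem corollary4p28:
  fixes r :: nat
    and A :: "('q::t2_space, 'e::euclidean_space) chart set"
    and T :: "real set"
    and a :: "real \<Rightarrow> 'q \<Rightarrow> ('q, 'e) tvec \<Rightarrow> ('q, 'e) tvec \<Rightarrow> real"
    and b :: "real \<Rightarrow> 'q \<Rightarrow> ('q, 'e) tvec \<Rightarrow> real"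
    and V :: "real \<Rightarrow> 'q \<Rightarrow> real"
  assumes "r \<ge> 2"
    and "Ck_atlas (r + 1) A"
    and "paracompact_space (euclidean :: 'q topology)"
    and "connected (UNIV :: 'q set)"
    and "is_interval T" and "open T"
    and "Cr_riemannian_metric r A T a"
    and "Cr_one_form r A T b"
    and "Cr_function r A T V"
    and "\<forall>e0 \<in> T \<times> UNIV. \<forall>e1 \<in> T \<times> UNIV. fst e0 < fst e1 \<longrightarrow>
           coercive_on (C1_curves A e0 e1) (fst e0) (fst e1) (action A a b V e0 e1)"
  shows "\<forall>e0 \<in> T \<times> UNIV. \<forall>e1 \<in> T \<times> UNIV. fst e0 < fst e1 \<longrightarrow>
           attains_infimum_on (C1_curves A e0 e1) (action A a b V e0 e1)"
proof -
  have Ck1: "Ck_on 1 f S" if "Ck_on (r + 1) f S" for f :: "'e \<Rightarrow> 'e" and S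
    by (rule Ck_on_le[OF that]) simp
  have Ck2: "Ck_on 2 f S" if "Ck_on r f S" for f :: "real \<times> 'e \<Rightarrow> real" and S
    by (rule Ck_on_le[OF that]) (rule assms(1))
  \<comment> \<open>Class C^2 of the data, secured by \<open>r \<ge> 2\<close>, is the source of the
    quadratic remainder of the Lagrangian; the atlas enters through the first derivatives of its
    transition maps.\<close>
  interpret lagrangian_system A T a b V
  proof
    show "Ck_atlas 1 A" using assms(2) Ck1 unfolding Ck_atlas_def by blast
    show "Cr_riemannian_metric 2 A T a"
      using assms(7) Ck2 unfolding Cr_riemannian_metric_def by blast
    show "Cr_one_form 2 A T b" using assms(8) Ck2 unfolding Cr_one_form_def by blast
    show "Cr_function 2 A T V" using assms(9) Ck2 unfolding Cr_function_def by blast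
  qed
  show ?thesis
  proof (intro ballI impI)
    fix e0 e1 :: "real \<times> 'q" assume e: "e0 \<in> T \<times> UNIV" "e1 \<in> T \<times> UNIV" "fst e0 < fst e1"
    have "{fst e0..fst e1} \<subseteq> T"
    proof
      fix t assume "t \<in> {fst e0..fst e1}"
      then show "t \<in> T" using assms(5) e(1,2) mem_is_interval_1_I[of T "fst e0" "fst e1" t] by auto
    qed
    then show "attains_infimum_on (C1_curves A e0 e1) (action A a b V e0 e1)"
      using assms(4,10) e by (intro coercive_imp_attains_infimum) auto
  qed
qed

end
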